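(* Let $M$ be a $1$-admissible half-flat spin $\frac32$ Grassmann manifold and let $\nu:W=\mathbb C^r\times M\to M$ be a trivial bundle. Let $\nabla$ be an almost $1$-partially flat connection in $\pi^*\nu$ (defined over all of $S_H$), and let $C^e_{\alpha\beta\gamma}$ be the matrix-valued functions on $M$, symmetric in $\alpha,\beta,\gamma$, such that the potentials of $\nabla$ with respect to a central frame satisfy $C(X^e_{+++})=u_+^\alpha u_+^\beta u_+^\gamma C^e_{\alpha\beta\gamma}$ and $C(X^e_+)=u_+^\alpha u_+^\beta u_-^\gamma C^e_{\alpha\beta\gamma}$. Define a connection $\widehat\nabla$ in $\pi^*\nu$ by $$\widehat\nabla_{X^e_{+++}}=X^e_{+++}+u_+^\alpha u_+^\beta u_+^\gamma C^e_{\alpha\beta\gamma},\quad \widehat\nabla_{X^e_+}=X^e_++u_+^\alpha u_+^\beta u_-^\gamma C^e_{\alpha\beta\gamma},$$ $$\widehat\nabla_{X^e_-}=X^e_-+u_-^\alpha u_-^\beta u_+^\gamma C^e_{\alpha\beta\gamma},\quad \widehat\nabla_{X^e_{---}}=X^e_{---}+u_-^\alpha u_-^\beta u_-^\gamma C^e_{\alpha\beta\gamma},$$ $$\widehat\nabla_{\partial_{++}}=\partial_{++},\quad \widehat\nabla_{\partial_{--}}=\partial_{--},\quad \widehat\nabla_{\partial_0}=\partial_0 .$$ Then $\widehat\nabla$ is a $1$-partially flat connection in $\pi^*\nu$ over $S_H$, and it is the pull-back of the following $1$-partially flat connection $\nabla^M$ in $\nu$ over $M$: $$\nabla^M_{X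^e_{\alpha\beta\gamma}}=X^e_{\alpha\beta\gamma}+C^e_{\alpha\beta\gamma}.$$
   Context: All objects are holomorphic; the construction is local in $M$. A half-flat spin $\frac32$ Grassmann manifold is a complex manifold $M$ with $T^*M\cong E\otimes S^3H$, where $E,H$ are holomorphic vector bundles, $H$ of rank $2$, with holomorphic connections $\nabla^E$ and $\nabla^H$, $\nabla^H$ preserving a form $\omega_H\in\Gamma(\wedge^2H)$ (symplectic on $H^*$), such that the connection $\nabla^F$ induced on $F=S^3H$ is flat; the Grassmann connection is $\nabla^E\otimes\mathrm{Id}+\mathrm{Id}\otimes\nabla^F$, with torsion $T$. $\pi:S_H\to M$ is the $\mathrm{Sp}(1,\mathbb C)$-principal bundle of pairs $(h_+,h_-)$ in fibres of $H^*$ with $\omega_H(h_+,h_-)=1$; a fixed parallel symplectic frame $(h_1,h_2)$ of $H^*$ identifies $S_H=M\times\mathrm{Sp}(1,\mathbb C)$ via $h_\pm=u_\pm^\alpha h_\alpha$. Vertical fields: $\partial_{++}=u_+^\alpha\frac{\partial}{\partial u_-^\alpha}$, $\partial_{--}=u_-^\alpha\frac{\partial}{\partial u_+^\alpha}$, $\partial_0=u_+^\alpha\frac{\partial}{\partial u_+^\alpha}-u_-^\alpha\frac{\partial}{\partial u_-^\alpha}$. For a section $e$ of $E^*$ let $X^e_{\alpha\beta\gamma}=e\otimes h_\alpha h_\beta h_\gamma$, with horizontal lift $\widetilde{X^e_{\alpha\beta\gamma}}$ to $S_H$, and set $X^e_{+++}=u_+^\alpha u_+^\beta u_+^\gamma\widetilde{X^e_{\alpha\beta\gamma}}$,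 $X^e_+=u_+^\alpha u_+^\beta u_-^\gamma\widetilde{X^e_{\alpha\beta\gamma}}$, $X^e_-=u_-^\alpha u_-^\beta u_+^\gamma\widetilde{X^e_{\alpha\beta\gamma}}$, $X^e_{---}=u_-^\alpha u_-^\beta u_-^\gamma\widetilde{X^e_{\alpha\beta\gamma}}$. $\mathcal D_{3\pm}$, $\mathcal D_\pm$ are spanned by the $X^e_{\pm\pm\pm}$, $X^e_\pm$. $M$ is $1$-admissible if the distributions $\mathcal D^1_{(\pm)}=\mathcal D_{3\pm}\oplus\mathcal D_\pm$ satisfy $T(\mathcal D^1_{(\pm)},\mathcal D^1_{(\pm)})\subset\mathcal D^1_{(\pm)}$ ($T$ lifted horizontally). The curvature of a connection over $M$ has components $\overset{(i)}F$, $i=0,1,2,3$, with values in $\mathrm{End}\,W$, in $\wedge^2E\otimes S^{6}H$, $S^2E\otimes S^4H$, $\wedge^2E\otimes S^2H$, $S^2E$ respectively, according to the decomposition $\wedge^2T^*M=\wedge^2E\otimes(S^6H\oplus\omega_H^2S^2H)\oplus S^2E\otimes(\omega_HS^4H\oplus\omega_H^3)$; it is $1$-partially flat if $\overset{(0)}F=\overset{(1)}F=\overset{(2)}F=0$. A connection over $S_H$ is $1$-partially flat if $F(X^e_{\pm\pm\pm},X^{e'}_{\pm\pm\pm})=F(X^{e'}_{\pm\pm\pm},X^e_\pm)=F(X^e_\pm,X^{e'}_\pm)=F(X^e_{\pm\pm\pm},X^{e'}_\mp)=0$, $F(X^e_{+++},X^{e'}_{---})=36\,\overset{(3)}F{}^{(ee')}$,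 $F(X^e_+,X^{e'}_-)=-12\,\overset{(3)}F{}^{(ee')}$ for some $\overset{(3)}F{}^{(ee')}$ symmetric in $e,e'$, and $F(v,\cdot)=0$ for all vertical $v$. A connection over $S_H$ is almost $1$-partially flat if $F(X^e_{+++},X^{e'}_{+++})=F(X^e_{+++},X^{e'}_+)=F(X^e_+,X^{e'}_+)=0$, $F(X^e_{+++},v)=F(X^e_\pm,v)=0$ for all vertical $v$, and $F(\partial_{++},\cdot)=F(\partial_0,\cdot)=0$. A central frame is a frame of $\pi^*\nu$ parallel along the fibres of $\pi$; the potential $C$ is the connection $1$-form in it. For an almost $1$-partially flat connection the potentials $C(X^e_{+++})$, $C(X^e_+)$ in a central frame are of the form stated in the claim. *)

theory Defs
  imports "HOL-Analysis.Analysis" "HOL-Library.Multiset"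
begin

section \<open>Complex normed spaces and holomorphic maps\<close>

class complex_normed = real_normed_vector +
  fixes scaleC :: "complex \<Rightarrow> 'a \<Rightarrow> 'a" (infixr "*\<^sub>C" 75)
  assumes scaleC_of_real: "complex_of_real r *\<^sub>C x = r *\<^sub>R x"
    and scaleC_add_left: "(a + b) *\<^sub>C x = a *\<^sub>C x + b *\<^sub>C x"
    and scaleC_add_right: "a *\<^sub>C (x + y) = a *\<^sub>C x + a *\<^sub>C y"
    and scaleC_scaleC: "a *\<^sub>C b *\<^sub>C x = (a * b) *\<^sub>C x"
    and norm_scaleC: "norm (a *\<^sub>C x) = cmod a * norm x"

instantiation complex :: complex_normed
begin
definition scaleC_complex :: "complex \<Rightarrow> complex \<Rightarrow> complex" where
  "scaleC_complex a x = a * x"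
instance
  by standard (simp_all add: scaleC_complex_def algebra_simps scaleR_conv_of_real norm_mult)
end

instantiation vec :: (complex_normed, finite) complex_normed
begin
definition scaleC_vec :: "complex \<Rightarrow> 'a ^ 'b \<Rightarrow> 'a ^ 'b" where
  "scaleC_vec a x = (\<chi> i. a *\<^sub>C (x $ i))"
instance
  by standard
    (simp_all add: scaleC_vec_def vec_eq_iff scaleC_of_real scaleC_add_left scaleC_add_right
      scaleC_scaleC norm_vec_def norm_scaleC L2_set_right_distrib)
end

instantiation prod :: (complex_normed, complex_normed) complex_normed
begin
definition scaleC_prod :: "complex \<Rightarrow> 'a \<times> 'b \<Rightarrow> 'a \<times> 'b" where
  "scaleC_prod a x = (a *\<^sub>C fst x, a *\<^sub>C snd x)"
instance
  by standard
    (simp_all add: scaleC_prod_def prod_eq_iff scaleC_of_real scaleC_add_left scaleC_add_right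
      scaleC_scaleC norm_prod_def norm_scaleC power_mult_distrib real_sqrt_mult
      flip: distrib_left)
end

definition clinear_on :: "'a::complex_normed set \<Rightarrow> ('a \<Rightarrow> 'b::complex_normed) \<Rightarrow> bool" where
  "clinear_on T f \<longleftrightarrow>
     (\<forall>v\<in>T. \<forall>w\<in>T. f (v + w) = f v + f w) \<and> (\<forall>c. \<forall>v\<in>T. f (c *\<^sub>C v) = c *\<^sub>C f v)"

abbreviation clinear_map :: "('a::complex_normed \<Rightarrow> 'b::complex_normed) \<Rightarrow> bool" where
  "clinear_map \<equiv> clinear_on UNIV"

text \<open>Used for open sets and for products of an open set with the complex submanifold
  \<open>Sp1C\<close> below, hence the derivative within \<open>S\<close>.\<close>

definition holo_on :: "'a::complex_normed set \<Rightarrow> ('a \<Rightarrow> 'b::complex_normed) \<Rightarrow> bool" where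
  "holo_on S f \<longleftrightarrow> (\<forall>z\<in>S. \<exists>D. clinear_map D \<and> (f has_derivative D) (at z within S))"


section \<open>Complex manifolds\<close>

text \<open>An atlas is indexed by the points: \<open>\<kappa> p\<close> is a chart (domain and coordinate map) around
  \<open>p\<close>.  Through this chart the tangent space at \<open>p\<close> is identified with the model space, so that a
  tangent vector at \<open>p\<close> is a vector of the model space and a vector field is a function from
  points to the model space.\<close>

type_synonym ('a, 'b) atlas = "'a \<Rightarrow> 'a set \<times> ('a \<Rightarrow> 'b)"

definition chart_dom :: "('a, 'b) atlas \<Rightarrow> 'a \<Rightarrow> 'a set" where
  "chart_dom \<kappa> p = fst (\<kappa> p)"

definition chart_map :: "('a, 'b) atlas \<Rightarrow> 'a \<Rightarrow> 'a \<Rightarrow> 'b" where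
  "chart_map \<kappa> p = snd (\<kappa> p)"

definition chart_img :: "('a, 'b) atlas \<Rightarrow> 'a \<Rightarrow> 'b set" where
  "chart_img \<kappa> p = chart_map \<kappa> p ` chart_dom \<kappa> p"

definition chart_inv :: "('a, 'b) atlas \<Rightarrow> 'a \<Rightarrow> 'b \<Rightarrow> 'a" where
  "chart_inv \<kappa> p = inv_into (chart_dom \<kappa> p) (chart_map \<kappa> p)"

definition complex_manifold ::
  "('a::{t2_space, second_countable_topology}, complex ^ 'm::finite) atlas \<Rightarrow> bool" where
  "complex_manifold \<kappa> \<longleftrightarrow>
     (\<forall>p. open (chart_dom \<kappa> p) \<and> p \<in> chart_dom \<kappa> p \<and> open (chart_img \<kappa> p) \<and>
          homeomorphism (chart_dom \<kappa> p) (chart_img \<kappa> p) (chart_map \<kappa> p) (chart_inv \<kappa> p)) \<and>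
     (\<forall>p q. holo_on (chart_map \<kappa> p ` (chart_dom \<kappa> p \<inter> chart_dom \<kappa> q))
                    (chart_map \<kappa> q \<circ> chart_inv \<kappa> p))"

text \<open>Complex differentiability at \<open>p\<close>, and the derivative of \<open>f\<close> along a tangent vector at \<open>p\<close>,
  both computed in the chart \<open>\<kappa> p\<close>.  When the chart image is not open in the model space, the
  derivative is determined only on tangent vectors and is only used there.\<close>

definition cdiff_at :: "('a, 'b::complex_normed) atlas \<Rightarrow> 'a \<Rightarrow> ('a \<Rightarrow> 'c::complex_normed) \<Rightarrow> bool" where
  "cdiff_at \<kappa> p f \<longleftrightarrow>
     (\<exists>D. clinear_map D \<and>
          (f \<circ> chart_inv \<kappa> p has_derivative D) (at (chart_map \<kappa> p p) within chart_img \<kappa> p))"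

definition dir :: "('a, 'b::complex_normed) atlas \<Rightarrow> ('a \<Rightarrow> 'c::complex_normed) \<Rightarrow> 'a \<Rightarrow> 'b \<Rightarrow> 'c" where
  "dir \<kappa> f p v =
     frechet_derivative (f \<circ> chart_inv \<kappa> p) (at (chart_map \<kappa> p p) within chart_img \<kappa> p) v"

definition holo_fun :: "('a, 'b::complex_normed) atlas \<Rightarrow> 'a set \<Rightarrow> ('a \<Rightarrow> 'c::complex_normed) \<Rightarrow> bool" where
  "holo_fun \<kappa> V f \<longleftrightarrow> (\<forall>p\<in>V. cdiff_at \<kappa> p f)"

text \<open>The components of the vector field \<open>X\<close> in the fixed chart \<open>\<kappa> p\<close>, as functions of a
  point \<open>q\<close> near \<open>p\<close>.\<close>

definition field_comp :: "('a, 'b::complex_normed) atlas \<Rightarrow> 'a \<Rightarrow> ('a \<Rightarrow> 'b) \<Rightarrow> 'a \<Rightarrow> 'b" where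
  "field_comp \<kappa> p X q = dir \<kappa> (chart_map \<kappa> p) q (X q)"

text \<open>\<open>T p\<close> is the tangent space at \<open>p\<close> inside the model space.\<close>

definition holo_field ::
  "('a, 'b::complex_normed) atlas \<Rightarrow> ('a \<Rightarrow> 'b set) \<Rightarrow> 'a set \<Rightarrow> ('a \<Rightarrow> 'b) \<Rightarrow> bool" where
  "holo_field \<kappa> T V X \<longleftrightarrow> (\<forall>p\<in>V. X p \<in> T p \<and> cdiff_at \<kappa> p (field_comp \<kappa> p X))"

definition bracket ::
  "('a, 'b::complex_normed) atlas \<Rightarrow> ('a \<Rightarrow> 'b) \<Rightarrow> ('a \<Rightarrow> 'b) \<Rightarrow> 'a \<Rightarrow> 'b" where
  "bracket \<kappa> X Y p = dir \<kappa> (field_comp \<kappa> p Y) p (X p) - dir \<kappa> (field_comp \<kappa> p X) p (Y p)"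


section \<open>Connections\<close>

text \<open>A connection in a trivial bundle of rank \<open>r\<close> is given by its potential in the
  standard frame, a holomorphic matrix-valued 1-form on the manifold with point set \<open>S\<close>:
  \<open>\<nabla>\<^sub>X s = X s + A(X) s\<close>.\<close>

definition connection_form ::
  "('a::topological_space, 'b::complex_normed) atlas \<Rightarrow> ('a \<Rightarrow> 'b set) \<Rightarrow> 'a set \<Rightarrow>
   ('a \<Rightarrow> 'b \<Rightarrow> complex ^ 'r::finite ^ 'r) \<Rightarrow> bool" where
  "connection_form \<kappa> T S A \<longleftrightarrow>
     (\<forall>p\<in>S. clinear_on (T p) (A p)) \<and>
     (\<forall>V X. openin (top_of_set S) V \<and> holo_field \<kappa> T V X \<longrightarrow> holo_fun \<kappa> V (\<lambda>q. A q (X q)))"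

definition curvature ::
  "('a, 'b::complex_normed) atlas \<Rightarrow> ('a \<Rightarrow> 'b \<Rightarrow> complex ^ 'r::finite ^ 'r) \<Rightarrow>
   ('a \<Rightarrow> 'b) \<Rightarrow> ('a \<Rightarrow> 'b) \<Rightarrow> 'a \<Rightarrow> complex ^ 'r ^ 'r" where
  "curvature \<kappa> A X Y p =
     dir \<kappa> (\<lambda>q. A q (Y q)) p (X p) - dir \<kappa> (\<lambda>q. A q (X q)) p (Y p)
     + (A p (X p) ** A p (Y p) - A p (Y p) ** A p (X p)) - A p (bracket \<kappa> X Y p)"

text \<open>A holomorphic vector bundle of rank \<open>k\<close>: a linear identification of each fibre with
  \<open>k\<close>-dimensional complex space is chosen, without any regularity in the base point, and
  \<open>\<beta> x\<close> is a local trivialisation around \<open>x\<close> (a domain and fibrewise isomorphisms), the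
  transition maps being holomorphic.\<close>

type_synonym ('x, 'k) vbundle = "'x \<Rightarrow> 'x set \<times> ('x \<Rightarrow> complex ^ 'k ^ 'k)"

definition vector_bundle ::
  "('x::topological_space, complex ^ 'm::finite) atlas \<Rightarrow> ('x, 'k::finite) vbundle \<Rightarrow> bool" where
  "vector_bundle \<kappa> \<beta> \<longleftrightarrow>
     (\<forall>x. open (fst (\<beta> x)) \<and> x \<in> fst (\<beta> x) \<and> (\<forall>y\<in>fst (\<beta> x). invertible (snd (\<beta> x) y))) \<and>
     (\<forall>x x'. holo_fun \<kappa> (fst (\<beta> x) \<inter> fst (\<beta> x'))
                (\<lambda>y. snd (\<beta> x') y ** matrix_inv (snd (\<beta> x) y)))"

definition holo_section ::
  "('x, complex ^ 'm::finite) atlas \<Rightarrow> ('x, 'k::finite) vbundle \<Rightarrow> 'x set \<Rightarrow> ('x \<Rightarrow> complex ^ 'k) \<Rightarrow> bool" where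
  "holo_section \<kappa> \<beta> V s \<longleftrightarrow> (\<forall>x\<in>V. cdiff_at \<kappa> x (\<lambda>y. snd (\<beta> x) y *v s y))"

abbreviation full_tangent :: "'x \<Rightarrow> 'b set" where
  "full_tangent \<equiv> (\<lambda>_. UNIV)"

text \<open>A holomorphic connection as a covariant derivative, \<open>N s x v = \<nabla>\<^sub>v s\<close> at \<open>x\<close>, in a bundle
  whose holomorphic sections over \<open>U\<close> are described by \<open>Sec U\<close>.\<close>

definition covariant_derivative ::
  "('x::topological_space, complex ^ 'm::finite) atlas \<Rightarrow> ('x set \<Rightarrow> ('x \<Rightarrow> 'v::complex_normed) \<Rightarrow> bool) \<Rightarrow>
   (('x \<Rightarrow> 'v) \<Rightarrow> 'x \<Rightarrow> complex ^ 'm \<Rightarrow> 'v) \<Rightarrow> bool" where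
  "covariant_derivative \<kappa> Sec N \<longleftrightarrow>
     (\<forall>U s. open U \<and> Sec U s \<longrightarrow>
        (\<forall>x\<in>U. clinear_map (N s x)) \<and>
        (\<forall>s'. Sec U s' \<longrightarrow> (\<forall>x\<in>U. \<forall>v. N (\<lambda>y. s y + s' y) x v = N s x v + N s' x v)) \<and>
        (\<forall>s'. (\<forall>y\<in>U. s' y = s y) \<longrightarrow> (\<forall>x\<in>U. N s' x = N s x)) \<and>
        (\<forall>f :: 'x \<Rightarrow> complex. holo_fun \<kappa> U f \<longrightarrow>
           (\<forall>x\<in>U. \<forall>v. N (\<lambda>y. f y *\<^sub>C s y) x v = dir \<kappa> f x v *\<^sub>C s x + f x *\<^sub>C N s x v)) \<and>
        (\<forall>X. holo_field \<kappa> full_tangent U X \<longrightarrow> Sec U (\<lambda>y. N s y (X y))))"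

definition curvature_op ::
  "('x, complex ^ 'm::finite) atlas \<Rightarrow> (('x \<Rightarrow> 'v::complex_normed) \<Rightarrow> 'x \<Rightarrow> complex ^ 'm \<Rightarrow> 'v) \<Rightarrow>
   ('x \<Rightarrow> complex ^ 'm) \<Rightarrow> ('x \<Rightarrow> complex ^ 'm) \<Rightarrow> ('x \<Rightarrow> 'v) \<Rightarrow> 'x \<Rightarrow> 'v" where
  "curvature_op \<kappa> N X Y s x =
     N (\<lambda>y. N s y (Y y)) x (X x) - N (\<lambda>y. N s y (X y)) x (Y x) - N s x (bracket \<kappa> X Y x)"


section \<open>Half-flat spin 3/2 Grassmann manifolds\<close>

text \<open>The symmetric cube of 2-dimensional complex space is the space of binary cubic forms, given by
  their coefficients; \<open>sym3 f g k\<close> is the product of three linear forms.\<close>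

definition sym3 :: "complex ^ 2 \<Rightarrow> complex ^ 2 \<Rightarrow> complex ^ 2 \<Rightarrow> complex ^ 4" where
  "sym3 f g k =
     vector [f $ 1 * g $ 1 * k $ 1,
             f $ 1 * g $ 1 * k $ 2 + f $ 1 * g $ 2 * k $ 1 + f $ 2 * g $ 1 * k $ 1,
             f $ 1 * g $ 2 * k $ 2 + f $ 2 * g $ 1 * k $ 2 + f $ 2 * g $ 2 * k $ 1,
             f $ 2 * g $ 2 * k $ 2]"

definition tensor :: "complex ^ 'p::finite \<Rightarrow> complex ^ 4 \<Rightarrow> complex ^ 4 ^ 'p" where
  "tensor e t = (\<chi> a. e $ a *s t)"

text \<open>The bundles stored are the duals \<open>E*\<close> and \<open>H*\<close>, with the connections induced there by
  \<open>\<nabla>\<^sup>E\<close> and \<open>\<nabla>\<^sup>H\<close>; \<open>soldering\<close> is the isomorphism from \<open>E* \<otimes> S\<^sup>3H*\<close> to \<open>TM\<close> dual to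
  \<open>T*M \<cong> E \<otimes> S\<^sup>3H\<close>.\<close>

record ('x, 'm, 'p) grassmann =
  atl :: "('x, complex ^ 'm) atlas"
  bunE :: "('x, 'p) vbundle"
  nablaE :: "('x \<Rightarrow> complex ^ 'p) \<Rightarrow> 'x \<Rightarrow> complex ^ 'm \<Rightarrow> complex ^ 'p"
  bunH :: "('x, 2) vbundle"
  nablaH :: "('x \<Rightarrow> complex ^ 2) \<Rightarrow> 'x \<Rightarrow> complex ^ 'm \<Rightarrow> complex ^ 2"
  omegaH :: "'x \<Rightarrow> complex ^ 2 \<Rightarrow> complex ^ 2 \<Rightarrow> complex"
  soldering :: "'x \<Rightarrow> complex ^ 4 ^ 'p \<Rightarrow> complex ^ 'm"
  nablaT :: "('x \<Rightarrow> complex ^ 'm) \<Rightarrow> 'x \<Rightarrow> complex ^ 'm \<Rightarrow> complex ^ 'm"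

abbreviation secE :: "('x::topological_space, 'm::finite, 'p::finite) grassmann \<Rightarrow> 'x set \<Rightarrow> ('x \<Rightarrow> complex ^ 'p) \<Rightarrow> bool" where
  "secE G \<equiv> holo_section (atl G) (bunE G)"

abbreviation secH :: "('x::topological_space, 'm::finite, 'p::finite) grassmann \<Rightarrow> 'x set \<Rightarrow> ('x \<Rightarrow> complex ^ 2) \<Rightarrow> bool" where
  "secH G \<equiv> holo_section (atl G) (bunH G)"

abbreviation secT :: "('x::topological_space, 'm::finite, 'p::finite) grassmann \<Rightarrow> 'x set \<Rightarrow> ('x \<Rightarrow> complex ^ 'm) \<Rightarrow> bool" where
  "secT G \<equiv> holo_field (atl G) full_tangent"

definition symplectic_form :: "('x::topological_space, 'm::finite, 'p::finite) grassmann \<Rightarrow> bool" where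
  "symplectic_form G \<longleftrightarrow>
     (\<forall>x f. clinear_map (omegaH G x f)) \<and>
     (\<forall>x f g. omegaH G x g f = - omegaH G x f g) \<and>
     (\<forall>x f. f \<noteq> 0 \<longrightarrow> (\<exists>g. omegaH G x f g \<noteq> 0)) \<and>
     (\<forall>U f g. open U \<and> secH G U f \<and> secH G U g \<longrightarrow> holo_fun (atl G) U (\<lambda>x. omegaH G x (f x) (g x)))"

definition preserves_omegaH :: "('x::topological_space, 'm::finite, 'p::finite) grassmann \<Rightarrow> bool" where
  "preserves_omegaH G \<longleftrightarrow>
     (\<forall>U f g. open U \<and> secH G U f \<and> secH G U g \<longrightarrow>
        (\<forall>x\<in>U. \<forall>v. dir (atl G) (\<lambda>y. omegaH G y (f y) (g y)) x v =
           omegaH G x (nablaH G f x v) (g x) + omegaH G x (f x) (nablaH G g x v)))"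

text \<open>The connection induced on the symmetric cube acts on products as a derivation, hence so does
  its curvature.\<close>

definition induced_cube_flat :: "('x::topological_space, 'm::finite, 'p::finite) grassmann \<Rightarrow> bool" where
  "induced_cube_flat G \<longleftrightarrow>
     (\<forall>U X Y f g k. open U \<and> secT G U X \<and> secT G U Y \<and> secH G U f \<and> secH G U g \<and> secH G U k \<longrightarrow>
        (\<forall>x\<in>U. let R = curvature_op (atl G) (nablaH G) X Y in
           sym3 (R f x) (g x) (k x) + sym3 (f x) (R g x) (k x) + sym3 (f x) (g x) (R k x) = 0))"

definition soldering_iso :: "('x::topological_space, 'm::finite, 'p::finite) grassmann \<Rightarrow> bool" where
  "soldering_iso G \<longleftrightarrow>
     (\<forall>x. clinear_map (soldering G x) \<and> bij (soldering G x)) \<and>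
     (\<forall>U e f g k. open U \<and> secE G U e \<and> secH G U f \<and> secH G U g \<and> secH G U k \<longrightarrow>
        secT G U (\<lambda>x. soldering G x (tensor (e x) (sym3 (f x) (g x) (k x)))))"

text \<open>\<open>nablaT\<close> is the Grassmann connection \<open>\<nabla>\<^sup>E \<otimes> Id + Id \<otimes> \<nabla>\<^sup>F\<close>, transported to \<open>TM\<close>.\<close>

definition grassmann_connection :: "('x::topological_space, 'm::finite, 'p::finite) grassmann \<Rightarrow> bool" where
  "grassmann_connection G \<longleftrightarrow>
     covariant_derivative (atl G) (secT G) (nablaT G) \<and>
     (\<forall>U e f g k. open U \<and> secE G U e \<and> secH G U f \<and> secH G U g \<and> secH G U k \<longrightarrow>
        (\<forall>x\<in>U. \<forall>v. nablaT G (\<lambda>y. soldering G y (tensor (e y) (sym3 (f y) (g y) (k y)))) x v =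
           soldering G x (tensor (nablaE G e x v) (sym3 (f x) (g x) (k x)) +
             tensor (e x) (sym3 (nablaH G f x v) (g x) (k x) + sym3 (f x) (nablaH G g x v) (k x) +
                           sym3 (f x) (g x) (nablaH G k x v)))))"

definition half_flat_grassmann ::
  "('x::{t2_space, second_countable_topology}, 'm::finite, 'p::finite) grassmann \<Rightarrow> bool" where
  "half_flat_grassmann G \<longleftrightarrow>
     complex_manifold (atl G) \<and>
     vector_bundle (atl G) (bunE G) \<and> covariant_derivative (atl G) (secE G) (nablaE G) \<and>
     vector_bundle (atl G) (bunH G) \<and> covariant_derivative (atl G) (secH G) (nablaH G) \<and>
     symplectic_form G \<and> preserves_omegaH G \<and> induced_cube_flat G \<and>
     soldering_iso G \<and> grassmann_connection G"

definition torsion ::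
  "('x::topological_space, 'm::finite, 'p::finite) grassmann \<Rightarrow>
   ('x \<Rightarrow> complex ^ 'm) \<Rightarrow> ('x \<Rightarrow> complex ^ 'm) \<Rightarrow> 'x \<Rightarrow> complex ^ 'm" where
  "torsion G X Y x = nablaT G Y x (X x) - nablaT G X x (Y x) - bracket (atl G) X Y x"

definition parallel_symplectic_frame ::
  "('x::topological_space, 'm::finite, 'p::finite) grassmann \<Rightarrow> (2 \<Rightarrow> 'x \<Rightarrow> complex ^ 2) \<Rightarrow> bool" where
  "parallel_symplectic_frame G h \<longleftrightarrow>
     (\<forall>\<alpha>. secH G UNIV (h \<alpha>) \<and> (\<forall>x v. nablaH G (h \<alpha>) x v = 0)) \<and>
     (\<forall>x. omegaH G x (h 1 x) (h 2 x) = 1)"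

text \<open>\<open>X\<^sup>e\<^sub>\<alpha>\<^sub>\<beta>\<^sub>\<gamma> = e \<otimes> h\<^sub>\<alpha> h\<^sub>\<beta> h\<^sub>\<gamma>\<close>.\<close>

definition Xfield ::
  "('x, 'm::finite, 'p::finite) grassmann \<Rightarrow> (2 \<Rightarrow> 'x \<Rightarrow> complex ^ 2) \<Rightarrow> ('x \<Rightarrow> complex ^ 'p) \<Rightarrow>
   2 \<Rightarrow> 2 \<Rightarrow> 2 \<Rightarrow> 'x \<Rightarrow> complex ^ 'm" where
  "Xfield G h e \<alpha> \<beta> \<gamma> x = soldering G x (tensor (e x) (sym3 (h \<alpha> x) (h \<beta> x) (h \<gamma> x)))"


section \<open>The bundle \<open>S\<^sub>H\<close>\<close>

text \<open>A point \<open>u = (u\<^sub>+, u\<^sub>-)\<close> stands for the pair \<open>h\<^sub>\<plusminus> = u\<^sub>\<plusminus>\<^sup>\<alpha> h\<^sub>\<alpha>\<close>; since \<open>\<omega>\<^sub>H(h\<^sub>1, h\<^sub>2) = 1\<close>, the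
  defining equation of \<open>Sp1C\<close> is \<open>\<omega>\<^sub>H(h\<^sub>+, h\<^sub>-) = 1\<close>.\<close>

type_synonym spinor_pair = "(complex ^ 2) \<times> (complex ^ 2)"

abbreviation up :: "spinor_pair \<Rightarrow> complex ^ 2" where "up \<equiv> fst"
abbreviation um :: "spinor_pair \<Rightarrow> complex ^ 2" where "um \<equiv> snd"

definition eps :: "complex ^ 2 \<Rightarrow> complex ^ 2 \<Rightarrow> complex" where
  "eps a b = a $ 1 * b $ 2 - a $ 2 * b $ 1"

definition Sp1C :: "spinor_pair set" where
  "Sp1C = {u. eps (up u) (um u) = 1}"

lemma eps_eq_omegaH:
  assumes "symplectic_form G" and "parallel_symplectic_frame G h"
  shows "omegaH G x (\<Sum>\<alpha>\<in>UNIV. a $ \<alpha> *s h \<alpha> x) (\<Sum>\<alpha>\<in>UNIV. b $ \<alpha> *s h \<alpha> x) = eps a b"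
proof -
  have sk: "omegaH G x g f = - omegaH G x f g" for f g :: "complex ^ 2"
    using assms(1) unfolding symplectic_form_def by blast
  have s: "c *s f = c *\<^sub>C f" for c and f :: "complex ^ 2"
    by (simp add: scaleC_vec_def vec_eq_iff scaleC_complex_def)
  have "clinear_map (omegaH G x f)" for f
    using assms(1) unfolding symplectic_form_def by blast
  then have addr: "omegaH G x f (g + k) = omegaH G x f g + omegaH G x f k"
    and sclr: "omegaH G x f (c *s g) = c * omegaH G x f g" for f g k c
    unfolding clinear_on_def s by (simp_all add: scaleC_complex_def)
  have addl: "omegaH G x (g + k) f = omegaH G x g f + omegaH G x k f"
    and scll: "omegaH G x (c *s g) f = c * omegaH G x g f" for f g k c
    unfolding sk[of "g + k" f] sk[of g f] sk[of k f] sk[of "c *s g" f]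
    by (simp_all only: addr sclr minus_add_distrib mult_minus_right)
  have h12: "omegaH G x (h 1 x) (h 2 x) = 1"
    using assms(2) unfolding parallel_symplectic_frame_def by blast
  have h21: "omegaH G x (h 2 x) (h 1 x) = -1"
    using sk[of "h 2 x" "h 1 x"] h12 by simp
  have h0: "omegaH G x f f = 0" for f
    using sk[of f f] by simp
  show ?thesis
    by (simp add: sum_2 addr sclr addl scll h12 h21 h0 eps_def algebra_simps)
qed

definition SH :: "('x \<times> spinor_pair) set" where
  "SH = UNIV \<times> Sp1C"

definition SH_atlas ::
  "('x, complex ^ 'm) atlas \<Rightarrow> ('x \<times> spinor_pair, (complex ^ 'm) \<times> spinor_pair) atlas" where
  "SH_atlas \<kappa> = (\<lambda>(x, u). (chart_dom \<kappa> x \<times> Sp1C, \<lambda>(y, w). (chart_map \<kappa> x y, w)))"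

definition SH_tangent :: "'x \<times> spinor_pair \<Rightarrow> ((complex ^ 'm) \<times> spinor_pair) set" where
  "SH_tangent = (\<lambda>(x, u). {(v, w). eps (up w) (um u) + eps (up u) (um w) = 0})"

abbreviation atlSH ::
  "('x, 'm::finite, 'p::finite) grassmann \<Rightarrow> ('x \<times> spinor_pair, (complex ^ 'm) \<times> spinor_pair) atlas" where
  "atlSH G \<equiv> SH_atlas (atl G)"

text \<open>The frame \<open>h\<close> being parallel, horizontal lifts with respect to \<open>\<nabla>\<^sup>H\<close> have no component along
  \<open>Sp1C\<close> in the trivialisation of \<open>S\<^sub>H\<close> by \<open>h\<close>.\<close>

definition hlift :: "complex ^ 'm \<Rightarrow> (complex ^ 'm) \<times> spinor_pair" where
  "hlift v = (v, 0)"

definition d_pp :: "'x \<times> spinor_pair \<Rightarrow> (complex ^ 'm::finite) \<times> spinor_pair" where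
  "d_pp = (\<lambda>(x, u). (0, (0, up u)))"

definition d_mm :: "'x \<times> spinor_pair \<Rightarrow> (complex ^ 'm::finite) \<times> spinor_pair" where
  "d_mm = (\<lambda>(x, u). (0, (um u, 0)))"

definition d_0 :: "'x \<times> spinor_pair \<Rightarrow> (complex ^ 'm::finite) \<times> spinor_pair" where
  "d_0 = (\<lambda>(x, u). (0, (up u, - um u)))"

definition vertical :: "(complex ^ 'm::finite) \<times> spinor_pair \<Rightarrow> bool" where
  "vertical v \<longleftrightarrow> fst v = 0"

text \<open>\<open>XSH G h a b c e\<close> is \<open>a\<^sup>\<alpha> b\<^sup>\<beta> c\<^sup>\<gamma>\<close> times the lift of \<open>X\<^sup>e\<^sub>\<alpha>\<^sub>\<beta>\<^sub>\<gamma>\<close>, with each of \<open>a, b, c\<close> one of \<open>up, um\<close>: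
  thus \<open>X\<^sup>e\<^sub>+\<^sub>+\<^sub>+ = XSH G h up up up e\<close>, \<open>X\<^sup>e\<^sub>+ = XSH G h up up um e\<close>, \<open>X\<^sup>e\<^sub>- = XSH G h um um up e\<close> and
  \<open>X\<^sup>e\<^sub>-\<^sub>-\<^sub>- = XSH G h um um um e\<close>.\<close>

definition XSH ::
  "('x, 'm::finite, 'p::finite) grassmann \<Rightarrow> (2 \<Rightarrow> 'x \<Rightarrow> complex ^ 2) \<Rightarrow>
   (spinor_pair \<Rightarrow> complex ^ 2) \<Rightarrow> (spinor_pair \<Rightarrow> complex ^ 2) \<Rightarrow> (spinor_pair \<Rightarrow> complex ^ 2) \<Rightarrow>
   ('x \<Rightarrow> complex ^ 'p) \<Rightarrow> 'x \<times> spinor_pair \<Rightarrow> (complex ^ 'm) \<times> spinor_pair" where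
  "XSH G h a b c e = (\<lambda>(x, u).
     \<Sum>\<alpha>\<in>UNIV. \<Sum>\<beta>\<in>UNIV. \<Sum>\<gamma>\<in>UNIV. (a u $ \<alpha> * b u $ \<beta> * c u $ \<gamma>) *\<^sub>C hlift (Xfield G h e \<alpha> \<beta> \<gamma> x))"

text \<open>The two choices of sign, \<open>(s, t)\<close> standing for \<open>(u\<^sub>\<plusminus>, u\<^sub>\<mp>)\<close>.\<close>

definition signs :: "((spinor_pair \<Rightarrow> complex ^ 2) \<times> (spinor_pair \<Rightarrow> complex ^ 2)) set" where
  "signs = {(up, um), (um, up)}"

text \<open>The fibre of \<open>\<D>\<^sup>1\<^sub>(\<^sub>\<plusminus>\<^sub>)\<close> at a point of \<open>S\<^sub>H\<close>.\<close>

definition dist1 ::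
  "('x, 'm::finite, 'p::finite) grassmann \<Rightarrow> (2 \<Rightarrow> 'x \<Rightarrow> complex ^ 2) \<Rightarrow>
   (spinor_pair \<Rightarrow> complex ^ 2) \<Rightarrow> (spinor_pair \<Rightarrow> complex ^ 2) \<Rightarrow>
   'x \<times> spinor_pair \<Rightarrow> ((complex ^ 'm) \<times> spinor_pair) set" where
  "dist1 G h s t p =
     {XSH G h s s s (\<lambda>_. e) p + XSH G h s s t (\<lambda>_. e') p | e e'. True}"

definition one_admissible ::
  "('x::topological_space, 'm::finite, 'p::finite) grassmann \<Rightarrow> (2 \<Rightarrow> 'x \<Rightarrow> complex ^ 2) \<Rightarrow> bool" where
  "one_admissible G h \<longleftrightarrow>
     (\<forall>(s, t)\<in>signs. \<forall>U X Y. open U \<and> secT G U X \<and> secT G U Y \<longrightarrow>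
        (\<forall>x\<in>U. \<forall>u\<in>Sp1C. hlift (X x) \<in> dist1 G h s t (x, u) \<and> hlift (Y x) \<in> dist1 G h s t (x, u) \<longrightarrow>
           hlift (torsion G X Y x) \<in> dist1 G h s t (x, u)))"


section \<open>Partial flatness\<close>

text \<open>The decomposition of the curvature over \<open>M\<close> at the point \<open>x\<close>.  A totally symmetric tensor with
  indices in \<open>{1, 2}\<close> is a function of the multiset of its indices; \<open>\<sigma>\<close> and \<open>\<tau>\<close> run over the
  permutations of the index triples \<open>a\<close> and \<open>b\<close>, without normalising factors: this is the convention
  that produces the constants 36 and -12 in the definition over \<open>S\<^sub>H\<close> below.\<close>

definition complex_bilinear :: "('a::complex_normed \<Rightarrow> 'a \<Rightarrow> 'b::complex_normed) \<Rightarrow> bool" where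
  "complex_bilinear F \<longleftrightarrow> (\<forall>e. clinear_map (F e)) \<and> (\<forall>e'. clinear_map (\<lambda>e. F e e'))"

definition curvature_components ::
  "('x::topological_space, 'm::finite, 'p::finite) grassmann \<Rightarrow> (2 \<Rightarrow> 'x \<Rightarrow> complex ^ 2) \<Rightarrow>
   ('x \<Rightarrow> complex ^ 'm \<Rightarrow> complex ^ 'r::finite ^ 'r) \<Rightarrow> 'x \<Rightarrow>
   (2 multiset \<Rightarrow> complex ^ 'p \<Rightarrow> complex ^ 'p \<Rightarrow> complex ^ 'r ^ 'r) \<Rightarrow>
   (2 multiset \<Rightarrow> complex ^ 'p \<Rightarrow> complex ^ 'p \<Rightarrow> complex ^ 'r ^ 'r) \<Rightarrow>
   (2 multiset \<Rightarrow> complex ^ 'p \<Rightarrow> complex ^ 'p \<Rightarrow> complex ^ 'r ^ 'r) \<Rightarrow>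
   (complex ^ 'p \<Rightarrow> complex ^ 'p \<Rightarrow> complex ^ 'r ^ 'r) \<Rightarrow> bool" where
  "curvature_components G h A x F0 F1 F2 F3 \<longleftrightarrow>
     (\<forall>I. complex_bilinear (F0 I) \<and> (\<forall>e e'. F0 I e' e = - F0 I e e')) \<and>
     (\<forall>I. complex_bilinear (F1 I) \<and> (\<forall>e e'. F1 I e' e = F1 I e e')) \<and>
     (\<forall>I. complex_bilinear (F2 I) \<and> (\<forall>e e'. F2 I e' e = - F2 I e e')) \<and>
     complex_bilinear F3 \<and> (\<forall>e e'. F3 e' e = F3 e e') \<and>
     (\<forall>U e e'. open U \<and> x \<in> U \<and> secE G U e \<and> secE G U e' \<longrightarrow>
        (\<forall>a b :: 3 \<Rightarrow> 2.
           curvature (atl G) A (Xfield G h e (a 1) (a 2) (a 3)) (Xfield G h e' (b 1) (b 2) (b 3)) x =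
           (\<Sum>\<sigma> | bij (\<sigma> :: 3 \<Rightarrow> 3). \<Sum>\<tau> | bij (\<tau> :: 3 \<Rightarrow> 3).
              let \<omega> = (\<lambda>i. omegaH G x (h (a (\<sigma> i)) x) (h (b (\<tau> i)) x)) in
              F0 {# a (\<sigma> 1), a (\<sigma> 2), a (\<sigma> 3), b (\<tau> 1), b (\<tau> 2), b (\<tau> 3) #} (e x) (e' x)
              + \<omega> 1 *\<^sub>C F1 {# a (\<sigma> 2), a (\<sigma> 3), b (\<tau> 2), b (\<tau> 3) #} (e x) (e' x)
              + (\<omega> 1 * \<omega> 2) *\<^sub>C F2 {# a (\<sigma> 3), b (\<tau> 3) #} (e x) (e' x)
              + (\<omega> 1 * \<omega> 2 * \<omega> 3) *\<^sub>C F3 (e x) (e' x))))"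

definition one_partially_flat_M ::
  "('x::topological_space, 'm::finite, 'p::finite) grassmann \<Rightarrow> (2 \<Rightarrow> 'x \<Rightarrow> complex ^ 2) \<Rightarrow>
   ('x \<Rightarrow> complex ^ 'm \<Rightarrow> complex ^ 'r::finite ^ 'r) \<Rightarrow> bool" where
  "one_partially_flat_M G h A \<longleftrightarrow>
     (\<forall>x. \<exists>F0 F1 F2 F3. curvature_components G h A x F0 F1 F2 F3 \<and>
        F0 = (\<lambda>I e e'. 0) \<and> F1 = (\<lambda>I e e'. 0) \<and> F2 = (\<lambda>I e e'. 0))"

definition one_partially_flat_SH ::
  "('x::topological_space, 'm::finite, 'p::finite) grassmann \<Rightarrow> (2 \<Rightarrow> 'x \<Rightarrow> complex ^ 2) \<Rightarrow>
   ('x \<times> spinor_pair \<Rightarrow> (complex ^ 'm) \<times> spinor_pair \<Rightarrow> complex ^ 'r::finite ^ 'r) \<Rightarrow> bool" where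
  "one_partially_flat_SH G h A \<longleftrightarrow>
     (let F = curvature (atlSH G) A in
       (\<forall>U e e'. open U \<and> secE G U e \<and> secE G U e' \<longrightarrow>
          (\<forall>p\<in>U \<times> Sp1C. \<forall>(s, t)\<in>signs.
             F (XSH G h s s s e) (XSH G h s s s e') p = 0 \<and>
             F (XSH G h s s s e') (XSH G h s s t e) p = 0 \<and>
             F (XSH G h s s t e) (XSH G h s s t e') p = 0 \<and>
             F (XSH G h s s s e) (XSH G h t t s e') p = 0)) \<and>
       (\<exists>F3 :: 'x \<times> spinor_pair \<Rightarrow> complex ^ 'p \<Rightarrow> complex ^ 'p \<Rightarrow> complex ^ 'r ^ 'r.
          (\<forall>p e e'. F3 p e' e = F3 p e e') \<and>
          (\<forall>U e e'. open U \<and> secE G U e \<and> secE G U e' \<longrightarrow>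
             (\<forall>p\<in>U \<times> Sp1C.
                F (XSH G h up up up e) (XSH G h um um um e') p = 36 *\<^sub>C F3 p (e (fst p)) (e' (fst p)) \<and>
                F (XSH G h up up um e) (XSH G h um um up e') p = (- 12) *\<^sub>C F3 p (e (fst p)) (e' (fst p))))) \<and>
       (\<forall>V Z Y. openin (top_of_set SH) V \<and> holo_field (atlSH G) SH_tangent V Z \<and>
                holo_field (atlSH G) SH_tangent V Y \<and> (\<forall>p\<in>V. vertical (Z p)) \<longrightarrow>
          (\<forall>p\<in>V. F Z Y p = 0)))"

definition almost_one_partially_flat ::
  "('x::topological_space, 'm::finite, 'p::finite) grassmann \<Rightarrow> (2 \<Rightarrow> 'x \<Rightarrow> complex ^ 2) \<Rightarrow>
   ('x \<times> spinor_pair \<Rightarrow> (complex ^ 'm) \<times> spinor_pair \<Rightarrow> complex ^ 'r::finite ^ 'r) \<Rightarrow> bool" where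
  "almost_one_partially_flat G h A \<longleftrightarrow>
     (let F = curvature (atlSH G) A in
       (\<forall>U e e'. open U \<and> secE G U e \<and> secE G U e' \<longrightarrow>
          (\<forall>p\<in>U \<times> Sp1C.
             F (XSH G h up up up e) (XSH G h up up up e') p = 0 \<and>
             F (XSH G h up up up e) (XSH G h up up um e') p = 0 \<and>
             F (XSH G h up up um e) (XSH G h up up um e') p = 0)) \<and>
       (\<forall>U e V Z. open U \<and> secE G U e \<and> openin (top_of_set SH) V \<and> V \<subseteq> U \<times> UNIV \<and>
                holo_field (atlSH G) SH_tangent V Z \<and> (\<forall>p\<in>V. vertical (Z p)) \<longrightarrow>
          (\<forall>p\<in>V. F (XSH G h up up up e) Z p = 0 \<and> F (XSH G h up up um e) Z p = 0 \<and>
                 F (XSH G h um um up e) Z p = 0)) \<and>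
       (\<forall>V Y. openin (top_of_set SH) V \<and> holo_field (atlSH G) SH_tangent V Y \<longrightarrow>
          (\<forall>p\<in>V. F d_pp Y p = 0 \<and> F d_0 Y p = 0)))"


section \<open>Central frames and potentials\<close>

text \<open>The columns of \<open>\<psi>\<close> are the sections of the frame.\<close>

definition central_frame ::
  "('x::topological_space, 'm::finite, 'p::finite) grassmann \<Rightarrow>
   ('x \<times> spinor_pair \<Rightarrow> (complex ^ 'm) \<times> spinor_pair \<Rightarrow> complex ^ 'r::finite ^ 'r) \<Rightarrow>
   ('x \<times> spinor_pair \<Rightarrow> complex ^ 'r ^ 'r) \<Rightarrow> bool" where
  "central_frame G A \<psi> \<longleftrightarrow>
     holo_fun (atlSH G) SH \<psi> \<and>
     (\<forall>p\<in>SH. invertible (\<psi> p) \<and>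
        (\<forall>v\<in>SH_tangent p. vertical v \<longrightarrow> dir (atlSH G) \<psi> p v + A p v ** \<psi> p = 0))"

definition potential ::
  "('x, 'm::finite, 'p::finite) grassmann \<Rightarrow>
   ('x \<times> spinor_pair \<Rightarrow> (complex ^ 'm) \<times> spinor_pair \<Rightarrow> complex ^ 'r::finite ^ 'r) \<Rightarrow>
   ('x \<times> spinor_pair \<Rightarrow> complex ^ 'r ^ 'r) \<Rightarrow>
   'x \<times> spinor_pair \<Rightarrow> (complex ^ 'm) \<times> spinor_pair \<Rightarrow> complex ^ 'r ^ 'r" where
  "potential G A \<psi> p v = matrix_inv (\<psi> p) ** (dir (atlSH G) \<psi> p v + A p v ** \<psi> p)"

text \<open>\<open>C x e \<alpha> \<beta> \<gamma>\<close> is \<open>C\<^sup>e\<^sub>\<alpha>\<^sub>\<beta>\<^sub>\<gamma>\<close> at \<open>x\<close>, which depends only on the value of \<open>e\<close> at \<open>x\<close>; \<open>CSH\<close> contracts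
  it with spinors as \<open>XSH\<close> does with \<open>X\<^sup>e\<^sub>\<alpha>\<^sub>\<beta>\<^sub>\<gamma>\<close>.\<close>

definition CSH ::
  "('x \<Rightarrow> complex ^ 'p::finite \<Rightarrow> 2 \<Rightarrow> 2 \<Rightarrow> 2 \<Rightarrow> complex ^ 'r::finite ^ 'r) \<Rightarrow>
   (spinor_pair \<Rightarrow> complex ^ 2) \<Rightarrow> (spinor_pair \<Rightarrow> complex ^ 2) \<Rightarrow> (spinor_pair \<Rightarrow> complex ^ 2) \<Rightarrow>
   complex ^ 'p \<Rightarrow> 'x \<times> spinor_pair \<Rightarrow> complex ^ 'r ^ 'r" where
  "CSH C a b c e = (\<lambda>(x, u).
     \<Sum>\<alpha>\<in>UNIV. \<Sum>\<beta>\<in>UNIV. \<Sum>\<gamma>\<in>UNIV. (a u $ \<alpha> * b u $ \<beta> * c u $ \<gamma>) *\<^sub>C C x e \<alpha> \<beta> \<gamma>)"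

text \<open>The prescribed values of the potentials of \<open>\<nabla>\<close>-hat over \<open>S\<^sub>H\<close> and of \<open>\<nabla>\<^sup>M\<close> over \<open>M\<close>, with
  linearity on each tangent space; as the fields involved span the tangent spaces, these determine
  the potentials.\<close>

definition hat_potential ::
  "('x, 'm::finite, 'p::finite) grassmann \<Rightarrow> (2 \<Rightarrow> 'x \<Rightarrow> complex ^ 2) \<Rightarrow>
   ('x \<Rightarrow> complex ^ 'p \<Rightarrow> 2 \<Rightarrow> 2 \<Rightarrow> 2 \<Rightarrow> complex ^ 'r::finite ^ 'r) \<Rightarrow>
   ('x \<times> spinor_pair \<Rightarrow> (complex ^ 'm) \<times> spinor_pair \<Rightarrow> complex ^ 'r ^ 'r) \<Rightarrow> bool" where
  "hat_potential G h C B \<longleftrightarrow>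
     (\<forall>p\<in>SH. clinear_on (SH_tangent p) (B p) \<and>
        (\<forall>e. B p (XSH G h up up up (\<lambda>_. e) p) = CSH C up up up e p \<and>
             B p (XSH G h up up um (\<lambda>_. e) p) = CSH C up up um e p \<and>
             B p (XSH G h um um up (\<lambda>_. e) p) = CSH C um um up e p \<and>
             B p (XSH G h um um um (\<lambda>_. e) p) = CSH C um um um e p) \<and>
        B p (d_pp p) = 0 \<and> B p (d_mm p) = 0 \<and> B p (d_0 p) = 0)"

definition base_potential ::
  "('x, 'm::finite, 'p::finite) grassmann \<Rightarrow> (2 \<Rightarrow> 'x \<Rightarrow> complex ^ 2) \<Rightarrow>
   ('x \<Rightarrow> complex ^ 'p \<Rightarrow> 2 \<Rightarrow> 2 \<Rightarrow> 2 \<Rightarrow> complex ^ 'r::finite ^ 'r) \<Rightarrow>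
   ('x \<Rightarrow> complex ^ 'm \<Rightarrow> complex ^ 'r ^ 'r) \<Rightarrow> bool" where
  "base_potential G h C B \<longleftrightarrow>
     (\<forall>x. clinear_map (B x) \<and> (\<forall>e \<alpha> \<beta> \<gamma>. B x (Xfield G h (\<lambda>_. e) \<alpha> \<beta> \<gamma> x) = C x e \<alpha> \<beta> \<gamma>))"

text \<open>In the charts used, the projection \<open>\<pi>\<close> is the projection to the first factor, and so is its
  differential.\<close>

definition pullback_form ::
  "('x \<Rightarrow> complex ^ 'm \<Rightarrow> complex ^ 'r ^ 'r) \<Rightarrow>
   'x \<times> spinor_pair \<Rightarrow> (complex ^ 'm) \<times> spinor_pair \<Rightarrow> complex ^ 'r ^ 'r" where
  "pullback_form B p v = B (fst p) (fst v)"

end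

(* Restrict the almost partially flat connection to a slice M x {u} and pass to the central frame.  The
   resulting connection on M agrees with the base connection X + C on the distribution D at u that is
   spanned by the cubics l^2 m, where l = u_+ and m is any spinor.  The spinors l, m are parallel and M is
   1-admissible, so D is involutive; hence the base connection is flat along D, for every u.  At a point
   of M its curvature is thus a bilinear form on cubics (with coefficients depending on e, e') that vanishes
   on pairs with a common squared factor.  Comparing coefficients in l, such a form is a multiple of the
   third transvectant, which is the component F^(3); evaluating it on the cubics of u_+, u_- gives the
   constants 36 and -12.  As the potential involves derivatives of the frame, its regularity rests on the
   fact that derivatives of holomorphic functions are holomorphic, which is obtained from the Cauchy
   integral along complex lines. *)

theory Submission
  imports Defs "HOL-Complex_Analysis.Complex_Analysis"
begin

text \<open>The coefficients \<open>C\<close> come as a bare family of matrices, so their linearity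
  in \<open>e\<close> and holomorphy in the base point have to be extracted from the potential. For
  fixed \<open>u\<close> the potential is that of a genuine connection over \<open>M\<close>, and
  its value on l^3 is a cubic polynomial in l; sampling it at four spinors recovers every
  coefficient. The central frame gives one gauge per slice, but slices are never compared with one
  another: each is compared with the base connection on its own distribution, and flatness is gauge
  invariant. The transvectant of two products of three linear forms is, up to a factor, the
  permanent of the 3 by 3 matrix of their pairings. It changes sign when the cubics are exchanged,
  so antisymmetry of the curvature makes F^(3) symmetric in \<open>e\<close>, \<open>e'\<close>. The
  permanents of the pairs (u_+^3, u_-^3) and (u_+^2 u_-, u_-^2 u_+) are 6 and -2; the factor is 6. A
  chart image of \<open>S_H\<close> is an open set times \<open>Sp1C\<close>, which is not open, so
  a derivative there is determined on tangent vectors only. Derivatives are therefore carried as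
  explicit witnesses, and brackets must be shown to be tangent.\<close>

no_notation fps_nth (infixl \<open>$\<close> 75)

section \<open>Complex scalar multiplication and complex-linear maps\<close>

lemma scaleR_eq_scaleC: "r *\<^sub>R x = complex_of_real r *\<^sub>C (x::'a::complex_normed)"
  by (simp add: scaleC_of_real)

lemma bounded_bilinear_scaleC: "bounded_bilinear (scaleC :: complex \<Rightarrow> 'a::complex_normed \<Rightarrow> 'a)"
proof
  show "\<exists>K. \<forall>a b. norm (a *\<^sub>C (b::'a)) \<le> norm a * norm b * K"
    by (rule exI[of _ 1]) (simp add: norm_scaleC)
qed (simp_all add: scaleC_add_left scaleC_add_right scaleR_eq_scaleC scaleC_scaleC
      scaleR_conv_of_real scaleC_complex_def mult_ac)

interpretation scaleC: bounded_bilinear "scaleC :: complex \<Rightarrow> 'a::complex_normed \<Rightarrow> 'a"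
  by (rule bounded_bilinear_scaleC)

lemmas [continuous_intros] = scaleC.continuous_on scaleC.continuous
lemmas [derivative_intros] = bounded_bilinear.FDERIV[OF bounded_bilinear_scaleC]

lemma scaleC_one [simp]: "1 *\<^sub>C x = (x::'a::complex_normed)"
  using scaleC_of_real[of 1 x] by simp

lemma scaleC_simps [simp]: "0 *\<^sub>C x = (0::'a::complex_normed)" "a *\<^sub>C 0 = (0::'a)" "(- 1) *\<^sub>C x = - x"
  using scaleC.minus_left[of 1 x] by (simp_all add: scaleC.zero_left scaleC.zero_right)

lemma scaleC_vec_nth [simp]: "(a *\<^sub>C v) $ i = a *\<^sub>C (v $ i)"
  by (simp add: scaleC_vec_def)

lemma scaleC_prod_sel [simp]: "fst (a *\<^sub>C p) = a *\<^sub>C fst p" "snd (a *\<^sub>C p) = a *\<^sub>C snd p"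
  by (simp_all add: scaleC_prod_def)

lemma scaleC_eq_vector_smult: "a *\<^sub>C (v::complex^'n) = a *s v"
  by (simp add: vec_eq_iff scaleC_complex_def)

lemma clinear_onD:
  assumes "clinear_on T f"
  shows "v \<in> T \<Longrightarrow> w \<in> T \<Longrightarrow> f (v + w) = f v + f w" "v \<in> T \<Longrightarrow> f (c *\<^sub>C v) = c *\<^sub>C f v"
  using assms unfolding clinear_on_def by blast+

lemma clinear_onI:
  assumes "\<And>v w. v \<in> T \<Longrightarrow> w \<in> T \<Longrightarrow> f (v + w) = f v + f w" "\<And>c v. v \<in> T \<Longrightarrow> f (c *\<^sub>C v) = c *\<^sub>C f v"
  shows "clinear_on T f"
  using assms unfolding clinear_on_def by blast

lemma clinear_map_linear:
  assumes "clinear_map f"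
  shows "linear f"
  by (rule linearI) (simp_all add: scaleR_eq_scaleC clinear_onD[OF assms])

lemma clinear_map_simps:
  assumes "clinear_map f"
  shows "f (v + w) = f v + f w" "f (c *\<^sub>C v) = c *\<^sub>C f v" "f 0 = 0" "f (- v) = - f v" "f (v - w) = f v - f w"
    "f (sum g I) = (\<Sum>i\<in>I. f (g i))"
  using clinear_onD[OF assms] linear_0 linear_neg linear_diff linear_sum clinear_map_linear[OF assms]
  by auto

section \<open>Derivatives of holomorphic functions of several variables\<close>

lemma holo_on_open_iff:
  assumes "open S"
  shows "holo_on S f \<longleftrightarrow> (\<forall>z\<in>S. \<exists>D. clinear_map D \<and> (f has_derivative D) (at z))"
  unfolding holo_on_def using at_within_open[OF _ assms] by metis

abbreviation fder :: "('a::complex_normed \<Rightarrow> 'b::complex_normed) \<Rightarrow> 'a \<Rightarrow> 'a \<Rightarrow> 'b" where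
  "fder f z \<equiv> frechet_derivative f (at z)"

lemma fder_eq: "(f has_derivative D) (at z) \<Longrightarrow> fder f z = D"
  by (metis frechet_derivative_at)

lemma holo_on_fder:
  assumes "open S" "holo_on S f" "z \<in> S"
  shows "clinear_map (fder f z)" "(f has_derivative fder f z) (at z)"
  using assms fder_eq unfolding holo_on_open_iff[OF assms(1)] by metis+

lemma holo_on_continuous_on: "holo_on S f \<Longrightarrow> continuous_on S f"
  unfolding holo_on_def by (meson continuous_on_eq_continuous_within has_derivative_continuous)

definition circ :: "real \<Rightarrow> real \<Rightarrow> complex" where
  "circ r t = circlepath 0 r t"

lemma norm_circ [simp]: "cmod (circ r t) = \<bar>r\<bar>"
  by (simp add: circ_def circlepath norm_mult)

lemma circ_neq_0: "r > 0 \<Longrightarrow> circ r t \<noteq> 0"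
  using norm_circ[of r t] by force

lemma continuous_on_circ [continuous_intros]: "continuous_on S g \<Longrightarrow> continuous_on S (\<lambda>x. circ r (g x))"
  unfolding circ_def circlepath by (intro continuous_intros)

text \<open>On the complex line through \<open>z\<close> in direction \<open>w\<close>,
  \<open>f\<close> is a holomorphic function of one variable, whose derivative at the centre is a
  Cauchy integral over a circle; parametrising the circle turns dzeta / zeta^2 into 2 pi i dt /
  zeta. On the right \<open>z\<close> occurs only inside values of \<open>f\<close>, so continuity
  and differentiability in \<open>z\<close> can be taken under the integral sign.\<close>

lemma fder_Cauchy:
  fixes f :: "'a::complex_normed \<Rightarrow> complex"
  assumes S: "open S" "holo_on S f" and r: "r > 0" and sub: "cball z (r * norm w) \<subseteq> S"
  shows "fder f z w = integral {0..1} (\<lambda>t. f (z + circ r t *\<^sub>C w) / circ r t)"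
proof -
  define g where "g \<zeta> = f (z + \<zeta> *\<^sub>C w)" for \<zeta>
  have inS: "z + \<zeta> *\<^sub>C w \<in> S" if "\<zeta> \<in> cball 0 r" for \<zeta>
    using that sub by (auto simp: dist_norm norm_scaleC mult_right_mono subset_iff)
  have der: "(g has_field_derivative fder f (z + \<zeta> *\<^sub>C w) w) (at \<zeta>)" if "\<zeta> \<in> cball 0 r" for \<zeta>
  proof -
    have "((\<lambda>\<zeta>. z + \<zeta> *\<^sub>C w) has_derivative (\<lambda>x. x *\<^sub>C w)) (at \<zeta>)"
      by (auto intro!: derivative_eq_intros)
    from has_derivative_compose[OF this holo_on_fder(2)[OF S inS[OF that]]]
    have "(g has_derivative (\<lambda>x. fder f (z + \<zeta> *\<^sub>C w) (x *\<^sub>C w))) (at \<zeta>)"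
      unfolding g_def .
    moreover have "(\<lambda>x. fder f (z + \<zeta> *\<^sub>C w) (x *\<^sub>C w)) = (*) (fder f (z + \<zeta> *\<^sub>C w) w)"
      using clinear_map_simps(2)[OF holo_on_fder(1)[OF S inS[OF that]]]
      by (auto simp: scaleC_complex_def)
    ultimately show ?thesis by (simp add: has_field_derivative_def)
  qed
  have hol: "g holomorphic_on cball 0 r"
    unfolding holomorphic_on_def field_differentiable_def
    using der has_field_derivative_at_within by blast
  have "contour_integral (circlepath 0 r) (\<lambda>u. g u / (u-0)^2) = (2 * pi * \<i>) * deriv g 0"
    by (rule Cauchy_contour_integral_circlepath_2)
       (use hol r in \<open>auto intro: holomorphic_on_imp_continuous_on holomorphic_on_subset\<close>)
  moreover have "deriv g 0 = fder f z w"
    using DERIV_imp_deriv[OF der[of 0]] r by simp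
  moreover have vd: "vector_derivative (circlepath 0 r) (at t) = 2 * pi * \<i> * circ r t" for t
    by (simp add: vector_derivative_circlepath circ_def) (simp add: circlepath)
  have "contour_integral (circlepath 0 r) (\<lambda>u. g u / (u-0)^2)
    = integral {0..1} (\<lambda>t. (2 * pi * \<i>) * (g (circ r t) / circ r t))"
    unfolding contour_integral_integral
    by (rule integral_cong)
       (use circ_neq_0[OF r] in \<open>simp add: vd power2_eq_square field_simps flip: circ_def\<close>)
  ultimately have "(2 * pi * \<i>) * fder f z w = (2 * pi * \<i>) * integral {0..1} (\<lambda>t. f (z + circ r t *\<^sub>C w) / circ r t)"
    by (simp only: g_def integral_mult_right)
  then show ?thesis by simp
qed

lemma continuous_on_circ_shift:
  fixes f :: "'a::complex_normed \<Rightarrow> 'b::topological_space"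
  assumes "continuous_on S f" "\<And>z t. z \<in> U \<Longrightarrow> z + circ r t *\<^sub>C w \<in> S"
  shows "continuous_on (U \<times> T) (\<lambda>(z, t). f (z + circ r t *\<^sub>C w))"
  unfolding split_def
  by (rule continuous_on_compose2[OF assms(1)]) (use assms(2) in \<open>auto intro!: continuous_intros\<close>)

lemma small_radius:
  assumes "(R::real) > 0"
  obtains r where "r > 0" "r * norm (w::'a::real_normed_vector) < R"
proof
  \<comment> \<open>The summand 1 covers \<open>w = 0\<close>.\<close>
  show "R / (norm w + 1) > 0" using assms by (simp add: add_nonneg_pos)
  show "R / (norm w + 1) * norm w < R"
    using assms by (simp add: divide_simps add_nonneg_pos)
qed

context
  fixes f :: "'a::{complex_normed, euclidean_space} \<Rightarrow> complex" and S
  assumes S: "open S" "holo_on S f"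
begin

text \<open>Half of the radius \<open>2 * R\<close> is for the centre \<open>z\<close> and half for
  the circle around it, so that one \<open>r\<close> serves all \<open>z\<close> near
  \<open>z0\<close>.\<close>

lemma ball_circ:
  assumes "ball z0 (2 * R) \<subseteq> S" "r > 0" "r * norm w < R" "z \<in> ball z0 R"
  shows "z + circ r t *\<^sub>C w \<in> S" "cball z (r * norm w) \<subseteq> S"
proof -
  show sub: "cball z (r * norm w) \<subseteq> S"
  proof
    fix y assume "y \<in> cball z (r * norm w)"
    then have "dist z0 y < 2 * R"
      using assms dist_triangle[of z0 y z] by auto
    then show "y \<in> S" using assms by auto
  qed
  show "z + circ r t *\<^sub>C w \<in> S"
    using sub assms(2) by (auto simp: subset_iff dist_norm norm_scaleC)
qed

text \<open>Near each point the Cauchy integral has a jointly continuous integrand over a fixed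
  parameter interval. This continuity of the first derivative is what allows the formula itself to
  be differentiated under the integral sign.\<close>

lemma continuous_on_fder: "continuous_on S (\<lambda>z. fder f z w)"
proof (rule continuous_at_imp_continuous_on, rule ballI)
  fix z0 assume "z0 \<in> S"
  then obtain R' where "R' > 0" "ball z0 R' \<subseteq> S" using S(1) openE by blast
  then obtain R where R: "R > 0" "ball z0 (2 * R) \<subseteq> S" by (metis field_sum_of_halves half_gt_zero mult_2)
  obtain r where r: "r > 0" "r * norm w < R" using small_radius[OF R(1)] .
  have "continuous_on (ball z0 R) (\<lambda>z. integral {0..1} (\<lambda>t. f (z + circ r t *\<^sub>C w) / circ r t))"
    unfolding cbox_interval[symmetric]
  proof (rule integral_continuous_on_param)
    show "continuous_on (ball z0 R \<times> cbox 0 1) (\<lambda>(x, t). f (x + circ r t *\<^sub>C w) / circ r t)"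
      using continuous_on_circ_shift[where U = "ball z0 R" and T = "cbox 0 1", OF holo_on_continuous_on[OF S(2)] ball_circ(1)[OF R(2) r]] r
      unfolding split_def by (intro continuous_intros) (auto simp: circ_neq_0)
  qed
  then have "continuous_on (ball z0 R) (\<lambda>z. fder f z w)"
    by (rule continuous_on_eq) (simp add: fder_Cauchy[OF S r(1) ball_circ(2)[OF R(2) r]])
  then show "isCont (\<lambda>z. fder f z w) z0"
    using R(1) continuous_on_eq_continuous_at[OF open_ball] centre_in_ball by blast
qed

text \<open>The Leibniz rule applied to \<open>fder_Cauchy\<close>. The result is complex linear
  because it is an integral of the complex-linear maps \<open>fder f\<close>.\<close>

lemma fder_fder_Cauchy:
  assumes z0: "ball z0 (2 * R) \<subseteq> S" "R > 0" and r: "r > 0" "r * norm w < R"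
  defines "D \<equiv> \<lambda>v. integral {0..1} (\<lambda>t. fder f (z0 + circ r t *\<^sub>C w) v / circ r t)"
  shows "((\<lambda>z. fder f z w) has_derivative D) (at z0)" "clinear_map D"
proof -
  note inS = ball_circ(1)[OF z0(1) r]
  have lin: "bounded_linear (fder f z)" if "z \<in> S" for z
    using holo_on_fder(2)[OF S that] by (rule has_derivative_bounded_linear)
  \<comment> \<open>The Leibniz rule wants the derivatives as bounded operators depending
    continuously on the parameters; on a finite-dimensional space continuity can be checked on each
    basis vector.\<close>
  define fx where "fx z t = Blinfun (\<lambda>v. fder f (z + circ r t *\<^sub>C w) v / circ r t)" for z t
  have fx: "blinfun_apply (fx z t) = (\<lambda>v. fder f (z + circ r t *\<^sub>C w) v / circ r t)" if "z \<in> ball z0 R" for z t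
    unfolding fx_def
    by (rule bounded_linear_Blinfun_apply)
       (rule bounded_linear_divide[THEN bounded_linear_compose, OF lin[OF inS[OF that]]])
  have cont: "continuous_on (ball z0 R \<times> cbox 0 1) (\<lambda>(z, t). fx z t)"
  proof (rule continuous_on_blinfun_componentwise)
    fix i :: 'a
    have "continuous_on (ball z0 R \<times> cbox 0 1) (\<lambda>x. fder f (fst x + circ r (snd x) *\<^sub>C w) i / circ r (snd x))"
      using continuous_on_circ_shift[where U = "ball z0 R" and T = "cbox 0 1", OF continuous_on_fder[of i] inS] r
      unfolding split_def by (intro continuous_intros) (auto simp: circ_neq_0)
    then show "continuous_on (ball z0 R \<times> cbox 0 1) (\<lambda>x. blinfun_apply (case x of (z, t) \<Rightarrow> fx z t) i)"
      by (rule continuous_on_eq) (auto simp: fx)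
  qed
  have "((\<lambda>z. integral (cbox 0 1) (\<lambda>t. f (z + circ r t *\<^sub>C w) / circ r t)) has_derivative
      integral (cbox 0 1) (fx z0)) (at z0 within ball z0 R)"
  proof (rule leibniz_rule[OF _ _ cont])
    fix z and t :: real assume z: "z \<in> ball z0 R"
    have "((\<lambda>z. z + circ r t *\<^sub>C w) has_derivative (\<lambda>v. v)) (at z)"
      by (auto intro!: derivative_eq_intros)
    from has_derivative_compose[OF this holo_on_fder(2)[OF S inS[OF z]]]
    have "((\<lambda>z. f (z + circ r t *\<^sub>C w)) has_derivative fder f (z + circ r t *\<^sub>C w)) (at z)" .
    then have "((\<lambda>z. f (z + circ r t *\<^sub>C w) / circ r t) has_derivative (\<lambda>v. fder f (z + circ r t *\<^sub>C w) v / circ r t)) (at z)"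
      by (rule bounded_linear.has_derivative[OF bounded_linear_divide])
    then show "((\<lambda>z. f (z + circ r t *\<^sub>C w) / circ r t) has_derivative blinfun_apply (fx z t)) (at z within ball z0 R)"
      unfolding fx[OF z] by (rule has_derivative_at_withinI)
  next
    fix z assume z: "z \<in> ball z0 R"
    have "continuous_on (cbox 0 1) (\<lambda>t. f (z + circ r t *\<^sub>C w))"
      by (rule continuous_on_compose2[OF holo_on_continuous_on[OF S(2)]])
         (use inS[OF z] in \<open>auto intro!: continuous_intros\<close>)
    then show "(\<lambda>t. f (z + circ r t *\<^sub>C w) / circ r t) integrable_on cbox 0 1"
      by (intro integrable_continuous continuous_intros) (auto simp: circ_neq_0 r)
  qed (use z0 in auto)
  then have *: "((\<lambda>z. integral {0..1} (\<lambda>t. f (z + circ r t *\<^sub>C w) / circ r t)) has_derivative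
      integral (cbox 0 1) (fx z0)) (at z0)"
    using z0 by (simp add: at_within_open[OF _ open_ball])
  have int: "fx z0 integrable_on cbox 0 1"
    by (rule integrable_continuous, rule continuous_on_compose2[OF cont, of _ "\<lambda>t. (z0, t)", simplified])
       (use z0 in \<open>auto intro!: continuous_intros\<close>)
  have z0': "z0 \<in> ball z0 R" using z0 by simp
  have D: "blinfun_apply (integral (cbox 0 1) (fx z0)) = D"
    using blinfun_apply_integral[OF int] by (auto simp: D_def fx[OF z0'] fun_eq_iff)
  show "((\<lambda>z. fder f z w) has_derivative D) (at z0)"
    using has_derivative_transform_within_open[OF *[unfolded D] open_ball z0'] fder_Cauchy[OF S r(1) ball_circ(2)[OF z0(1) r]]
    by fastforce
  show "clinear_map D"
  proof (rule clinear_onI)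
    show "D (v + v') = D v + D v'" for v v'
      unfolding D[symmetric] by (simp add: blinfun.add_right)
    show "D (c *\<^sub>C v) = c *\<^sub>C D v" for c v
      using clinear_map_simps(2)[OF holo_on_fder(1)[OF S inS[OF z0']], of _ c]
      by (simp add: D_def scaleC_complex_def flip: times_divide_eq_right)
  qed
qed

text \<open>A second derivative is a double Cauchy integral over a torus. Exchanging the order of
  integration exchanges the two directions, which gives the symmetry.\<close>

lemma fder_holo_on: "holo_on S (\<lambda>z. fder f z w)"
  and fder_commute: "z \<in> S \<Longrightarrow> fder (\<lambda>z. fder f z w) z v = fder (\<lambda>z. fder f z v) z w"
proof -
  have *: "(\<exists>D. clinear_map D \<and> ((\<lambda>z. fder f z w) has_derivative D) (at z)) \<and>
    fder (\<lambda>z. fder f z w) z v = fder (\<lambda>z. fder f z v) z w" if "z \<in> S" for z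
  proof -
    obtain R' where "R' > 0" "ball z R' \<subseteq> S" using S(1) \<open>z \<in> S\<close> openE by blast
    then obtain R where R: "R > 0" "ball z (2 * R) \<subseteq> S" by (metis field_sum_of_halves half_gt_zero mult_2)
    obtain r1 where r1: "r1 > 0" "r1 * norm w < R" using small_radius[OF R(1)] .
    obtain r2 where r2: "r2 > 0" "r2 * norm v < R" using small_radius[OF R(1)] .
    \<comment> \<open>A single radius for both directions makes the two iterated integrals run over
      the same torus.\<close>
    define r where "r = min r1 r2"
    have r: "r > 0" "r * norm w < R" "r * norm v < R"
      using r1 r2 mult_right_mono[of r r1 "norm w"] mult_right_mono[of r r2 "norm v"] by (auto simp: r_def)
    note Dw = fder_fder_Cauchy[OF R(2,1) r(1,2)] and Dv = fder_fder_Cauchy[OF R(2,1) r(1,3)]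
    have in_ball: "z + circ r t *\<^sub>C a \<in> ball z R" if "r * norm a < R" for t a
      using that r(1) by (simp add: dist_norm norm_scaleC)
    have eq: "fder f (z + circ r t *\<^sub>C a) b = integral {0..1} (\<lambda>s. f (z + circ r t *\<^sub>C a + circ r s *\<^sub>C b) / circ r s)"
      if "r * norm a < R" "r * norm b < R" for t a b
      by (rule fder_Cauchy[OF S r(1) ball_circ(2)[OF R(2) r(1) that(2) in_ball[OF that(1)]]])
    have cont: "continuous_on (cbox (0,0) (1,1)) (\<lambda>(t, s). f (z + circ r t *\<^sub>C w + circ r s *\<^sub>C v) / circ r s / circ r t)"
      unfolding split_def
      by (intro continuous_intros continuous_on_compose2[OF holo_on_continuous_on[OF S(2)]])
         (use ball_circ(1)[OF R(2) r(1,3) in_ball[OF r(2)]] r in \<open>auto simp: circ_neq_0\<close>)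
    have "integral {0..1} (\<lambda>t. fder f (z + circ r t *\<^sub>C w) v / circ r t)
      = integral (cbox 0 1) (\<lambda>t. integral (cbox 0 1) (\<lambda>s. f (z + circ r t *\<^sub>C w + circ r s *\<^sub>C v) / circ r s / circ r t))"
      using r by (simp add: eq del: divide_divide_eq_left)
    also have "\<dots> = integral (cbox 0 1) (\<lambda>s. integral (cbox 0 1) (\<lambda>t. f (z + circ r t *\<^sub>C w + circ r s *\<^sub>C v) / circ r s / circ r t))"
      by (rule integral_swap_continuous[OF cont])
    also have "\<dots> = integral {0..1} (\<lambda>t. fder f (z + circ r t *\<^sub>C v) w / circ r t)"
    proof -
      have "integral (cbox 0 1) (\<lambda>t. f (z + circ r t *\<^sub>C w + circ r s *\<^sub>C v) / circ r s / circ r t)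
        = fder f (z + circ r s *\<^sub>C v) w / circ r s" for s
        using r by (simp add: eq add_ac divide_divide_eq_left mult.commute flip: integral_divide)
      then show ?thesis by simp
    qed
    finally show ?thesis using Dw(2) Dw(1) fder_eq[OF Dw(1)] fder_eq[OF Dv(1)] by metis
  qed
  show "holo_on S (\<lambda>z. fder f z w)" using * holo_on_open_iff[OF S(1)] by blast
  show "z \<in> S \<Longrightarrow> fder (\<lambda>z. fder f z w) z v = fder (\<lambda>z. fder f z v) z w" using * by blast
qed

end

section \<open>Componentwise passage to vector and matrix values\<close>

lemma has_derivative_vec_iff:
  fixes f :: "'a::real_normed_vector \<Rightarrow> 'b::euclidean_space ^ 'n"
  shows "(f has_derivative D) F \<longleftrightarrow> (\<forall>i. ((\<lambda>x. f x $ i) has_derivative (\<lambda>v. D v $ i)) F)"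
proof
  show "(f has_derivative D) F \<Longrightarrow> \<forall>i. ((\<lambda>x. f x $ i) has_derivative (\<lambda>v. D v $ i)) F"
    using bounded_linear.has_derivative[OF bounded_linear_vec_nth] by blast
next
  assume *: "\<forall>i. ((\<lambda>x. f x $ i) has_derivative (\<lambda>v. D v $ i)) F"
  have "linear (axis i :: 'b \<Rightarrow> 'b^'n)" for i
    by (rule linearI) (simp_all add: vec_eq_iff axis_def)
  then have "bounded_linear (axis i :: 'b \<Rightarrow> 'b^'n)" for i
    by (simp add: linear_conv_bounded_linear)
  then have "((\<lambda>x. \<Sum>i\<in>UNIV. axis i (f x $ i)) has_derivative (\<lambda>v. \<Sum>i\<in>UNIV. axis i (D v $ i))) F"
    using * by (intro has_derivative_sum) (auto intro: bounded_linear.has_derivative)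
  moreover have "(\<Sum>i\<in>UNIV. axis i (v $ i)) = v" for v :: "'b^'n"
    by (simp add: vec_eq_iff axis_def)
  ultimately show "(f has_derivative D) F" by simp
qed

lemma clinear_on_vec_iff: "clinear_on T f \<longleftrightarrow> (\<forall>i. clinear_on T (\<lambda>v. f v $ i))"
  unfolding clinear_on_def by (auto simp: vec_eq_iff)

lemma holo_on_vec_iff:
  fixes f :: "'a::complex_normed \<Rightarrow> 'b::{complex_normed,euclidean_space} ^ 'n"
  shows "holo_on S f \<longleftrightarrow> (\<forall>i. holo_on S (\<lambda>x. f x $ i))"
proof
  show "holo_on S f \<Longrightarrow> \<forall>i. holo_on S (\<lambda>x. f x $ i)"
    unfolding holo_on_def has_derivative_vec_iff[of f] clinear_on_vec_iff by fast
next
  assume *: "\<forall>i. holo_on S (\<lambda>x. f x $ i)"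
  show "holo_on S f"
    unfolding holo_on_def
  proof
    fix z assume "z \<in> S"
    with * have "\<forall>i. \<exists>D. clinear_map D \<and> ((\<lambda>x. f x $ i) has_derivative D) (at z within S)"
      unfolding holo_on_def by blast
    then obtain D where "\<forall>i. clinear_map (D i) \<and> ((\<lambda>x. f x $ i) has_derivative D i) (at z within S)"
      by metis
    then show "\<exists>D. clinear_map D \<and> (f has_derivative D) (at z within S)"
      by (intro exI[of _ "\<lambda>v. \<chi> i. D i v"]) (simp add: has_derivative_vec_iff[where f=f] clinear_on_vec_iff)
  qed
qed

lemma fder_vec_nth:
  fixes f :: "'a::complex_normed \<Rightarrow> 'b::{complex_normed,euclidean_space} ^ 'n"
  assumes "open S" "holo_on S f" "z \<in> S"
  shows "fder (\<lambda>x. f x $ i) z v = fder f z v $ i"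
  by (rule fun_cong[OF fder_eq]) (use holo_on_fder(2)[OF assms] in \<open>simp add: has_derivative_vec_iff[of f]\<close>)

lemma holo_on_cong: "(\<And>z. z \<in> S \<Longrightarrow> f z = g z) \<Longrightarrow> holo_on S f \<Longrightarrow> holo_on S g"
  unfolding holo_on_def using has_derivative_transform[of _ S g f] by fastforce

lemma fder_cong_open:
  assumes "open S" "z \<in> S" "\<And>y. y \<in> S \<Longrightarrow> f y = g y"
  shows "fder f z = fder g z"
proof -
  have "(f has_derivative D) (at z) = (g has_derivative D) (at z)" for D
    using has_derivative_transform_within_open[of f D z UNIV S g] has_derivative_transform_within_open[of g D z UNIV S f]
      assms by auto
  then show ?thesis unfolding frechet_derivative_def by presburger
qed

text \<open>The entry type is left general so that the step can be taken twice: from numbers to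
  vectors, and from vectors to matrices, which are vectors of rows.\<close>

lemma fder_vec_lift:
  fixes f :: "'a::{complex_normed, euclidean_space} \<Rightarrow> 'b::{complex_normed,euclidean_space} ^ 'n"
  assumes S: "open S" "holo_on S f"
    and h: "\<And>i w. holo_on S (\<lambda>z. fder (\<lambda>z. f z $ i) z w)"
    and c: "\<And>i z w v. z \<in> S \<Longrightarrow> fder (\<lambda>z. fder (\<lambda>z. f z $ i) z w) z v = fder (\<lambda>z. fder (\<lambda>z. f z $ i) z v) z w"
  shows "holo_on S (\<lambda>z. fder f z w)"
    and "z \<in> S \<Longrightarrow> fder (\<lambda>z. fder f z w) z v = fder (\<lambda>z. fder f z v) z w"
proof -
  show h': "holo_on S (\<lambda>z. fder f z w)" for w
    unfolding holo_on_vec_iff[of S "\<lambda>z. fder f z w"]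
    by (intro allI, rule holo_on_cong[OF fder_vec_nth[OF S] h])
  assume z: "z \<in> S"
  have "fder (\<lambda>z. fder f z w) z v $ i = fder (\<lambda>z. fder (\<lambda>z. f z $ i) z w) z v" for w v i
    unfolding fder_vec_nth[OF S(1) h' z, symmetric]
    by (rule fun_cong[OF fder_cong_open[OF S(1) z]]) (simp add: fder_vec_nth[OF S])
  then show "fder (\<lambda>z. fder f z w) z v = fder (\<lambda>z. fder f z v) z w"
    by (simp add: vec_eq_iff c[OF z])
qed

lemma fder_holo_on_vec:
  fixes f :: "'a::{complex_normed, euclidean_space} \<Rightarrow> complex ^ 'n"
  assumes "open S" "holo_on S f"
  shows "holo_on S (\<lambda>z. fder f z w)"
    and "z \<in> S \<Longrightarrow> fder (\<lambda>z. fder f z w) z v = fder (\<lambda>z. fder f z v) z w"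
proof -
  have comp: "holo_on S (\<lambda>z. f z $ i)" for i
    using assms(2) unfolding holo_on_vec_iff[of S f] by simp
  show "holo_on S (\<lambda>z. fder f z w)"
    by (rule fder_vec_lift(1)[OF assms]) (rule fder_holo_on[OF assms(1) comp], rule fder_commute[OF assms(1) comp])
  show "z \<in> S \<Longrightarrow> fder (\<lambda>z. fder f z w) z v = fder (\<lambda>z. fder f z v) z w"
    by (rule fder_vec_lift(2)[OF assms]) (rule fder_holo_on[OF assms(1) comp], rule fder_commute[OF assms(1) comp])
qed

lemma fder_holo_on_mat:
  fixes f :: "'a::{complex_normed, euclidean_space} \<Rightarrow> complex ^ 'n ^ 'k"
  assumes "open S" "holo_on S f"
  shows "holo_on S (\<lambda>z. fder f z w)"
    and "z \<in> S \<Longrightarrow> fder (\<lambda>z. fder f z w) z v = fder (\<lambda>z. fder f z v) z w"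
proof -
  have comp: "holo_on S (\<lambda>z. f z $ i)" for i
    using assms(2) unfolding holo_on_vec_iff[of S f] by simp
  show "holo_on S (\<lambda>z. fder f z w)"
    by (rule fder_vec_lift(1)[OF assms]) (rule fder_holo_on_vec(1)[OF assms(1) comp], rule fder_holo_on_vec(2)[OF assms(1) comp])
  show "z \<in> S \<Longrightarrow> fder (\<lambda>z. fder f z w) z v = fder (\<lambda>z. fder f z v) z w"
    by (rule fder_vec_lift(2)[OF assms]) (rule fder_holo_on_vec(1)[OF assms(1) comp], rule fder_holo_on_vec(2)[OF assms(1) comp])
qed

section \<open>Complex derivatives in charts\<close>

text \<open>\<open>dir\<close> selects one derivative by choice, and on \<open>S_H\<close> the
  choice is ambiguous because chart images are not open. With the derivative as an explicit
  argument, one set of rules covers the atlas of \<open>M\<close> and that of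
  \<open>S_H\<close>.\<close>

definition cder ::
  "('a, 'b::complex_normed) atlas \<Rightarrow> 'a \<Rightarrow> ('a \<Rightarrow> 'c::complex_normed) \<Rightarrow> ('b \<Rightarrow> 'c) \<Rightarrow> bool" where
  "cder \<kappa> p f D \<longleftrightarrow> clinear_map D \<and>
     (f \<circ> chart_inv \<kappa> p has_derivative D) (at (chart_map \<kappa> p p) within chart_img \<kappa> p)"

lemma cdiff_at_iff_cder: "cdiff_at \<kappa> p f \<longleftrightarrow> (\<exists>D. cder \<kappa> p f D)"
  unfolding cdiff_at_def cder_def ..

lemma cdiff_atI: "cder \<kappa> p f D \<Longrightarrow> cdiff_at \<kappa> p f"
  unfolding cdiff_at_iff_cder by blast

lemma cdiff_atE:
  assumes "cdiff_at \<kappa> p f"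
  obtains D where "cder \<kappa> p f D"
  using assms unfolding cdiff_at_iff_cder ..

text \<open>Being a neighbourhood is tested in the chart, relative to its possibly non-open image,
  so that the notion makes sense on \<open>S_H\<close> as well.\<close>

definition nbhd :: "('a, 'b::topological_space) atlas \<Rightarrow> 'a \<Rightarrow> 'a set \<Rightarrow> bool" where
  "nbhd \<kappa> p W \<longleftrightarrow> (\<exists>U. open U \<and> chart_map \<kappa> p p \<in> U \<and> (\<forall>z\<in>U \<inter> chart_img \<kappa> p. chart_inv \<kappa> p z \<in> W))"

text \<open>The atlas of \<open>S_H\<close> is also indexed by pairs \<open>(x, u)\<close> with
  \<open>u\<close> outside \<open>Sp1C\<close>, where this fails; hence it appears as a hypothesis
  of the calculus rules.\<close>

definition centred :: "('a, 'b) atlas \<Rightarrow> 'a \<Rightarrow> bool" where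
  "centred \<kappa> p \<longleftrightarrow> chart_map \<kappa> p p \<in> chart_img \<kappa> p \<and> chart_inv \<kappa> p (chart_map \<kappa> p p) = p"

lemma cder_cong:
  assumes "centred \<kappa> p" "nbhd \<kappa> p W" "\<And>q. q \<in> W \<Longrightarrow> f q = g q" "cder \<kappa> p f D"
  shows "cder \<kappa> p g D"
proof -
  obtain U where U: "open U" "chart_map \<kappa> p p \<in> U" "\<And>z. z \<in> U \<inter> chart_img \<kappa> p \<Longrightarrow> chart_inv \<kappa> p z \<in> W"
    using assms(2) unfolding nbhd_def by auto
  obtain d where d: "d > 0" "ball (chart_map \<kappa> p p) d \<subseteq> U" using U openE by blast
  have "(g \<circ> chart_inv \<kappa> p has_derivative D) (at (chart_map \<kappa> p p) within chart_img \<kappa> p)"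
  proof (rule has_derivative_transform_within[OF _ d(1)])
    show "(f \<circ> chart_inv \<kappa> p has_derivative D) (at (chart_map \<kappa> p p) within chart_img \<kappa> p)"
      using assms(4) unfolding cder_def by simp
    show "chart_map \<kappa> p p \<in> chart_img \<kappa> p" using assms(1) unfolding centred_def by simp
    show "(f \<circ> chart_inv \<kappa> p) z = (g \<circ> chart_inv \<kappa> p) z"
      if "z \<in> chart_img \<kappa> p" "dist z (chart_map \<kappa> p p) < d" for z
      using that d(2) U(3)[of z] assms(3) by (auto simp: dist_commute subset_iff)
  qed
  then show ?thesis using assms(4) unfolding cder_def by simp
qed

lemma cdiff_at_cong:
  assumes "centred \<kappa> p" "nbhd \<kappa> p W" "\<And>q. q \<in> W \<Longrightarrow> f q = g q" "cdiff_at \<kappa> p f"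
  shows "cdiff_at \<kappa> p g"
proof -
  obtain D where "cder \<kappa> p f D" using assms(4) unfolding cdiff_at_iff_cder ..
  then show ?thesis by (intro cdiff_atI cder_cong[where f = f, OF assms(1-3)])
qed

lemma cder_const: "cder \<kappa> p (\<lambda>_. c) (\<lambda>_. 0)"
  by (simp add: cder_def clinear_on_def o_def)

lemma cder_add: "cder \<kappa> p f D \<Longrightarrow> cder \<kappa> p g E \<Longrightarrow> cder \<kappa> p (\<lambda>q. f q + g q) (\<lambda>v. D v + E v)"
  unfolding cder_def o_def clinear_on_def by (auto intro!: has_derivative_add simp: scaleC_add_right)

lemma cder_diff: "cder \<kappa> p f D \<Longrightarrow> cder \<kappa> p g E \<Longrightarrow> cder \<kappa> p (\<lambda>q. f q - g q) (\<lambda>v. D v - E v)"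
  unfolding cder_def o_def clinear_on_def by (auto intro!: has_derivative_diff simp: scaleC.diff_right)

lemma cder_sum:
  "(\<And>i. i \<in> I \<Longrightarrow> cder \<kappa> p (f i) (D i)) \<Longrightarrow> cder \<kappa> p (\<lambda>q. \<Sum>i\<in>I. f i q) (\<lambda>v. \<Sum>i\<in>I. D i v)"
  unfolding cder_def o_def clinear_on_def
  by (auto intro!: has_derivative_sum simp: scaleC.sum_right sum.distrib)

lemma cder_clinear:
  assumes "clinear_map L" "bounded_linear L" "cder \<kappa> p f D"
  shows "cder \<kappa> p (\<lambda>q. L (f q)) (\<lambda>v. L (D v))"
  using assms(3) bounded_linear.has_derivative[OF assms(2)]
  unfolding cder_def o_def clinear_on_def by (auto simp: clinear_map_simps[OF assms(1)])

lemma cder_bilinear: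
  assumes "centred \<kappa> p" "bounded_bilinear B" "\<And>x. clinear_map (B x)" "\<And>y. clinear_map (\<lambda>x. B x y)"
    and "cder \<kappa> p f D" "cder \<kappa> p g E"
  shows "cder \<kappa> p (\<lambda>q. B (f q) (g q)) (\<lambda>v. B (f p) (E v) + B (D v) (g p))"
proof -
  have "((\<lambda>x. B (f (chart_inv \<kappa> p x)) (g (chart_inv \<kappa> p x))) has_derivative (\<lambda>v. B (f p) (E v) + B (D v) (g p)))
      (at (chart_map \<kappa> p p) within chart_img \<kappa> p)"
    using bounded_bilinear.FDERIV[OF assms(2), where x = "chart_map \<kappa> p p" and s = "chart_img \<kappa> p"
        and f = "f \<circ> chart_inv \<kappa> p" and g = "g \<circ> chart_inv \<kappa> p" and f' = D and g' = E] assms(1,5,6)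
    by (simp add: cder_def centred_def)
  moreover have linD: "clinear_map D" and linE: "clinear_map E" using assms(5,6) unfolding cder_def by simp_all
  have "clinear_map (\<lambda>v. B (f p) (E v) + B (D v) (g p))"
    by (rule clinear_onI) (simp_all add: clinear_map_simps[OF assms(3)] clinear_map_simps[OF assms(4)]
        clinear_map_simps[OF linD] clinear_map_simps[OF linE] scaleC_add_right)
  ultimately show ?thesis unfolding cder_def o_def by simp
qed

lemma clinear_map_scaleC: "clinear_map (scaleC c :: 'a::complex_normed \<Rightarrow> 'a)" "clinear_map (\<lambda>c. c *\<^sub>C (x::'a))"
  by (auto simp: clinear_on_def scaleC_add_right scaleC_add_left scaleC_scaleC mult_ac scaleC_complex_def)

lemma cder_scaleC:
  assumes "centred \<kappa> p" "cder \<kappa> p f D" "cder \<kappa> p g E"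
  shows "cder \<kappa> p (\<lambda>q. f q *\<^sub>C g q) (\<lambda>v. f p *\<^sub>C E v + D v *\<^sub>C g p)"
  by (rule cder_bilinear[OF assms(1) bounded_bilinear_scaleC clinear_map_scaleC assms(2,3)])

lemma clinear_map_bounded:
  fixes L :: "'a::{complex_normed, euclidean_space} \<Rightarrow> 'b::complex_normed"
  assumes "clinear_map L"
  shows "bounded_linear L"
  using clinear_map_linear[OF assms] linear_conv_bounded_linear by auto

lemma cbilinear_bounded:
  fixes B :: "'a::{complex_normed, euclidean_space} \<Rightarrow> 'b::{complex_normed, euclidean_space} \<Rightarrow> 'c::complex_normed"
  assumes "\<And>x. clinear_map (B x)" "\<And>y. clinear_map (\<lambda>x. B x y)"
  shows "bounded_bilinear B"
  using clinear_map_linear[OF assms(1)] clinear_map_linear[OF assms(2)]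
  by (simp add: bilinear_conv_bounded_bilinear[symmetric] bilinear_def)

lemma clinear_map_matrix_mult:
  "clinear_map (\<lambda>B. (A :: complex^'n^'m) ** (B :: complex^'k^'n))"
  "clinear_map (\<lambda>A. (A :: complex^'n^'m) ** (B :: complex^'k^'n))"
  "clinear_map (\<lambda>v. (A :: complex^'n^'m) *v v)"
  "clinear_map (\<lambda>A. (A :: complex^'n^'m) *v v)"
  by (simp_all add: clinear_on_def matrix_matrix_mult_def matrix_vector_mult_def vec_eq_iff scaleC_complex_def
      sum.distrib sum_distrib_left distrib_left distrib_right mult_ac)

lemma cder_matrix_mult:
  fixes f :: "'a \<Rightarrow> complex^'n^'m" and g :: "'a \<Rightarrow> complex^'k^'n"
  assumes "centred \<kappa> p" "cder \<kappa> p f D" "cder \<kappa> p g E"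
  shows "cder \<kappa> p (\<lambda>q. f q ** g q) (\<lambda>v. f p ** E v + D v ** g p)"
  by (rule cder_bilinear[OF assms(1) cbilinear_bounded _ _ assms(2,3)]) (rule clinear_map_matrix_mult)+

lemma clinear_map_compose:
  assumes "clinear_map f" "clinear_map g"
  shows "clinear_map (\<lambda>v. f (g v))"
  by (simp add: clinear_on_def clinear_map_simps[OF assms(1)] clinear_map_simps[OF assms(2)])

lemma clinear_map_vec_nth: "clinear_map (\<lambda>v. v $ i)"
  by (simp add: clinear_on_def)

lemma cdiff_const: "cdiff_at \<kappa> p (\<lambda>_. c)"
  by (rule cdiff_atI[OF cder_const])

lemma cdiff_add: "cdiff_at \<kappa> p f \<Longrightarrow> cdiff_at \<kappa> p g \<Longrightarrow> cdiff_at \<kappa> p (\<lambda>q. f q + g q)"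
  by (elim cdiff_atE) (rule cdiff_atI[OF cder_add])

lemma cdiff_diff: "cdiff_at \<kappa> p f \<Longrightarrow> cdiff_at \<kappa> p g \<Longrightarrow> cdiff_at \<kappa> p (\<lambda>q. f q - g q)"
  by (elim cdiff_atE) (rule cdiff_atI[OF cder_diff])

lemma cdiff_sum:
  assumes "\<And>i. i \<in> I \<Longrightarrow> cdiff_at \<kappa> p (f i)"
  shows "cdiff_at \<kappa> p (\<lambda>q. \<Sum>i\<in>I. f i q)"
proof -
  have "cder \<kappa> p (f i) (SOME D. cder \<kappa> p (f i) D)" if "i \<in> I" for i
    using assms[OF that] unfolding cdiff_at_iff_cder by (rule someI_ex)
  then show ?thesis by (rule cdiff_atI[OF cder_sum])
qed

lemma cdiff_clinear:
  fixes f :: "'a \<Rightarrow> 'c::{complex_normed, euclidean_space}"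
  assumes "clinear_map L" "cdiff_at \<kappa> p f"
  shows "cdiff_at \<kappa> p (\<lambda>q. L (f q))"
  using assms(2) by (elim cdiff_atE) (rule cdiff_atI[OF cder_clinear[OF assms(1) clinear_map_bounded[OF assms(1)]]])

lemma cdiff_vec_nth: "cdiff_at \<kappa> p f \<Longrightarrow> cdiff_at \<kappa> p (\<lambda>q. f q $ i)"
  by (elim cdiff_atE) (rule cdiff_atI[OF cder_clinear[OF clinear_map_vec_nth bounded_linear_vec_nth]])

lemma cdiff_scaleC: "centred \<kappa> p \<Longrightarrow> cdiff_at \<kappa> p f \<Longrightarrow> cdiff_at \<kappa> p g \<Longrightarrow> cdiff_at \<kappa> p (\<lambda>q. f q *\<^sub>C g q)"
  by (elim cdiff_atE) (rule cdiff_atI[OF cder_scaleC])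

lemma cdiff_mult:
  fixes f g :: "'a \<Rightarrow> complex"
  shows "centred \<kappa> p \<Longrightarrow> cdiff_at \<kappa> p f \<Longrightarrow> cdiff_at \<kappa> p g \<Longrightarrow> cdiff_at \<kappa> p (\<lambda>q. f q * g q)"
  using cdiff_scaleC[of \<kappa> p f g] by (simp add: scaleC_complex_def)

lemma cdiff_matrix_mult:
  fixes f :: "'a \<Rightarrow> complex^'n^'m" and g :: "'a \<Rightarrow> complex^'k^'n"
  shows "centred \<kappa> p \<Longrightarrow> cdiff_at \<kappa> p f \<Longrightarrow> cdiff_at \<kappa> p g \<Longrightarrow> cdiff_at \<kappa> p (\<lambda>q. f q ** g q)"
  by (elim cdiff_atE) (rule cdiff_atI[OF cder_matrix_mult])

lemma cdiff_prod:
  fixes f :: "'i \<Rightarrow> 'a \<Rightarrow> complex"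
  assumes "centred \<kappa> p" "\<And>i. i \<in> I \<Longrightarrow> cdiff_at \<kappa> p (f i)"
  shows "cdiff_at \<kappa> p (\<lambda>q. \<Prod>i\<in>I. f i q)"
  using assms(2)
proof (induction I rule: infinite_finite_induct)
  case (insert i I)
  then show ?case using cdiff_mult[OF assms(1)] by simp
qed (auto intro: cdiff_const)

lemma cdiff_divide:
  fixes f g :: "'a \<Rightarrow> complex"
  assumes "centred \<kappa> p" "cdiff_at \<kappa> p f" "cdiff_at \<kappa> p g" "g p \<noteq> 0"
  shows "cdiff_at \<kappa> p (\<lambda>q. f q / g q)"
proof -
  obtain D E where D: "cder \<kappa> p f D" and E: "cder \<kappa> p g E"
    using assms(2,3) by (elim cdiff_atE)
  have linD: "clinear_map D" and linE: "clinear_map E" using D E unfolding cder_def by simp_all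
  show ?thesis
    unfolding cdiff_at_def
  proof (rule exI, rule conjI)
    show "clinear_map (\<lambda>h. - f p * (inverse (g p) * E h * inverse (g p)) + D h / g p)"
      by (rule clinear_onI) (simp_all add: clinear_map_simps[OF linD] clinear_map_simps[OF linE] scaleC_complex_def
          algebra_simps add_divide_distrib)
    show "((\<lambda>q. f q / g q) \<circ> chart_inv \<kappa> p has_derivative (\<lambda>h. - f p * (inverse (g p) * E h * inverse (g p)) + D h / g p))
        (at (chart_map \<kappa> p p) within chart_img \<kappa> p)"
      using has_derivative_divide[of "f \<circ> chart_inv \<kappa> p" D "chart_map \<kappa> p p" "chart_img \<kappa> p" "g \<circ> chart_inv \<kappa> p" E] D E assms(1,4)
      by (simp add: cder_def centred_def o_def)
  qed
qed

lemma cdiff_vec_lambda: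
  fixes f :: "'i::finite \<Rightarrow> 'a \<Rightarrow> 'c::{complex_normed, euclidean_space}"
  assumes "\<And>i. cdiff_at \<kappa> p (f i)"
  shows "cdiff_at \<kappa> p (\<lambda>q. \<chi> i. f i q)"
proof -
  define D where "D i = (SOME D. cder \<kappa> p (f i) D)" for i
  have "cder \<kappa> p (f i) (D i)" for i
    using assms[of i] unfolding cdiff_at_iff_cder D_def by (rule someI_ex)
  then have "cder \<kappa> p (\<lambda>q. \<chi> i. f i q) (\<lambda>v. \<chi> i. D i v)"
    unfolding cder_def clinear_on_vec_iff[of UNIV "\<lambda>v. \<chi> i. D i v"]
      has_derivative_vec_iff[of "(\<lambda>q. \<chi> i. f i q) \<circ> chart_inv \<kappa> p"] by (simp add: o_def)
  then show ?thesis by (rule cdiff_atI)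
qed

lemma cdiff_matrix_vec:
  fixes f :: "'a \<Rightarrow> complex^'n^'m" and g :: "'a \<Rightarrow> complex^'n"
  assumes "centred \<kappa> p" "cdiff_at \<kappa> p f" "cdiff_at \<kappa> p g"
  shows "cdiff_at \<kappa> p (\<lambda>q. f q *v g q)"
  unfolding matrix_vector_mult_def
  by (intro cdiff_vec_lambda cdiff_sum cdiff_mult cdiff_vec_nth assms)

section \<open>Solutions of linear systems with differentiable coefficients\<close>

lemma cdiff_det:
  fixes f :: "'a \<Rightarrow> complex^'n^'n"
  assumes "centred \<kappa> p" "cdiff_at \<kappa> p f"
  shows "cdiff_at \<kappa> p (\<lambda>q. det (f q))"
  unfolding det_def
  by (intro cdiff_sum cdiff_mult cdiff_prod cdiff_vec_nth cdiff_const assms)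

text \<open>By Cramer's rule the solution is a vector of quotients of determinants.\<close>

lemma cdiff_linear_system:
  fixes N :: "'a \<Rightarrow> complex^'n^'n" and w f :: "'a \<Rightarrow> complex^'n"
  assumes c: "centred \<kappa> p" and N: "cdiff_at \<kappa> p N" and w: "cdiff_at \<kappa> p w"
    and W: "nbhd \<kappa> p W" "\<And>q. q \<in> W \<Longrightarrow> invertible (N q) \<and> N q *v f q = w q" "p \<in> W"
  shows "cdiff_at \<kappa> p f"
proof (rule cdiff_at_cong[OF c W(1)])
  show "(\<chi> k. det (\<chi> i j. if j = k then w q $ i else N q $ i $ j) / det (N q)) = f q" if "q \<in> W" for q
    using W(2)[OF that] cramer[of "N q" "f q" "w q"] by (simp add: invertible_det_nz)
  have if_cdiff: "cdiff_at \<kappa> p (\<lambda>q. if b then F q else G q)" if "cdiff_at \<kappa> p F" "cdiff_at \<kappa> p G" for b F and G :: "_ \<Rightarrow> complex"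
    using that by (cases b) simp_all
  show "cdiff_at \<kappa> p (\<lambda>q. \<chi> k. det (\<chi> i j. if j = k then w q $ i else N q $ i $ j) / det (N q))"
    by (intro cdiff_vec_lambda cdiff_divide cdiff_det cdiff_vec_nth if_cdiff c N w)
       (use W(2,3) in \<open>auto simp: invertible_det_nz\<close>)
qed

text \<open>The maps \<open>L q\<close> go between different spaces, so there is no determinant to
  divide by. Composing with the inverse of \<open>L p\<close> at the fixed point \<open>p\<close>
  turns them into the square matrices \<open>N q\<close> and reduces the claim to Cramer's
  rule.\<close>

lemma cdiff_linear_map_system:
  fixes L :: "'a \<Rightarrow> 'v::{complex_normed, euclidean_space} \<Rightarrow> complex^'n" and f :: "'a \<Rightarrow> 'v"
  assumes c: "centred \<kappa> p" and L: "\<And>v. cdiff_at \<kappa> p (\<lambda>q. L q v)" and w: "cdiff_at \<kappa> p w"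
    and W: "nbhd \<kappa> p W" "p \<in> W" "\<And>q. q \<in> W \<Longrightarrow> clinear_map (L q) \<and> bij (L q)" "\<And>q. q \<in> W \<Longrightarrow> L q (f q) = w q"
  shows "cdiff_at \<kappa> p f"
proof -
  define M where "M = inv (L p)"
  have bij: "bij (L p)" and lin: "clinear_map (L p)" using W by auto
  have LM: "L p (M v) = v" and RM: "M (L p v') = v'" for v v'
    using bij by (auto simp: M_def surj_f_inv_f bij_is_surj inv_f_f bij_is_inj)
  have linM: "clinear_map M"
  proof (rule clinear_onI)
    show "M (v + v') = M v + M v'" for v v'
      using RM[of "M v + M v'"] by (simp add: clinear_map_simps[OF lin] LM)
    show "M (r *\<^sub>C v) = r *\<^sub>C M v" for r v
      using RM[of "r *\<^sub>C M v"] by (simp add: clinear_map_simps[OF lin] LM)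
  qed
  have bijM: "bij M" unfolding M_def using bij by (rule bij_imp_bij_inv)
  define N where "N q = (\<chi> i j. L q (M (axis j 1)) $ i)" for q
  have NM: "N q *v v = L q (M v)" if "q \<in> W" for q v
  proof -
    have linq: "clinear_map (L q)" using W(3)[OF that] ..
    have v: "v = (\<Sum>j\<in>UNIV. v $ j *\<^sub>C axis j 1)"
      by (simp add: vec_eq_iff axis_def scaleC_complex_def mult_delta_right)
    show ?thesis
      by (subst (2) v) (simp add: vec_eq_iff N_def matrix_vector_mult_def clinear_map_simps[OF linq]
          clinear_map_simps[OF linM] scaleC_complex_def mult.commute)
  qed
  have "cdiff_at \<kappa> p (\<lambda>q. L p (f q))"
  proof (rule cdiff_linear_system[OF c _ w W(1) _ W(2), of N])
    show "cdiff_at \<kappa> p N"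
      unfolding N_def by (intro cdiff_vec_lambda cdiff_vec_nth L)
    show "invertible (N q) \<and> N q *v L p (f q) = w q" if "q \<in> W" for q
    proof
      have "inj ((*v) (N q))"
        unfolding NM[OF that, abs_def]
        using bij_is_inj[OF bijM] W(3)[OF that] by (auto simp: inj_def bij_def)
      then show "invertible (N q)"
        unfolding invertible_left_inverse matrix_left_invertible_injective .
      show "N q *v L p (f q) = w q"
        using W(4)[OF that] by (simp add: NM[OF that] RM)
    qed
  qed
  from cdiff_clinear[OF linM this] show ?thesis by (simp add: RM)
qed

section \<open>Calculus on a complex manifold\<close>

lemmas matrix_mult_simps =
  clinear_map_simps[OF clinear_map_matrix_mult(1)] clinear_map_simps[OF clinear_map_matrix_mult(2)]

lemma vec_basis_sum: "v = (\<Sum>i\<in>UNIV. v $ i *\<^sub>C axis i (1::complex))"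
  by (simp add: vec_eq_iff axis_def scaleC_complex_def mult_delta_right)

lemma clinear_map_basis:
  assumes "clinear_map (D :: complex^'m \<Rightarrow> 'c::complex_normed)"
  shows "D v = (\<Sum>i\<in>UNIV. v $ i *\<^sub>C D (axis i 1))"
  by (subst vec_basis_sum[of v]) (simp only: clinear_map_simps[OF assms])

locale cmanifold =
  fixes \<kappa> :: "('a::{t2_space, second_countable_topology}, complex ^ 'm::finite) atlas"
  assumes complex_manifold: "complex_manifold \<kappa>"
begin

abbreviation "chart \<equiv> chart_map \<kappa>"
abbreviation "cdom \<equiv> chart_dom \<kappa>"
abbreviation "cinv \<equiv> chart_inv \<kappa>"
abbreviation "holo_vf \<equiv> holo_field \<kappa> full_tangent"

lemma open_dom: "open (cdom p)"
  and mem_dom [simp]: "p \<in> cdom p"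
  and open_img: "open (chart_img \<kappa> p)"
  and chart_homeo: "homeomorphism (cdom p) (chart_img \<kappa> p) (chart p) (cinv p)"
  using complex_manifold unfolding complex_manifold_def by auto

lemma chart_inv_map [simp]: "q \<in> cdom p \<Longrightarrow> cinv p (chart p q) = q"
  and chart_map_inv [simp]: "z \<in> chart_img \<kappa> p \<Longrightarrow> chart p (cinv p z) = z"
  and chart_inv_mem: "z \<in> chart_img \<kappa> p \<Longrightarrow> cinv p z \<in> cdom p"
  and chart_map_mem: "q \<in> cdom p \<Longrightarrow> chart p q \<in> chart_img \<kappa> p"
  using chart_homeo[of p] unfolding homeomorphism_def by auto

lemma centred: "centred \<kappa> p"
  unfolding centred_def by (simp add: chart_map_mem)

lemma open_chart_image:
  assumes "open W"
  shows "open (chart p ` (W \<inter> cdom p))"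
proof -
  have "chart p ` (W \<inter> cdom p) = chart_img \<kappa> p \<inter> cinv p -` W"
    by (force simp: chart_map_mem chart_inv_mem image_iff)
  moreover have "continuous_on (chart_img \<kappa> p) (cinv p)"
    using chart_homeo[of p] unfolding homeomorphism_def by auto
  ultimately show ?thesis using continuous_open_preimage[OF _ open_img assms] by metis
qed

lemma nbhdI:
  assumes "open W" "p \<in> W"
  shows "nbhd \<kappa> p W"
  unfolding nbhd_def
  by (rule exI[of _ "chart p ` (W \<inter> cdom p)"]) (use assms open_chart_image in auto)

lemma cdiff_at_local:
  assumes "cdiff_at \<kappa> p f" "open W" "p \<in> W" "\<And>q. q \<in> W \<Longrightarrow> f q = g q"
  shows "cdiff_at \<kappa> p g"
  using cdiff_at_cong[where f = f, OF centred nbhdI[OF assms(2,3)] assms(4,1)] by simp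

lemma cder_local:
  assumes "cder \<kappa> p f D" "open W" "p \<in> W" "\<And>q. q \<in> W \<Longrightarrow> f q = g q"
  shows "cder \<kappa> p g D"
  using cder_cong[where f = f, OF centred nbhdI[OF assms(2,3)] assms(4,1)] by simp

lemma at_img: "at (chart p p) within chart_img \<kappa> p = at (chart p p)"
  by (rule at_within_open[OF chart_map_mem[OF mem_dom] open_img])

lemma dir_eq:
  assumes "cder \<kappa> p f D"
  shows "dir \<kappa> f p = D"
proof
  show "dir \<kappa> f p v = D v" for v
    using fder_eq[of "f \<circ> cinv p" D] assms unfolding cder_def dir_def at_img by simp
qed

lemma cder_dir:
  assumes "cdiff_at \<kappa> p f"
  shows "cder \<kappa> p f (dir \<kappa> f p)"
  using assms by (elim cdiff_atE) (simp add: dir_eq)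

lemma clinear_dir: "cdiff_at \<kappa> p f \<Longrightarrow> clinear_map (dir \<kappa> f p)"
  using cder_dir unfolding cder_def by blast

lemma dir_local:
  assumes "cdiff_at \<kappa> p f" "open W" "p \<in> W" "\<And>q. q \<in> W \<Longrightarrow> f q = g q"
  shows "dir \<kappa> g p = dir \<kappa> f p"
  by (rule dir_eq[OF cder_local[OF cder_dir[OF assms(1)] assms(2-4)]])

lemma transition:
  assumes "r \<in> cdom p" "r \<in> cdom q"
  shows "clinear_map (fder (chart q \<circ> cinv p) (chart p r))"
    "(chart q \<circ> cinv p has_derivative fder (chart q \<circ> cinv p) (chart p r)) (at (chart p r))"
proof -
  have "holo_on (chart p ` (cdom q \<inter> cdom p)) (chart q \<circ> cinv p)"
    using complex_manifold unfolding complex_manifold_def by (metis Int_commute)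
  then show "clinear_map (fder (chart q \<circ> cinv p) (chart p r))"
    "(chart q \<circ> cinv p has_derivative fder (chart q \<circ> cinv p) (chart p r)) (at (chart p r))"
    using holo_on_fder[OF open_chart_image[OF open_dom]] assms by blast+
qed

text \<open>The field with constant components \<open>w\<close> in the chart around
  \<open>p\<close>. The transition map enters because a tangent vector at \<open>q\<close> is
  recorded in the chart around \<open>q\<close>.\<close>

definition coord_field :: "'a \<Rightarrow> complex^'m \<Rightarrow> 'a \<Rightarrow> complex^'m" where
  "coord_field p w q = fder (chart q \<circ> cinv p) (chart p q) w"

lemma clinear_coord_field: "q \<in> cdom p \<Longrightarrow> clinear_map (\<lambda>w. coord_field p w q)"
  unfolding coord_field_def using transition(1)[OF _ mem_dom] by simp

lemma dir_chart:
  assumes q: "q \<in> cdom p" and f: "cdiff_at \<kappa> q f"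
  shows "(f \<circ> cinv p has_derivative (\<lambda>w. dir \<kappa> f q (coord_field p w q))) (at (chart p q))"
proof -
  define W where "W = chart p ` (cdom q \<inter> cdom p)"
  have W: "open W" "chart p q \<in> W" unfolding W_def using q open_chart_image[OF open_dom] by auto
  have *: "(f \<circ> cinv q has_derivative dir \<kappa> f q) (at ((chart q \<circ> cinv p) (chart p q)))"
    using cder_dir[OF f] q unfolding cder_def at_img by simp
  have "((f \<circ> cinv q) \<circ> (chart q \<circ> cinv p) has_derivative (\<lambda>w. dir \<kappa> f q (coord_field p w q))) (at (chart p q))"
    using diff_chain_at[OF transition(2)[OF q mem_dom] *] unfolding coord_field_def o_def .
  then show ?thesis
    by (rule has_derivative_transform_within_open[OF _ W]) (auto simp: W_def)
qed

lemma cder_chart: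
  assumes q: "q \<in> cdom p" and D: "clinear_map D" "(f \<circ> cinv p has_derivative D) (at (chart p q))"
  shows "cder \<kappa> q f (\<lambda>v. D (dir \<kappa> (chart p) q v))"
proof -
  define W where "W = chart q ` (cdom p \<inter> cdom q)"
  have W: "open W" "chart q q \<in> W" unfolding W_def using q open_chart_image[OF open_dom] by auto
  have cd: "cder \<kappa> q (chart p) (dir \<kappa> (chart p) q)"
    by (intro cder_dir) (use transition[OF mem_dom q] in \<open>unfold cdiff_at_def at_img, blast\<close>)
  then have J: "clinear_map (dir \<kappa> (chart p) q)"
     "(chart p \<circ> cinv q has_derivative dir \<kappa> (chart p) q) (at (chart q q))"
    unfolding cder_def at_img by auto
  have *: "(f \<circ> cinv p has_derivative D) (at ((chart p \<circ> cinv q) (chart q q)))"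
    using D(2) by simp
  have "((f \<circ> cinv p) \<circ> (chart p \<circ> cinv q) has_derivative (\<lambda>v. D (dir \<kappa> (chart p) q v))) (at (chart q q))"
    using diff_chain_at[OF J(2) *] unfolding o_def .
  then have "(f \<circ> cinv q has_derivative (\<lambda>v. D (dir \<kappa> (chart p) q v))) (at (chart q q))"
    by (rule has_derivative_transform_within_open[OF _ W]) (auto simp: W_def)
  then show ?thesis unfolding cder_def at_img using clinear_map_compose[OF D(1) J(1)] by simp
qed

lemma cdiff_chart_map: "q \<in> cdom p \<Longrightarrow> cdiff_at \<kappa> q (chart p)"
  unfolding cdiff_at_def at_img using transition[OF mem_dom] by blast

lemma dir_chart_map_coord_field [simp]:
  assumes "q \<in> cdom p"
  shows "dir \<kappa> (chart p) q (coord_field p w q) = w"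
proof -
  have "(chart p \<circ> cinv p has_derivative (\<lambda>w. w)) (at (chart p q))"
    by (rule has_derivative_transform_within_open[OF has_derivative_ident open_img[of p]])
       (use assms in \<open>auto simp: chart_map_mem\<close>)
  from has_derivative_unique[OF dir_chart[OF assms cdiff_chart_map[OF assms]] this] show ?thesis by metis
qed

lemma dir_chart_map_self [simp]: "dir \<kappa> (chart p) p v = v"
proof -
  have "cder \<kappa> p (chart p) (\<lambda>v. v)"
    unfolding cder_def at_img
  proof
    show "(chart p \<circ> cinv p has_derivative (\<lambda>w. w)) (at (chart p p))"
      by (rule has_derivative_transform_within_open[OF has_derivative_ident open_img[of p]])
         (auto simp: chart_map_mem)
  qed (simp add: clinear_on_def)
  then show ?thesis by (simp add: dir_eq)
qed

lemma dir_via_chart: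
  assumes q: "q \<in> cdom p" and f: "cdiff_at \<kappa> q f"
  shows "dir \<kappa> f q v = fder (f \<circ> cinv p) (chart p q) (dir \<kappa> (chart p) q v)"
proof -
  have "clinear_map (\<lambda>w. dir \<kappa> f q (coord_field p w q))"
    by (rule clinear_map_compose[OF clinear_dir[OF f] clinear_coord_field[OF q]])
  from fun_cong[OF dir_eq[OF cder_chart[OF q this dir_chart[OF q f]]]] show ?thesis
    by (rule trans) (simp only: fder_eq[OF dir_chart[OF q f]])
qed

lemma coord_field_dir_chart_map [simp]:
  assumes q: "q \<in> cdom p"
  shows "coord_field p (dir \<kappa> (chart p) q v) q = v"
  unfolding coord_field_def
  using dir_via_chart[OF q cdiff_chart_map[of q q], of v] by simp

lemma coord_field_self [simp]: "coord_field p w p = w"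
  using coord_field_dir_chart_map[of p p w] by simp

lemma field_comp_self [simp]: "field_comp \<kappa> p X p = X p"
  by (simp add: field_comp_def)

lemma field_comp_coord_field [simp]: "q \<in> cdom p \<Longrightarrow> field_comp \<kappa> p (coord_field p w) q = w"
  by (simp add: field_comp_def)

lemma holo_on_chart:
  assumes V: "open V" "holo_fun \<kappa> V f"
  shows "holo_on (chart p ` (V \<inter> cdom p)) (f \<circ> cinv p)"
  unfolding holo_on_open_iff[OF open_chart_image[OF V(1)]]
proof
  fix z assume "z \<in> chart p ` (V \<inter> cdom p)"
  then obtain q where q: "q \<in> V" "q \<in> cdom p" "z = chart p q" by auto
  have f: "cdiff_at \<kappa> q f" using V q unfolding holo_fun_def by blast
  show "\<exists>D. clinear_map D \<and> (f \<circ> cinv p has_derivative D) (at z)"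
    unfolding q(3) using dir_chart[OF q(2) f] clinear_map_compose[OF clinear_dir[OF f] clinear_coord_field[OF q(2)]]
    by blast
qed

lemma cdiff_chart:
  assumes "q \<in> cdom p" "holo_on Z g" "open Z" "chart p q \<in> Z"
  shows "cder \<kappa> q (\<lambda>r. g (chart p r)) (\<lambda>v. fder g (chart p q) (dir \<kappa> (chart p) q v))"
proof (rule cder_chart[OF assms(1) holo_on_fder(1)[OF assms(3,2,4)]])
  show "((\<lambda>r. g (chart p r)) \<circ> cinv p has_derivative fder g (chart p q)) (at (chart p q))"
    by (rule has_derivative_transform_within_open[OF holo_on_fder(2)[OF assms(3,2,4)] open_img[of p]])
       (use assms(1) in \<open>auto simp: chart_map_mem\<close>)
qed

text \<open>The derivatives of \<open>f\<close> in the chart are assumed to be holomorphic, to cover both vector and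
  matrix values of \<open>f\<close>.\<close>

lemma cder_dir_field:
  fixes f :: "'a \<Rightarrow> 'c::complex_normed"
  assumes V: "open V" "p \<in> V" "holo_fun \<kappa> V f"
    and holo: "\<And>w. holo_on (chart r ` (V \<inter> cdom r)) (\<lambda>z. fder (f \<circ> cinv r) z w)"
    and r: "p \<in> cdom r"
    and X: "cdiff_at \<kappa> p (field_comp \<kappa> r X)"
  shows "cder \<kappa> p (\<lambda>q. dir \<kappa> f q (X q))
    (\<lambda>v. (\<Sum>i\<in>UNIV. field_comp \<kappa> r X p $ i *\<^sub>C
           fder (\<lambda>z. fder (f \<circ> cinv r) z (axis i 1)) (chart r p) (dir \<kappa> (chart r) p v))
       + fder (f \<circ> cinv r) (chart r p) (dir \<kappa> (field_comp \<kappa> r X) p v))"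
proof -
  define Z where "Z = chart r ` (V \<inter> cdom r)"
  have Z: "open Z" "chart r q \<in> Z" if "q \<in> V \<inter> cdom r" for q
    unfolding Z_def using that V r open_chart_image by auto
  have lin: "clinear_map (fder (f \<circ> cinv r) (chart r q))" if "q \<in> V \<inter> cdom r" for q
    by (rule holo_on_fder(1)[OF Z(1)[OF that] _ Z(2)[OF that]]) (use holo_on_chart[OF V(1,3)] in \<open>simp add: Z_def\<close>)
  have prV: "p \<in> V \<inter> cdom r" using V r by simp
  have comp: "cder \<kappa> p (\<lambda>q. field_comp \<kappa> r X q $ i) (\<lambda>v. dir \<kappa> (field_comp \<kappa> r X) p v $ i)" for i
    by (rule cder_clinear[OF clinear_map_vec_nth bounded_linear_vec_nth cder_dir[OF X]])
  have sum: "cder \<kappa> p (\<lambda>q. \<Sum>i\<in>UNIV. field_comp \<kappa> r X q $ i *\<^sub>C fder (f \<circ> cinv r) (chart r q) (axis i 1))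
    (\<lambda>v. \<Sum>i\<in>UNIV. field_comp \<kappa> r X p $ i *\<^sub>C
           fder (\<lambda>z. fder (f \<circ> cinv r) z (axis i 1)) (chart r p) (dir \<kappa> (chart r) p v)
          + dir \<kappa> (field_comp \<kappa> r X) p v $ i *\<^sub>C fder (f \<circ> cinv r) (chart r p) (axis i 1))"
    by (intro cder_sum cder_scaleC[OF centred comp] cdiff_chart[OF r _ Z[OF prV]])
       (rule holo[folded Z_def])
  have "cder \<kappa> p (\<lambda>q. dir \<kappa> f q (X q))
    (\<lambda>v. \<Sum>i\<in>UNIV. field_comp \<kappa> r X p $ i *\<^sub>C
           fder (\<lambda>z. fder (f \<circ> cinv r) z (axis i 1)) (chart r p) (dir \<kappa> (chart r) p v)
          + dir \<kappa> (field_comp \<kappa> r X) p v $ i *\<^sub>C fder (f \<circ> cinv r) (chart r p) (axis i 1))"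
  proof (rule cder_local[OF sum _ prV])
    show "open (V \<inter> cdom r)" using V open_dom by auto
    show "(\<Sum>i\<in>UNIV. field_comp \<kappa> r X q $ i *\<^sub>C fder (f \<circ> cinv r) (chart r q) (axis i 1)) = dir \<kappa> f q (X q)"
      if "q \<in> V \<inter> cdom r" for q
      using dir_via_chart[of q r f "X q"] clinear_map_basis[OF lin[OF that], of "field_comp \<kappa> r X q"] that V(3)
      by (auto simp: holo_fun_def field_comp_def)
  qed
  then show ?thesis
    by (simp add: sum.distrib clinear_map_basis[OF lin[OF prV], symmetric])
qed

text \<open>The components in the chart around \<open>p'\<close> are the derivative of that chart
  map along the field, so this is \<open>cder_dir_field\<close> for a chart map. Even independence
  of the chart thus rests on derivatives of holomorphic functions being holomorphic.\<close>

lemma field_comp_change_chart: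
  assumes "q \<in> cdom p" "q \<in> cdom p'" "cdiff_at \<kappa> q (field_comp \<kappa> p X)"
  shows "cdiff_at \<kappa> q (field_comp \<kappa> p' X)"
proof -
  define V where "V = cdom p \<inter> cdom p'"
  have V: "open V" "q \<in> V" "holo_fun \<kappa> V (chart p')"
    unfolding V_def using assms open_dom by (auto simp: holo_fun_def cdiff_chart_map)
  have "holo_on (chart p ` (V \<inter> cdom p)) (\<lambda>z. fder (chart p' \<circ> cinv p) z w)" for w
    by (rule fder_holo_on_vec(1)[OF open_chart_image[OF V(1)] holo_on_chart[OF V(1,3)]])
  from cdiff_atI[OF cder_dir_field[OF V this assms(1,3)]] show ?thesis
    unfolding field_comp_def[abs_def] .
qed

lemma holo_field_iff:
  assumes "V \<subseteq> cdom p"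
  shows "holo_vf V X \<longleftrightarrow> (\<forall>q\<in>V. cdiff_at \<kappa> q (field_comp \<kappa> p X))"
  unfolding holo_field_def
  using assms field_comp_change_chart[of _ _ p X] field_comp_change_chart[of _ p _ X] by (metis UNIV_I mem_dom subsetD)

lemma holo_field_coord_field: "holo_vf (cdom p) (coord_field p w)"
  unfolding holo_field_iff[OF order_refl]
proof
  fix q assume q: "q \<in> cdom p"
  show "cdiff_at \<kappa> q (field_comp \<kappa> p (coord_field p w))"
    by (rule cdiff_at_local[OF cdiff_const open_dom q]) simp
qed

lemma holo_fieldD: "holo_field \<kappa> T V X \<Longrightarrow> p \<in> V \<Longrightarrow> cdiff_at \<kappa> p (field_comp \<kappa> p X)"
  unfolding holo_field_def by blast

lemma holo_fun_dir:
  fixes f :: "'a \<Rightarrow> complex^'n^'k"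
  assumes V: "open V" "holo_fun \<kappa> V f" and X: "holo_vf V X"
  shows "holo_fun \<kappa> V (\<lambda>q. dir \<kappa> f q (X q))"
  unfolding holo_fun_def
proof
  fix p assume p: "p \<in> V"
  have "holo_on (chart p ` (V \<inter> cdom p)) (\<lambda>z. fder (f \<circ> cinv p) z w)" for w
    by (rule fder_holo_on_mat(1)[OF open_chart_image[OF V(1)] holo_on_chart[OF V]])
  from cdiff_atI[OF cder_dir_field[OF V(1) p V(2) this mem_dom holo_fieldD[OF X p]]]
  show "cdiff_at \<kappa> p (\<lambda>q. dir \<kappa> f q (X q))" .
qed

text \<open>The second derivatives of \<open>f\<close> cancel by their symmetry; what is left
  differentiates the components of the fields, and these terms make up the bracket.\<close>

lemma dir_dir_bracket:
  fixes f :: "'a \<Rightarrow> complex^'n^'k"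
  assumes V: "open V" "p \<in> V" "holo_fun \<kappa> V f"
    and X: "holo_vf V X" and Y: "holo_vf V Y"
  shows "dir \<kappa> (\<lambda>q. dir \<kappa> f q (Y q)) p (X p) - dir \<kappa> (\<lambda>q. dir \<kappa> f q (X q)) p (Y p) = dir \<kappa> f p (bracket \<kappa> X Y p)"
proof -
  define Z where "Z = chart p ` (V \<inter> cdom p)"
  define g where "g = f \<circ> cinv p"
  define z where "z = chart p p"
  have Z: "open Z" "z \<in> Z" unfolding Z_def z_def using V open_chart_image by auto
  have g: "holo_on Z g" unfolding Z_def g_def by (rule holo_on_chart[OF V(1,3)])
  have hol: "holo_on Z (\<lambda>z. fder g z w)" for w by (rule fder_holo_on_mat(1)[OF Z(1) g])
  have lin: "clinear_map (fder g z)" by (rule holo_on_fder(1)[OF Z(1) g Z(2)])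
  have lin2: "clinear_map (fder (\<lambda>z. fder g z w) z)" for w by (rule holo_on_fder(1)[OF Z(1) hol Z(2)])
  have dd: "dir \<kappa> (\<lambda>q. dir \<kappa> f q (X q)) p v =
    (\<Sum>i\<in>UNIV. X p $ i *\<^sub>C fder (\<lambda>z. fder g z (axis i 1)) z v) + fder g z (dir \<kappa> (field_comp \<kappa> p X) p v)"
    if "holo_vf V X" for X v
    unfolding dir_eq[OF cder_dir_field[OF V hol[unfolded Z_def g_def] mem_dom holo_fieldD[OF that V(2)]]]
    by (simp add: g_def z_def)
  have sym: "(\<Sum>i\<in>UNIV. x $ i *\<^sub>C fder (\<lambda>z. fder g z (axis i 1)) z y) = fder (\<lambda>z. fder g z y) z x" for x y
    unfolding fder_holo_on_mat(2)[OF Z(1) g Z(2), of _ y] by (rule clinear_map_basis[OF lin2, symmetric])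
  have f: "dir \<kappa> f p v = fder g z v" for v
    using dir_via_chart[of p p f v] V by (simp add: g_def z_def holo_fun_def)
  show ?thesis
    unfolding dd[OF X] dd[OF Y] sym f bracket_def
    by (simp add: fder_holo_on_mat(2)[OF Z(1) g Z(2), of "X p" "Y p"] clinear_map_simps[OF lin])
qed

section \<open>Curvature on a complex manifold\<close>

text \<open>The curvature evaluated on coordinate fields of the chart around \<open>p\<close>. Their
  components are constant, so their bracket vanishes at \<open>p\<close> and there is no bracket
  term.\<close>

definition curv :: "('a \<Rightarrow> complex^'m \<Rightarrow> complex^'r::finite^'r) \<Rightarrow> 'a \<Rightarrow> complex^'m \<Rightarrow> complex^'m \<Rightarrow> complex^'r^'r" where
  "curv A p v w = dir \<kappa> (\<lambda>q. A q (coord_field p w q)) p v - dir \<kappa> (\<lambda>q. A q (coord_field p v q)) p w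
     + (A p v ** A p w - A p w ** A p v)"

context
  fixes A :: "'a \<Rightarrow> complex^'m \<Rightarrow> complex^'r::finite^'r"
  assumes A: "connection_form \<kappa> full_tangent UNIV A"
begin

lemma conn_linear: "clinear_map (A p)"
  using A unfolding connection_form_def by simp

lemma conn_holo: "open V \<Longrightarrow> holo_vf V X \<Longrightarrow> holo_fun \<kappa> V (\<lambda>q. A q (X q))"
  using A unfolding connection_form_def by simp

lemma conn_coord_cdiff: "q \<in> cdom p \<Longrightarrow> cdiff_at \<kappa> q (\<lambda>q. A q (coord_field p w q))"
  using conn_holo[OF open_dom holo_field_coord_field] unfolding holo_fun_def by blast

lemma conn_coord_linear: "q \<in> cdom p \<Longrightarrow> clinear_map (\<lambda>w. A q (coord_field p w q))"
  by (rule clinear_map_compose[OF conn_linear clinear_coord_field])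

text \<open>The product rule after expanding \<open>X\<close> in coordinate fields: the first
  summand freezes the components of \<open>X\<close> at \<open>p\<close>, the second differentiates
  them.\<close>

lemma cder_conn_field:
  assumes X: "cdiff_at \<kappa> p (field_comp \<kappa> p X)"
  shows "cder \<kappa> p (\<lambda>q. A q (X q))
    (\<lambda>v. dir \<kappa> (\<lambda>q. A q (coord_field p (X p) q)) p v + A p (dir \<kappa> (field_comp \<kappa> p X) p v))"
proof -
  have comp: "cder \<kappa> p (\<lambda>q. field_comp \<kappa> p X q $ i) (\<lambda>v. dir \<kappa> (field_comp \<kappa> p X) p v $ i)" for i
    by (rule cder_clinear[OF clinear_map_vec_nth bounded_linear_vec_nth cder_dir[OF X]])
  have const: "cder \<kappa> p (\<lambda>_. c) (\<lambda>_. 0)" for c :: complex by (rule cder_const)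
  have d: "dir \<kappa> (\<lambda>q. A q (coord_field p w q)) p v
      = (\<Sum>i\<in>UNIV. w $ i *\<^sub>C dir \<kappa> (\<lambda>q. A q (coord_field p (axis i 1) q)) p v)" for w v
  proof -
    have "cder \<kappa> p (\<lambda>q. \<Sum>i\<in>UNIV. w $ i *\<^sub>C A q (coord_field p (axis i 1) q))
      (\<lambda>v. \<Sum>i\<in>UNIV. w $ i *\<^sub>C dir \<kappa> (\<lambda>q. A q (coord_field p (axis i 1) q)) p v + 0 *\<^sub>C A p (coord_field p (axis i 1) p))"
      by (intro cder_sum cder_scaleC[OF centred const] cder_dir conn_coord_cdiff mem_dom)
    from dir_eq[OF cder_local[OF this open_dom mem_dom, of "\<lambda>q. A q (coord_field p w q)"]] show ?thesis
      by (simp add: clinear_map_basis[OF conn_coord_linear, symmetric])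
  qed
  have *: "cder \<kappa> p (\<lambda>q. \<Sum>i\<in>UNIV. field_comp \<kappa> p X q $ i *\<^sub>C A q (coord_field p (axis i 1) q))
    (\<lambda>v. \<Sum>i\<in>UNIV. field_comp \<kappa> p X p $ i *\<^sub>C dir \<kappa> (\<lambda>q. A q (coord_field p (axis i 1) q)) p v
       + dir \<kappa> (field_comp \<kappa> p X) p v $ i *\<^sub>C A p (coord_field p (axis i 1) p))"
    by (intro cder_sum cder_scaleC[OF centred comp] cder_dir conn_coord_cdiff mem_dom)
  have eq: "(\<Sum>i\<in>UNIV. field_comp \<kappa> p X q $ i *\<^sub>C A q (coord_field p (axis i 1) q)) = A q (X q)"
    if "q \<in> cdom p" for q
    unfolding clinear_map_basis[OF conn_coord_linear[OF that], symmetric] using that by (simp add: field_comp_def)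
  show ?thesis
    using cder_local[OF * open_dom mem_dom eq]
    by (simp add: sum.distrib d[symmetric] clinear_map_basis[OF conn_linear, symmetric])
qed

text \<open>Tensoriality: by \<open>cder_conn_field\<close> the derivatives of the components of
  \<open>X\<close> and \<open>Y\<close> contribute exactly \<open>A\<close> of the bracket, which
  the last term of the curvature removes.\<close>

lemma curvature_eq_curv:
  assumes "cdiff_at \<kappa> p (field_comp \<kappa> p X)" "cdiff_at \<kappa> p (field_comp \<kappa> p Y)"
  shows "curvature \<kappa> A X Y p = curv A p (X p) (Y p)"
  unfolding curvature_def curv_def bracket_def dir_eq[OF cder_conn_field[OF assms(1)]] dir_eq[OF cder_conn_field[OF assms(2)]]
  by (simp add: clinear_map_simps[OF conn_linear])

lemma curv_linear: "clinear_map (\<lambda>w. curv A p v w)" "clinear_map (\<lambda>v. curv A p v w)"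
  and curv_anti: "curv A p w v = - curv A p v w"
proof -
  show anti: "curv A p w v = - curv A p v w" for v w by (simp add: curv_def)
  have c: "cdiff_at \<kappa> p (\<lambda>q. A q (coord_field p w q))" for w
    by (rule conn_coord_cdiff[OF mem_dom])
  have d: "clinear_map (dir \<kappa> (\<lambda>q. A q (coord_field p w q)) p)" for w
    by (rule clinear_dir[OF conn_coord_cdiff[OF mem_dom]])
  have "dir \<kappa> (\<lambda>q. A q (coord_field p (w + w') q)) p v
     = dir \<kappa> (\<lambda>q. A q (coord_field p w q)) p v + dir \<kappa> (\<lambda>q. A q (coord_field p w' q)) p v" for v w w'
    using dir_eq[OF cder_local[OF cder_add[OF cder_dir[OF c[of w]] cder_dir[OF c[of w']]] open_dom mem_dom],
        of "\<lambda>q. A q (coord_field p (w + w') q)"]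
    by (simp add: clinear_map_simps[OF conn_coord_linear])
  moreover have "dir \<kappa> (\<lambda>q. A q (coord_field p (r *\<^sub>C w) q)) p v = r *\<^sub>C dir \<kappa> (\<lambda>q. A q (coord_field p w q)) p v" for r v w
    using dir_eq[OF cder_local[OF cder_scaleC[OF centred cder_const[where c = r] cder_dir[OF c[of w]]] open_dom mem_dom],
        of "\<lambda>q. A q (coord_field p (r *\<^sub>C w) q)"]
    by (simp add: clinear_map_simps[OF conn_coord_linear])
  ultimately show *: "clinear_map (\<lambda>w. curv A p v w)" for v
    by (intro clinear_onI)
       (simp_all add: curv_def clinear_map_simps[OF d] clinear_map_simps[OF conn_linear] matrix_mult_simps
         scaleC_add_right scaleC.diff_right)
  show "clinear_map (\<lambda>v. curv A p v w)" for w
    unfolding anti[of _ w] by (intro clinear_onI) (simp_all add: clinear_map_simps[OF *] scaleC.minus_right)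
qed

text \<open>Curvature under a change of frame: \<open>cX, cY, cZ\<close> are the values of the potential in the
  frame \<open>\<psi>\<close> on \<open>X, Y, [X, Y]\<close>.  Multiplying by \<open>\<psi>\<close> avoids differentiating its inverse.\<close>

lemma curvature_gauge:
  assumes V: "open V" "p \<in> V" "holo_fun \<kappa> V \<psi>"
    and X: "holo_vf V X" and Y: "holo_vf V Y"
    and cX: "cdiff_at \<kappa> p cX" "\<And>q. q \<in> V \<Longrightarrow> \<psi> q ** cX q = dir \<kappa> \<psi> q (X q) + A q (X q) ** \<psi> q"
    and cY: "cdiff_at \<kappa> p cY" "\<And>q. q \<in> V \<Longrightarrow> \<psi> q ** cY q = dir \<kappa> \<psi> q (Y q) + A q (Y q) ** \<psi> q"
    and cZ: "\<psi> p ** cZ = dir \<kappa> \<psi> p (bracket \<kappa> X Y p) + A p (bracket \<kappa> X Y p) ** \<psi> p"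
  shows "\<psi> p ** (dir \<kappa> cY p (X p) - dir \<kappa> cX p (Y p) + (cX p ** cY p - cY p ** cX p) - cZ)
    = curvature \<kappa> A X Y p ** \<psi> p"
proof -
  have psi: "cder \<kappa> p \<psi> (dir \<kappa> \<psi> p)"
    using V(2,3) by (intro cder_dir) (simp add: holo_fun_def)
  \<comment> \<open>The equation defining \<open>cX\<close>, differentiated along \<open>v\<close>
    by the product rule on both sides.\<close>
  have main: "\<psi> p ** dir \<kappa> cX p v + dir \<kappa> \<psi> p v ** cX p
     = dir \<kappa> (\<lambda>q. dir \<kappa> \<psi> q (X q)) p v + (A p (X p) ** dir \<kappa> \<psi> p v + dir \<kappa> (\<lambda>q. A q (X q)) p v ** \<psi> p)"
    if X: "holo_vf V X" and cX: "cdiff_at \<kappa> p cX"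
      "\<And>q. q \<in> V \<Longrightarrow> \<psi> q ** cX q = dir \<kappa> \<psi> q (X q) + A q (X q) ** \<psi> q" for cX X v
  proof -
    have "cdiff_at \<kappa> p (\<lambda>q. dir \<kappa> \<psi> q (X q))" "cdiff_at \<kappa> p (\<lambda>q. A q (X q))"
      using holo_fun_dir[OF V(1,3) X] conn_holo[OF V(1) X] V(2) unfolding holo_fun_def by auto
    from cder_add[OF cder_dir[OF this(1)] cder_matrix_mult[OF centred cder_dir[OF this(2)] psi]]
    have "cder \<kappa> p (\<lambda>q. \<psi> q ** cX q) (\<lambda>v. dir \<kappa> (\<lambda>q. dir \<kappa> \<psi> q (X q)) p v +
        (A p (X p) ** dir \<kappa> \<psi> p v + dir \<kappa> (\<lambda>q. A q (X q)) p v ** \<psi> p))"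
      by (rule cder_local[OF _ V(1,2)]) (simp add: cX(2))
    from dir_eq[OF this] dir_eq[OF cder_matrix_mult[OF centred psi cder_dir[OF cX(1)]]]
    show ?thesis by metis
  qed
  note mX = main[OF X cX, of "Y p"] and mY = main[OF Y cY, of "X p"]
  have x: "dir \<kappa> \<psi> p (X p) = \<psi> p ** cX p - A p (X p) ** \<psi> p" and y: "dir \<kappa> \<psi> p (Y p) = \<psi> p ** cY p - A p (Y p) ** \<psi> p"
    using cX(2)[OF V(2)] cY(2)[OF V(2)] by simp_all
  have "\<psi> p ** (dir \<kappa> cY p (X p) - dir \<kappa> cX p (Y p) + (cX p ** cY p - cY p ** cX p) - cZ)
    = (\<psi> p ** dir \<kappa> cY p (X p)) - (\<psi> p ** dir \<kappa> cX p (Y p)) + (\<psi> p ** cX p ** cY p - \<psi> p ** cY p ** cX p) - \<psi> p ** cZ"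
    by (simp add: matrix_mult_simps matrix_mul_assoc)
  also have "\<psi> p ** dir \<kappa> cY p (X p) = dir \<kappa> (\<lambda>q. dir \<kappa> \<psi> q (Y q)) p (X p)
     + (A p (Y p) ** dir \<kappa> \<psi> p (X p) + dir \<kappa> (\<lambda>q. A q (Y q)) p (X p) ** \<psi> p) - dir \<kappa> \<psi> p (X p) ** cY p"
    using mY by (simp add: algebra_simps)
  also have "\<psi> p ** dir \<kappa> cX p (Y p) = dir \<kappa> (\<lambda>q. dir \<kappa> \<psi> q (X q)) p (Y p)
     + (A p (X p) ** dir \<kappa> \<psi> p (Y p) + dir \<kappa> (\<lambda>q. A q (X q)) p (Y p) ** \<psi> p) - dir \<kappa> \<psi> p (Y p) ** cX p"
    using mX by (simp add: algebra_simps)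
  \<comment> \<open>By \<open>dir_dir_bracket\<close> the derivative along the bracket is the
    difference of the iterated derivatives of \<open>\<psi>\<close> in the two previous equations,
    so these cancel.\<close>
  also have "\<psi> p ** cZ = (dir \<kappa> (\<lambda>q. dir \<kappa> \<psi> q (Y q)) p (X p) - dir \<kappa> (\<lambda>q. dir \<kappa> \<psi> q (X q)) p (Y p)) + A p (bracket \<kappa> X Y p) ** \<psi> p"
    unfolding cZ dir_dir_bracket[OF V X Y] ..
  finally show ?thesis
    unfolding x y curvature_def by (simp add: matrix_mult_simps matrix_mul_assoc)
qed

end
end

section \<open>Calculus on the spinor bundle\<close>

lemma scaleC_Pair: "c *\<^sub>C (a, b) = (c *\<^sub>C a, c *\<^sub>C b)"
  by (simp add: scaleC_prod_def)

lemma eps_simps: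
  "eps (a + b) c = eps a c + eps b c" "eps c (a + b) = eps c a + eps c b"
  "eps (a - b) c = eps a c - eps b c" "eps c (a - b) = eps c a - eps c b"
  "eps (r *\<^sub>C a) c = r * eps a c" "eps c (r *\<^sub>C a) = r * eps c a"
  "eps 0 a = 0" "eps a 0 = 0" "eps (- a) c = - eps a c" "eps c (- a) = - eps c a"
  by (simp_all add: eps_def scaleC_complex_def algebra_simps)

lemma eps_self [simp]: "eps a a = 0"
  by (simp add: eps_def)

lemma eps_swap: "eps a b = - eps b a"
  by (simp add: eps_def)

lemma clinear_map_eps: "clinear_map (eps a)" "clinear_map (\<lambda>a. eps a b)"
  by (auto intro!: clinear_onI simp: eps_simps scaleC_complex_def)

lemma bounded_bilinear_eps: "bounded_bilinear eps"
  by (rule cbilinear_bounded[OF clinear_map_eps])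

lemma SH_tangent_iff: "v \<in> SH_tangent (x, u) \<longleftrightarrow> eps (up (snd v)) (um u) + eps (up u) (um (snd v)) = 0"
  by (auto simp: SH_tangent_def split: prod.splits)

lemma SH_tangent_horizontal [simp]: "(v, 0) \<in> SH_tangent p"
  by (cases p) (simp add: SH_tangent_iff eps_simps)

lemma SH_tangent_simps:
  "v \<in> SH_tangent p \<Longrightarrow> w \<in> SH_tangent p \<Longrightarrow> v + w \<in> SH_tangent p"
  "v \<in> SH_tangent p \<Longrightarrow> w \<in> SH_tangent p \<Longrightarrow> v - w \<in> SH_tangent p"
  "v \<in> SH_tangent p \<Longrightarrow> c *\<^sub>C v \<in> SH_tangent p"
proof -
  obtain x u where p: "p = (x, u)" by (cases p)
  show "v \<in> SH_tangent p \<Longrightarrow> w \<in> SH_tangent p \<Longrightarrow> v + w \<in> SH_tangent p"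
    unfolding p SH_tangent_iff by (simp only: snd_add fst_add eps_simps) algebra
  show "v \<in> SH_tangent p \<Longrightarrow> w \<in> SH_tangent p \<Longrightarrow> v - w \<in> SH_tangent p"
    unfolding p SH_tangent_iff by (simp only: snd_diff fst_diff eps_simps) algebra
  show "v \<in> SH_tangent p \<Longrightarrow> c *\<^sub>C v \<in> SH_tangent p"
    unfolding p SH_tangent_iff by (simp only: scaleC_prod_sel eps_simps) algebra
qed

text \<open>A tangent vector of \<open>Sp1C\<close> is the velocity of a curve in \<open>Sp1C\<close>, obtained from a straight line
  by normalising \<open>eps\<close>.\<close>

lemma has_derivative_Sp1C_unique:
  fixes f :: "'a::real_normed_vector \<times> spinor_pair \<Rightarrow> 'b::real_normed_vector"
  assumes S: "open S" "z \<in> S" and u: "u \<in> Sp1C"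
    and D: "(f has_derivative D) (at (z, u) within S \<times> Sp1C)"
    and E: "(f has_derivative E) (at (z, u) within S \<times> Sp1C)"
    and w: "eps (up w) (um u) + eps (up u) (um w) = 0"
  shows "D (v, w) = E (v, w)"
proof -
  \<comment> \<open>Along the line \<open>u + t w\<close> the value of \<open>eps\<close> is
    \<open>1 + t^2 k\<close>, the linear term being zero by tangency. Dividing the first spinor by
    it returns to \<open>Sp1C\<close>, and since \<open>s\<close> has derivative 0 at
    \<open>t = 0\<close> the velocity is still \<open>w\<close>.\<close>
  define k where "k = eps (up w) (um w)"
  define s :: "real \<Rightarrow> complex" where "s t = 1 + of_real t * of_real t * k" for t
  define \<gamma> where "\<gamma> t = (z + t *\<^sub>R v, (inverse (s t) *\<^sub>C (up u + t *\<^sub>R up w), um u + t *\<^sub>R um w))" for t :: real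
  have \<gamma>0: "\<gamma> 0 = (z, u)" by (simp add: \<gamma>_def s_def)
  have \<gamma>': "(\<gamma> has_derivative (\<lambda>t. t *\<^sub>R (v, w))) (at 0)"
    unfolding \<gamma>_def s_def
    by (rule derivative_eq_intros has_derivative_of_real | simp add: scaleR_prod_def)+
  define I where "I = {t. z + t *\<^sub>R v \<in> S} \<inter> {t. s t \<noteq> 0}"
  have "continuous_on UNIV s" unfolding s_def by (intro continuous_intros)
  then have "open {t. s t \<noteq> 0}" by (intro open_Collect_neq) auto
  moreover have "open {t. z + t *\<^sub>R v \<in> S}"
    using continuous_open_preimage[of UNIV "\<lambda>t. z + t *\<^sub>R v" S] S by (simp add: vimage_def continuous_intros)
  ultimately have I: "open I" "0 \<in> I" unfolding I_def using S by (auto simp: s_def)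
  have "\<gamma> ` I \<subseteq> S \<times> Sp1C"
  proof (rule image_subsetI)
    fix t assume t: "t \<in> I"
    have u1: "eps (up u) (um u) = 1" using u by (simp add: Sp1C_def)
    have "eps (up u + t *\<^sub>R up w) (um u + t *\<^sub>R um w)
       = eps (up u) (um u) + of_real t * (eps (up w) (um u) + eps (up u) (um w)) + of_real t * of_real t * k"
      by (simp add: scaleR_eq_scaleC eps_simps k_def algebra_simps)
    also have "\<dots> = s t" by (simp add: w u1 s_def)
    finally show "\<gamma> t \<in> S \<times> Sp1C"
      using t by (auto simp: \<gamma>_def I_def Sp1C_def eps_simps(5))
  qed
  then have sub: "(f has_derivative D) (at (\<gamma> 0) within \<gamma> ` I)" "(f has_derivative E) (at (\<gamma> 0) within \<gamma> ` I)"
    unfolding \<gamma>0 using D E has_derivative_subset by blast+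
  have "((\<lambda>t. f (\<gamma> t)) has_derivative (\<lambda>t. D (t *\<^sub>R (v, w)))) (at 0)"
       "((\<lambda>t. f (\<gamma> t)) has_derivative (\<lambda>t. E (t *\<^sub>R (v, w)))) (at 0)"
    using has_derivative_in_compose[OF has_derivative_at_withinI[OF \<gamma>'] sub(1)]
      has_derivative_in_compose[OF has_derivative_at_withinI[OF \<gamma>'] sub(2)]
    by (simp_all add: at_within_open[OF I(2,1)])
  from fun_cong[OF has_derivative_unique[OF this], of 1] show ?thesis by simp
qed

context cmanifold
begin

abbreviation "\<sigma> \<equiv> SH_atlas \<kappa>"

lemma SH_chart [simp]:
  "chart_dom \<sigma> (x, u) = cdom x \<times> Sp1C"
  "chart_map \<sigma> (x, u) = (\<lambda>q. (chart x (fst q), snd q))"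
  "chart_img \<sigma> (x, u) = chart_img \<kappa> x \<times> Sp1C"
proof -
  show d: "chart_dom \<sigma> (x, u) = cdom x \<times> Sp1C"
    and m: "chart_map \<sigma> (x, u) = (\<lambda>q. (chart x (fst q), snd q))"
    by (simp_all add: chart_dom_def chart_map_def SH_atlas_def split_def)
  show "chart_img \<sigma> (x, u) = chart_img \<kappa> x \<times> Sp1C"
    unfolding chart_img_def d m by force
qed

lemma SH_chart_inv [simp]:
  assumes "z \<in> chart_img \<kappa> x" "w \<in> Sp1C"
  shows "chart_inv \<sigma> (x, u) (z, w) = (cinv x z, w)"
proof -
  have "inj_on (chart_map \<sigma> (x, u)) (chart_dom \<sigma> (x, u))"
  proof (rule inj_onI)
    fix q r assume "q \<in> chart_dom \<sigma> (x, u)" "r \<in> chart_dom \<sigma> (x, u)"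
      and eq: "chart_map \<sigma> (x, u) q = chart_map \<sigma> (x, u) r"
    then have "fst q \<in> cdom x" "fst r \<in> cdom x" by auto
    moreover have "chart x (fst q) = chart x (fst r)" "snd q = snd r" using eq by simp_all
    ultimately show "q = r" by (metis chart_inv_map prod_eqI)
  qed
  moreover have "(cinv x z, w) \<in> chart_dom \<sigma> (x, u)"
    using assms by (simp add: chart_inv_mem)
  moreover have "chart_map \<sigma> (x, u) (cinv x z, w) = (z, w)" using assms by simp
  ultimately show ?thesis unfolding chart_inv_def[of \<sigma>] by (metis inv_into_f_f)
qed

lemma SH_centred: "u \<in> Sp1C \<Longrightarrow> centred \<sigma> (x, u)"
  by (simp add: centred_def chart_map_mem)

lemma SH_nbhd:
  assumes "openin (top_of_set SH) V" "(x, u) \<in> V"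
  shows "nbhd \<sigma> (x, u) (V \<inter> (cdom x \<times> Sp1C))"
proof -
  obtain T where T: "open T" "V = T \<inter> SH" using assms(1) by (metis inf_commute openin_open)
  define g where "g q = (cinv x (fst q), snd q)" for q :: "(complex^'m) \<times> spinor_pair"
  have "continuous_on (chart_img \<kappa> x \<times> UNIV) g"
    unfolding g_def using chart_homeo[of x] unfolding homeomorphism_def
    by (auto intro!: continuous_intros continuous_on_compose2[of "chart_img \<kappa> x" "cinv x"])
  then have "open (chart_img \<kappa> x \<times> UNIV \<inter> g -` T)"
    using open_img T by (intro continuous_open_preimage open_Times) auto
  then show ?thesis
    unfolding nbhd_def
    by (rule exI[of _ "chart_img \<kappa> x \<times> UNIV \<inter> g -` T", OF conjI])
       (use T assms(2) in \<open>auto simp: g_def chart_map_mem chart_inv_mem SH_def\<close>)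
qed

lemma openin_SH_Times: "open U \<Longrightarrow> openin (top_of_set SH) (U \<times> Sp1C)"
  unfolding SH_def by (simp add: openin_Times)

lemma SH_cder_unique:
  assumes "u \<in> Sp1C" "cder \<sigma> (x, u) f D" "cder \<sigma> (x, u) f E" "v \<in> SH_tangent (x, u)"
  shows "D v = E v"
  using has_derivative_Sp1C_unique[OF open_img chart_map_mem[OF mem_dom[of x]] assms(1), where f = "f \<circ> chart_inv \<sigma> (x, u)" and D = D and E = E
      and w = "snd v" and v = "fst v"]
    assms by (simp add: cder_def SH_tangent_iff)

text \<open>\<open>dir\<close> is some derivative at the point, and by
  \<open>has_derivative_Sp1C_unique\<close> any two derivatives agree on tangent vectors.\<close>

lemma SH_dir_eq:
  assumes "u \<in> Sp1C" "cder \<sigma> (x, u) f D" "v \<in> SH_tangent (x, u)"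
  shows "dir \<sigma> f (x, u) v = D v"
proof -
  have "(f \<circ> chart_inv \<sigma> (x, u) has_derivative frechet_derivative (f \<circ> chart_inv \<sigma> (x, u)) (at (chart x x, u) within chart_img \<kappa> x \<times> Sp1C))
      (at (chart x x, u) within chart_img \<kappa> x \<times> Sp1C)"
    using assms(2) unfolding frechet_derivative_works[symmetric] differentiable_def cder_def by auto
  from has_derivative_Sp1C_unique[OF open_img chart_map_mem[OF mem_dom] assms(1) this, of D "snd v" "fst v"]
  show ?thesis using assms by (simp add: cder_def SH_tangent_iff dir_def)
qed

lemma cder_slice:
  assumes u: "u \<in> Sp1C" and f: "cder \<sigma> (x, u) f D"
  shows "cder \<kappa> x (\<lambda>y. f (y, u)) (\<lambda>v. D (v, 0))"
proof -
  have D: "clinear_map D" using f unfolding cder_def by simp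
  have "((\<lambda>z. (z, u)) has_derivative (\<lambda>v. (v, 0))) (at (chart x x) within chart_img \<kappa> x)"
    by (auto intro!: derivative_eq_intros)
  moreover have "(f \<circ> chart_inv \<sigma> (x, u) has_derivative D) (at (chart x x, u) within (\<lambda>z. (z, u)) ` chart_img \<kappa> x)"
    by (rule has_derivative_subset[of _ _ _ "chart_img \<kappa> x \<times> Sp1C"]) (use f u in \<open>auto simp: cder_def\<close>)
  ultimately have "((\<lambda>z. (f \<circ> chart_inv \<sigma> (x, u)) (z, u)) has_derivative (\<lambda>v. D (v, 0))) (at (chart x x) within chart_img \<kappa> x)"
    by (rule has_derivative_in_compose)
  then have "((\<lambda>y. f (y, u)) \<circ> cinv x has_derivative (\<lambda>v. D (v, 0))) (at (chart x x) within chart_img \<kappa> x)"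
    by (rule has_derivative_transform[rotated 2]) (use u in \<open>auto simp: chart_map_mem\<close>)
  moreover have "clinear_map (\<lambda>v. D (v, 0))"
    by (rule clinear_onI) (simp_all add: scaleC_Pair flip: clinear_map_simps[OF D])
  ultimately show ?thesis unfolding cder_def by simp
qed

lemma cdiff_slice: "u \<in> Sp1C \<Longrightarrow> cdiff_at \<sigma> (x, u) f \<Longrightarrow> cdiff_at \<kappa> x (\<lambda>y. f (y, u))"
  by (elim cdiff_atE) (rule cdiff_atI[OF cder_slice])

lemma dir_slice:
  assumes u: "u \<in> Sp1C" and f: "cdiff_at \<sigma> (x, u) f"
  shows "dir \<sigma> f (x, u) (v, 0) = dir \<kappa> (\<lambda>y. f (y, u)) x v"
proof -
  obtain D where D: "cder \<sigma> (x, u) f D" using f by (rule cdiff_atE)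
  show ?thesis by (simp add: SH_dir_eq[OF u D] dir_eq[OF cder_slice[OF u D]])
qed

lemma cder_fst:
  assumes u: "u \<in> Sp1C" and g: "cder \<kappa> x g D"
  shows "cder \<sigma> (x, u) (\<lambda>q. g (fst q)) (\<lambda>v. D (fst v))"
proof -
  have D: "clinear_map D" using g unfolding cder_def by simp
  have "(g \<circ> cinv x has_derivative D) (at (fst (chart x x, u)) within fst ` (chart_img \<kappa> x \<times> Sp1C))"
    by (rule has_derivative_subset[of _ _ _ "chart_img \<kappa> x"]) (use g in \<open>auto simp: cder_def\<close>)
  from has_derivative_in_compose[OF has_derivative_fst[OF has_derivative_ident] this]
  have "((\<lambda>q. g (fst q)) \<circ> chart_inv \<sigma> (x, u) has_derivative (\<lambda>v. D (fst v))) (at (chart x x, u) within chart_img \<kappa> x \<times> Sp1C)"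
    by (rule has_derivative_transform[rotated 2]) (use u in \<open>auto simp: chart_map_mem\<close>)
  moreover have "clinear_map (\<lambda>v. D (fst v))"
    by (rule clinear_onI) (simp_all add: clinear_map_simps[OF D])
  ultimately show ?thesis unfolding cder_def by simp
qed

lemma cdiff_fst: "u \<in> Sp1C \<Longrightarrow> cdiff_at \<kappa> x g \<Longrightarrow> cdiff_at \<sigma> (x, u) (\<lambda>q. g (fst q))"
  by (elim cdiff_atE) (rule cdiff_atI[OF cder_fst])

lemma cder_snd:
  assumes u: "u \<in> Sp1C"
  shows "cder \<sigma> (x, u) snd snd"
  unfolding cder_def
proof
  show "(snd \<circ> chart_inv \<sigma> (x, u) has_derivative snd) (at (chart_map \<sigma> (x, u) (x, u)) within chart_img \<sigma> (x, u))"
    by (rule has_derivative_transform[OF _ _ has_derivative_snd[OF has_derivative_ident]])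
       (use u in \<open>auto simp: chart_map_mem\<close>)
qed (simp add: clinear_on_def)

lemma cder_Pair:
  assumes "cder \<tau> p f D" "cder \<tau> p g E"
  shows "cder \<tau> p (\<lambda>q. (f q, g q)) (\<lambda>v. (D v, E v))"
proof -
  have lin: "clinear_map D" "clinear_map E" using assms unfolding cder_def by simp_all
  have "clinear_map (\<lambda>v. (D v, E v))"
    by (rule clinear_onI) (simp_all add: clinear_map_simps[OF lin(1)] clinear_map_simps[OF lin(2)] scaleC_Pair)
  then show ?thesis
    using assms unfolding cder_def by (simp add: o_def has_derivative_Pair)
qed

lemma cder_prod_sel:
  assumes "cder \<tau> p f D"
  shows "cder \<tau> p (\<lambda>q. fst (f q)) (\<lambda>v. fst (D v))" "cder \<tau> p (\<lambda>q. snd (f q)) (\<lambda>v. snd (D v))"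
proof -
  have lin: "clinear_map D" using assms unfolding cder_def by simp
  have "clinear_map (\<lambda>v. fst (D v))" "clinear_map (\<lambda>v. snd (D v))"
    by (rule clinear_onI; simp add: clinear_map_simps[OF lin])+
  then show "cder \<tau> p (\<lambda>q. fst (f q)) (\<lambda>v. fst (D v))" "cder \<tau> p (\<lambda>q. snd (f q)) (\<lambda>v. snd (D v))"
    using assms has_derivative_fst[of "f \<circ> chart_inv \<tau> p" D] has_derivative_snd[of "f \<circ> chart_inv \<tau> p" D]
    unfolding cder_def by (simp_all add: o_def)
qed

lemma cdiff_prod_sel:
  assumes "cdiff_at \<tau> p f"
  shows "cdiff_at \<tau> p (\<lambda>q. fst (f q))" "cdiff_at \<tau> p (\<lambda>q. snd (f q))"
  by (rule cdiff_atE[OF assms], rule cdiff_atI[OF cder_prod_sel(1)], assumption)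
     (rule cdiff_atE[OF assms], rule cdiff_atI[OF cder_prod_sel(2)])

lemma SH_field_comp:
  assumes "y \<in> cdom x" "w \<in> Sp1C" "X (y, w) \<in> SH_tangent (y, w)"
  shows "field_comp \<sigma> (x, u) X (y, w) = (dir \<kappa> (chart x) y (fst (X (y, w))), snd (X (y, w)))"
proof -
  have "cder \<sigma> (y, w) (chart_map \<sigma> (x, u)) (\<lambda>v. (dir \<kappa> (chart x) y (fst v), snd v))"
    unfolding SH_chart
    by (intro cder_Pair cder_fst cder_snd assms cder_dir cdiff_chart_map)
  from SH_dir_eq[OF assms(2) this assms(3)] show ?thesis unfolding field_comp_def .
qed

lemma holo_field_horizontal:
  assumes "\<And>x u. x \<in> V \<Longrightarrow> u \<in> Sp1C \<Longrightarrow> cdiff_at \<sigma> (x, u) (\<lambda>q. dir \<kappa> (chart x) (fst q) (fst (X q)))"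
    and "\<And>q. snd (X q) = 0" and V: "open V"
  shows "holo_field \<sigma> SH_tangent (V \<times> Sp1C) X"
  unfolding holo_field_def
proof safe
  fix x u assume x: "x \<in> V" and u: "u \<in> Sp1C"
  have X: "X q = (fst (X q), 0)" for q using assms(2)[of q] by (simp add: prod_eq_iff)
  show tan: "X (x, u) \<in> SH_tangent (x, u)" for x u by (subst X) (rule SH_tangent_horizontal)
  obtain D where D: "cder \<sigma> (x, u) (\<lambda>q. dir \<kappa> (chart x) (fst q) (fst (X q))) D"
    using assms(1)[OF x u] by (rule cdiff_atE)
  have "cdiff_at \<sigma> (x, u) (\<lambda>q. (dir \<kappa> (chart x) (fst q) (fst (X q)), 0 :: spinor_pair))"
    by (rule cdiff_atI[OF cder_Pair[OF D cder_const]])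
  then show "cdiff_at \<sigma> (x, u) (field_comp \<sigma> (x, u) X)"
    by (rule cdiff_at_cong[OF SH_centred[OF u] SH_nbhd[OF openin_SH_Times[OF V]], rotated 2])
       (use x u SH_field_comp[of _ x _ X u, OF _ _ tan] assms(2) in auto)
qed

lemma holo_field_lift:
  assumes V: "open V" and X: "holo_vf V X"
  shows "holo_field \<sigma> SH_tangent (V \<times> Sp1C) (\<lambda>q. (X (fst q), 0))"
proof (rule holo_field_horizontal[OF _ _ V])
  fix x u assume "x \<in> V" "u \<in> Sp1C"
  then show "cdiff_at \<sigma> (x, u) (\<lambda>q. dir \<kappa> (chart x) (fst q) (fst (X (fst q), 0)))"
    using cdiff_fst[OF _ holo_fieldD[OF X]] by (simp add: field_comp_def[abs_def])
qed simp

lemma holo_field_slice: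
  assumes u: "u \<in> Sp1C" and V: "open V" and X: "holo_field \<sigma> SH_tangent (V \<times> Sp1C) X"
  shows "holo_vf V (\<lambda>y. fst (X (y, u)))"
  unfolding holo_field_def
proof safe
  fix x assume x: "x \<in> V"
  have "cdiff_at \<sigma> (x, u) (field_comp \<sigma> (x, u) X)" using X x u unfolding holo_field_def by blast
  from cdiff_slice[OF u cdiff_prod_sel(1)[OF this]]
  show "cdiff_at \<kappa> x (field_comp \<kappa> x (\<lambda>y. fst (X (y, u))))"
  proof (rule cdiff_at_local)
    show "open (V \<inter> cdom x)" "x \<in> V \<inter> cdom x" using V open_dom x by auto
    show "fst (field_comp \<sigma> (x, u) X (y, u)) = field_comp \<kappa> x (\<lambda>y. fst (X (y, u))) y" if "y \<in> V \<inter> cdom x" for y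
      using SH_field_comp[of y x u X u] that X u unfolding holo_field_def by (simp add: field_comp_def)
  qed
qed simp

text \<open>Horizontal fields only differentiate along the base, so their curvature is that of the slice.\<close>

lemma curvature_slice:
  assumes u: "u \<in> Sp1C" and V: "open V" "x \<in> V"
    and X: "holo_field \<sigma> SH_tangent (V \<times> Sp1C) X" "\<And>q. snd (X q) = 0"
    and Y: "holo_field \<sigma> SH_tangent (V \<times> Sp1C) Y" "\<And>q. snd (Y q) = 0"
    and B: "cdiff_at \<sigma> (x, u) (\<lambda>q. B q (X q))" "cdiff_at \<sigma> (x, u) (\<lambda>q. B q (Y q))"
  shows "curvature \<sigma> B X Y (x, u)
    = curvature \<kappa> (\<lambda>y v. B (y, u) (v, 0)) (\<lambda>y. fst (X (y, u))) (\<lambda>y. fst (Y (y, u))) x"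
proof -
  have pair: "Z q = (fst (Z q), 0)" if "\<And>q. snd (Z q) = 0" for Z :: "'a \<times> spinor_pair \<Rightarrow> (complex^'m) \<times> spinor_pair" and q
    using that[of q] by (simp add: prod_eq_iff)
  note pX = pair[of X, OF X(2)] and pY = pair[of Y, OF Y(2)]
  have fc: "dir \<sigma> (field_comp \<sigma> (x, u) Z) (x, u) (v, 0) = (dir \<kappa> (field_comp \<kappa> x (\<lambda>y. fst (Z (y, u)))) x v, 0)"
    if Z: "holo_field \<sigma> SH_tangent (V \<times> Sp1C) Z" "\<And>q. snd (Z q) = 0" for Z v
  proof -
    have cd: "cdiff_at \<sigma> (x, u) (field_comp \<sigma> (x, u) Z)" using Z V u unfolding holo_field_def by blast
    have "cder \<kappa> x (\<lambda>y. (field_comp \<kappa> x (\<lambda>y. fst (Z (y, u))) y, 0 :: spinor_pair))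
        (\<lambda>v. (dir \<kappa> (field_comp \<kappa> x (\<lambda>y. fst (Z (y, u)))) x v, 0))"
      by (intro cder_Pair cder_const cder_dir holo_fieldD[OF holo_field_slice[OF u V(1) Z(1)] V(2)])
    then have "cder \<kappa> x (\<lambda>y. field_comp \<sigma> (x, u) Z (y, u)) (\<lambda>v. (dir \<kappa> (field_comp \<kappa> x (\<lambda>y. fst (Z (y, u)))) x v, 0))"
    proof (rule cder_local)
      show "open (V \<inter> cdom x)" "x \<in> V \<inter> cdom x" using V open_dom by auto
      show "(field_comp \<kappa> x (\<lambda>y. fst (Z (y, u))) y, 0) = field_comp \<sigma> (x, u) Z (y, u)" if "y \<in> V \<inter> cdom x" for y
        using SH_field_comp[of y x u Z u] that Z u unfolding holo_field_def by (simp add: field_comp_def)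
    qed
    from dir_eq[OF this] show ?thesis by (simp add: dir_slice[OF u cd])
  qed
  have br: "bracket \<sigma> X Y (x, u) = (bracket \<kappa> (\<lambda>y. fst (X (y, u))) (\<lambda>y. fst (Y (y, u))) x, 0)"
  proof -
    have "dir \<sigma> (field_comp \<sigma> (x, u) Y) (x, u) (X (x, u)) = (dir \<kappa> (field_comp \<kappa> x (\<lambda>y. fst (Y (y, u)))) x (fst (X (x, u))), 0)"
      by (subst pX) (rule fc[OF Y])
    moreover have "dir \<sigma> (field_comp \<sigma> (x, u) X) (x, u) (Y (x, u)) = (dir \<kappa> (field_comp \<kappa> x (\<lambda>y. fst (X (y, u)))) x (fst (Y (x, u))), 0)"
      by (subst pY) (rule fc[OF X])
    ultimately show ?thesis unfolding bracket_def by simp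
  qed
  have "dir \<sigma> (\<lambda>q. B q (Y q)) (x, u) (X (x, u)) = dir \<kappa> (\<lambda>y. B (y, u) (fst (Y (y, u)), 0)) x (fst (X (x, u)))"
    by (subst pX) (simp only: dir_slice[OF u B(2)] flip: pY)
  moreover have "dir \<sigma> (\<lambda>q. B q (X q)) (x, u) (Y (x, u)) = dir \<kappa> (\<lambda>y. B (y, u) (fst (X (y, u)), 0)) x (fst (Y (x, u)))"
    by (subst pY) (simp only: dir_slice[OF u B(1)] flip: pX)
  moreover have "B (x, u) (X (x, u)) = B (x, u) (fst (X (x, u)), 0)" "B (x, u) (Y (x, u)) = B (x, u) (fst (Y (x, u)), 0)"
    by (simp_all only: flip: pX pY)
  ultimately show ?thesis
    unfolding curvature_def br by simp
qed

lemma connection_form_slice: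
  assumes u: "u \<in> Sp1C" and B: "connection_form \<sigma> SH_tangent SH B"
  shows "connection_form \<kappa> full_tangent UNIV (\<lambda>y v. B (y, u) (v, 0))"
  unfolding connection_form_def
proof (intro conjI ballI allI impI)
  fix x
  have "clinear_on (SH_tangent (x, u)) (B (x, u))"
    using B u unfolding connection_form_def SH_def by blast
  from clinear_onD(1)[OF this, of "(v, 0)" "(w, 0)" for v w] clinear_onD(2)[OF this, of "(v, 0)" for v]
  show "clinear_map (\<lambda>v. B (x, u) (v, 0))"
    by (intro clinear_onI) (simp_all add: scaleC_Pair)
next
  fix V X assume VX: "openin (top_of_set UNIV) V \<and> holo_vf V X"
  then have V: "open V" by simp
  have "holo_fun \<sigma> (V \<times> Sp1C) (\<lambda>q. B q (X (fst q), 0))"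
    using B holo_field_lift[OF V] openin_SH_Times[OF V] VX unfolding connection_form_def by blast
  then show "holo_fun \<kappa> V (\<lambda>y. B (y, u) (X y, 0))"
    unfolding holo_fun_def using cdiff_slice[OF u] u by fastforce
qed

end

section \<open>Pull-back connections\<close>

context cmanifold
begin

lemma SH_holo_fieldD:
  assumes "holo_field \<sigma> SH_tangent V X" "(x, u) \<in> V"
  shows "X (x, u) \<in> SH_tangent (x, u)" "cdiff_at \<sigma> (x, u) (field_comp \<sigma> (x, u) X)"
  using assms unfolding holo_field_def by blast+

lemma SH_cder_local:
  assumes "cder \<sigma> (x, u) f D" "openin (top_of_set SH) V" "(x, u) \<in> V"
    and "\<And>y w. (y, w) \<in> V \<Longrightarrow> y \<in> cdom x \<Longrightarrow> w \<in> Sp1C \<Longrightarrow> f (y, w) = g (y, w)"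
  shows "cder \<sigma> (x, u) g D"
proof (rule cder_cong[where f = f, OF SH_centred SH_nbhd[OF assms(2,3)] _ assms(1)])
  show "u \<in> Sp1C" using openin_subset[OF assms(2)] assms(3) by (auto simp: SH_def)
  show "f q = g q" if "q \<in> V \<inter> (cdom x \<times> Sp1C)" for q
    using that assms(4)[of "fst q" "snd q"] by auto
qed

text \<open>The fibre component of a tangent field satisfies a bilinear equation together with the
  point of \<open>Sp1C\<close>; this is that equation differentiated along \<open>v\<close>.\<close>

lemma SH_tangent_deriv:
  assumes V: "openin (top_of_set SH) V" "(x, u) \<in> V"
    and X: "holo_field \<sigma> SH_tangent V X" and D: "cder \<sigma> (x, u) (field_comp \<sigma> (x, u) X) D"
    and v: "v \<in> SH_tangent (x, u)"
  shows "eps (up (snd (D v))) (um u) + eps (up u) (um (snd (D v)))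
    = - (eps (up (snd (X (x, u)))) (um (snd v)) + eps (up (snd v)) (um (snd (X (x, u)))))"
proof -
  have u: "u \<in> Sp1C" using openin_subset[OF V(1)] V(2) by (auto simp: SH_def)
  have fc: "field_comp \<sigma> (x, u) X (y, w) = (dir \<kappa> (chart x) y (fst (X (y, w))), snd (X (y, w)))"
    if "(y, w) \<in> V" "y \<in> cdom x" "w \<in> Sp1C" for y w
    by (rule SH_field_comp[where X = X, OF that(2,3) SH_holo_fieldD(1)[OF X that(1)]])
  define W where "W q = snd (field_comp \<sigma> (x, u) X q)" for q
  have W: "cder \<sigma> (x, u) W (\<lambda>v. snd (D v))" unfolding W_def by (rule cder_prod_sel(2)[OF D])
  have S: "cder \<sigma> (x, u) snd snd" by (rule cder_snd[OF u])
  have Wp: "W (x, u) = snd (X (x, u))" using fc[OF V(2) mem_dom u] by (simp add: W_def)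
  have "cder \<sigma> (x, u) (\<lambda>q. eps (fst (W q)) (snd (snd q)) + eps (fst (snd q)) (snd (W q)))
    (\<lambda>v. eps (fst (W (x, u))) (snd (snd v)) + eps (fst (snd (D v))) (snd (snd (x, u)))
       + (eps (fst (snd (x, u))) (snd (snd (D v))) + eps (fst (snd v)) (snd (W (x, u)))))"
    by (intro cder_add cder_bilinear[OF SH_centred[OF u] bounded_bilinear_eps clinear_map_eps] cder_prod_sel W S)
  \<comment> \<open>The tangency equation holds identically on \<open>V\<close>, so 0 is also a
    derivative of the left side; the two derivatives agree on the tangent vector
    \<open>v\<close>.\<close>
  moreover have "cder \<sigma> (x, u) (\<lambda>q. eps (fst (W q)) (snd (snd q)) + eps (fst (snd q)) (snd (W q))) (\<lambda>_. 0)"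
  proof (rule SH_cder_local[OF cder_const V])
    show "0 = eps (fst (W (y, w))) (snd (snd (y, w))) + eps (fst (snd (y, w))) (snd (W (y, w)))"
      if "(y, w) \<in> V" "y \<in> cdom x" "w \<in> Sp1C" for y w
      using SH_holo_fieldD(1)[OF X that(1)] by (simp add: W_def fc[OF that] SH_tangent_iff)
  qed
  ultimately have "eps (fst (W (x, u))) (snd (snd v)) + eps (fst (snd (D v))) (snd (snd (x, u)))
       + (eps (fst (snd (x, u))) (snd (snd (D v))) + eps (fst (snd v)) (snd (W (x, u)))) = 0"
    by (rule SH_cder_unique[OF u _ _ v])
  then show ?thesis unfolding Wp by (simp add: algebra_simps eq_neg_iff_add_eq_0)
qed

text \<open>The right side of \<open>SH_tangent_deriv\<close> is symmetric in the two fields, so it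
  drops out of the difference. This is needed because a potential on \<open>S_H\<close> is
  controlled on tangent vectors only, and the curvature evaluates it on a bracket.\<close>

lemma SH_bracket_tangent:
  assumes V: "openin (top_of_set SH) V" "(x, u) \<in> V"
    and X: "holo_field \<sigma> SH_tangent V X" and Y: "holo_field \<sigma> SH_tangent V Y"
  shows "bracket \<sigma> X Y (x, u) \<in> SH_tangent (x, u)"
proof -
  have u: "u \<in> Sp1C" using openin_subset[OF V(1)] V(2) by (auto simp: SH_def)
  obtain D where D: "cder \<sigma> (x, u) (field_comp \<sigma> (x, u) X) D" using SH_holo_fieldD(2)[OF X V(2)] by (rule cdiff_atE)
  obtain E where E: "cder \<sigma> (x, u) (field_comp \<sigma> (x, u) Y) E" using SH_holo_fieldD(2)[OF Y V(2)] by (rule cdiff_atE)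
  note tX = SH_holo_fieldD(1)[OF X V(2)] and tY = SH_holo_fieldD(1)[OF Y V(2)]
  have br: "bracket \<sigma> X Y (x, u) = E (X (x, u)) - D (Y (x, u))"
    unfolding bracket_def by (simp add: SH_dir_eq[OF u D tY] SH_dir_eq[OF u E tX])
  show ?thesis
    unfolding br SH_tangent_iff
    using SH_tangent_deriv[OF V X D tY] SH_tangent_deriv[OF V Y E tX]
    by (simp only: snd_diff fst_diff eps_simps) algebra
qed

context
  fixes A :: "'a \<Rightarrow> complex^'m \<Rightarrow> complex^'r::finite^'r"
    and B :: "'a \<times> spinor_pair \<Rightarrow> (complex^'m) \<times> spinor_pair \<Rightarrow> complex^'r^'r"
  assumes A: "connection_form \<kappa> full_tangent UNIV A"
    and B: "\<And>p v. p \<in> SH \<Longrightarrow> v \<in> SH_tangent p \<Longrightarrow> B p v = A (fst p) (fst v)"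
begin

text \<open>The base component of \<open>X\<close> is expanded in coordinate fields of
  \<open>M\<close>. Only the components depend on the fibre; the coefficients given by
  \<open>A\<close> are functions on \<open>M\<close>.\<close>

lemma cder_pullback:
  assumes V: "openin (top_of_set SH) V" "(x, u) \<in> V"
    and X: "holo_field \<sigma> SH_tangent V X" and D: "cder \<sigma> (x, u) (field_comp \<sigma> (x, u) X) D"
  shows "cder \<sigma> (x, u) (\<lambda>q. B q (X q))
    (\<lambda>v. \<Sum>i\<in>UNIV. fst (X (x, u)) $ i *\<^sub>C dir \<kappa> (\<lambda>q. A q (coord_field x (axis i 1) q)) x (fst v)
        + fst (D v) $ i *\<^sub>C A x (axis i 1))"
proof -
  have VSH: "V \<subseteq> SH" using openin_subset[OF V(1)] by simp
  then have u: "u \<in> Sp1C" using V(2) by (auto simp: SH_def)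
  have fc: "field_comp \<sigma> (x, u) X (y, w) = (dir \<kappa> (chart x) y (fst (X (y, w))), snd (X (y, w)))"
    if "(y, w) \<in> V" "y \<in> cdom x" "w \<in> Sp1C" for y w
    by (rule SH_field_comp[where X = X, OF that(2,3) SH_holo_fieldD(1)[OF X that(1)]])
  have comp: "cder \<sigma> (x, u) (\<lambda>q. fst (field_comp \<sigma> (x, u) X q) $ i) (\<lambda>v. fst (D v) $ i)" for i
    by (rule cder_clinear[OF clinear_map_vec_nth bounded_linear_vec_nth cder_prod_sel(1)[OF D]])
  have "cder \<sigma> (x, u) (\<lambda>q. \<Sum>i\<in>UNIV. fst (field_comp \<sigma> (x, u) X q) $ i *\<^sub>C A (fst q) (coord_field x (axis i 1) (fst q)))
    (\<lambda>v. \<Sum>i\<in>UNIV. fst (field_comp \<sigma> (x, u) X (x, u)) $ i *\<^sub>C dir \<kappa> (\<lambda>q. A q (coord_field x (axis i 1) q)) x (fst v)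
        + fst (D v) $ i *\<^sub>C A (fst (x, u)) (coord_field x (axis i 1) (fst (x, u))))"
    by (intro cder_sum cder_scaleC[OF SH_centred[OF u] comp] cder_fst[OF u] cder_dir conn_coord_cdiff[OF A] mem_dom)
  then have "cder \<sigma> (x, u) (\<lambda>q. B q (X q))
    (\<lambda>v. \<Sum>i\<in>UNIV. fst (field_comp \<sigma> (x, u) X (x, u)) $ i *\<^sub>C dir \<kappa> (\<lambda>q. A q (coord_field x (axis i 1) q)) x (fst v)
        + fst (D v) $ i *\<^sub>C A (fst (x, u)) (coord_field x (axis i 1) (fst (x, u))))"
  proof (rule SH_cder_local[OF _ V])
    fix y w assume yw: "(y, w) \<in> V" "y \<in> cdom x" "w \<in> Sp1C"
    have "(\<Sum>i\<in>UNIV. fst (field_comp \<sigma> (x, u) X (y, w)) $ i *\<^sub>C A y (coord_field x (axis i 1) y))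
      = A y (fst (X (y, w)))"
      unfolding clinear_map_basis[OF conn_coord_linear[OF A yw(2)], symmetric] by (simp add: fc[OF yw] yw(2))
    also have "\<dots> = B (y, w) (X (y, w))"
      using B[OF _ SH_holo_fieldD(1)[OF X yw(1)]] VSH yw(1) by auto
    finally show "(\<Sum>i\<in>UNIV. fst (field_comp \<sigma> (x, u) X (y, w)) $ i *\<^sub>C A (fst (y, w)) (coord_field x (axis i 1) (fst (y, w))))
        = B (y, w) (X (y, w))" by simp
  qed
  then show ?thesis by (simp add: fc[OF V(2) mem_dom u])
qed

lemma connection_form_pullback: "connection_form \<sigma> SH_tangent SH B"
  unfolding connection_form_def
proof (intro conjI ballI allI impI)
  fix p :: "'a \<times> spinor_pair" assume p: "p \<in> SH"
  show "clinear_on (SH_tangent p) (B p)"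
    by (rule clinear_onI)
       (simp_all add: B[OF p] SH_tangent_simps clinear_map_simps[OF conn_linear[OF A]])
next
  fix V X assume VX: "openin (top_of_set SH) V \<and> holo_field \<sigma> SH_tangent V X"
  show "holo_fun \<sigma> V (\<lambda>q. B q (X q))"
    unfolding holo_fun_def
  proof
    fix p assume p: "p \<in> V"
    obtain x u where xu: "p = (x, u)" by (cases p)
    obtain D where D: "cder \<sigma> (x, u) (field_comp \<sigma> (x, u) X) D"
      using SH_holo_fieldD(2)[of V X x u] VX p xu by (auto elim: cdiff_atE)
    show "cdiff_at \<sigma> p (\<lambda>q. B q (X q))"
      unfolding xu by (rule cdiff_atI[OF cder_pullback[OF _ _ _ D]]) (use VX p xu in auto)
  qed
qed

text \<open>Along a vertical \<open>Z\<close> only the components of \<open>Y\<close> vary, so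
  differentiating \<open>B\<close> on \<open>Y\<close> gives \<open>A\<close> of the base part of
  the bracket, which the bracket term cancels. All other terms contain the base component of
  \<open>Z\<close>, which is zero.\<close>

lemma curvature_pullback_vertical:
  assumes V: "openin (top_of_set SH) V" "p \<in> V"
    and Z: "holo_field \<sigma> SH_tangent V Z" and Y: "holo_field \<sigma> SH_tangent V Y"
    and vert: "\<And>q. q \<in> V \<Longrightarrow> vertical (Z q)"
  shows "curvature \<sigma> B Z Y p = 0"
proof -
  obtain x u where p: "p = (x, u)" by (cases p)
  note V' = V[unfolded p]
  have VSH: "V \<subseteq> SH" using openin_subset[OF V(1)] by simp
  then have u: "u \<in> Sp1C" using V(2) p by (auto simp: SH_def)
  have pSH: "(x, u) \<in> SH" using u by (simp add: SH_def)
  obtain D where D: "cder \<sigma> (x, u) (field_comp \<sigma> (x, u) Z) D" using SH_holo_fieldD(2)[OF Z V'(2)] by (rule cdiff_atE)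
  obtain E where E: "cder \<sigma> (x, u) (field_comp \<sigma> (x, u) Y) E" using SH_holo_fieldD(2)[OF Y V'(2)] by (rule cdiff_atE)
  note tZ = SH_holo_fieldD(1)[OF Z V'(2)] and tY = SH_holo_fieldD(1)[OF Y V'(2)]
  have lin: "clinear_map (A y)" for y by (rule conn_linear[OF A])
  have fZ: "fst (Z q) = 0" if "q \<in> V" for q using vert[OF that] by (simp add: vertical_def)
  have da: "clinear_map (dir \<kappa> (\<lambda>q. A q (coord_field x w q)) x)" for w
    by (rule clinear_dir[OF conn_coord_cdiff[OF A mem_dom]])
  \<comment> \<open>The base component of \<open>Z\<close> vanishes on all of \<open>V\<close>; its
    derivative \<open>D\<close> is known to vanish on tangent vectors only, and only those
    occur.\<close>
  have D0: "fst (D v) = 0" if v: "v \<in> SH_tangent (x, u)" for v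
  proof -
    have "cder \<sigma> (x, u) (\<lambda>q. fst (field_comp \<sigma> (x, u) Z q)) (\<lambda>_. 0)"
    proof (rule SH_cder_local[OF cder_const V'])
      fix y w assume yw: "(y, w) \<in> V" "y \<in> cdom x" "w \<in> Sp1C"
      show "0 = fst (field_comp \<sigma> (x, u) Z (y, w))"
        by (simp add: SH_field_comp[where X = Z, OF yw(2,3) SH_holo_fieldD(1)[OF Z yw(1)]] fZ[OF yw(1)]
            clinear_map_simps[OF clinear_dir[OF cdiff_chart_map[OF yw(2)]]])
    qed
    from SH_cder_unique[OF u cder_prod_sel(1)[OF D] this v] show ?thesis .
  qed
  have br: "bracket \<sigma> Z Y (x, u) = E (Z (x, u)) - D (Y (x, u))"
    unfolding bracket_def by (simp add: SH_dir_eq[OF u D tY] SH_dir_eq[OF u E tZ])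
  have "B (x, u) (bracket \<sigma> Z Y (x, u)) = A x (fst (E (Z (x, u))))"
    using B[OF pSH SH_bracket_tangent[OF V' Z Y]] by (simp add: br D0[OF tY])
  moreover have "dir \<sigma> (\<lambda>q. B q (Y q)) (x, u) (Z (x, u)) = A x (fst (E (Z (x, u))))"
    unfolding SH_dir_eq[OF u cder_pullback[OF V' Y E] tZ] fZ[OF V'(2)]
    by (simp add: clinear_map_simps[OF da] clinear_map_basis[OF lin, symmetric])
  moreover have "dir \<sigma> (\<lambda>q. B q (Z q)) (x, u) (Y (x, u)) = 0"
    unfolding SH_dir_eq[OF u cder_pullback[OF V' Z D] tY] fZ[OF V'(2)]
    by (simp add: D0[OF tY])
  moreover have "B (x, u) (Z (x, u)) = 0"
    using B[OF pSH tZ] fZ[OF V'(2)] by (simp add: clinear_map_simps[OF lin])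
  ultimately show ?thesis unfolding curvature_def p by (simp add: matrix_mult_simps)
qed

end
end

section \<open>Binary cubic forms\<close>

definition cube :: "(complex^4^'p::finite \<Rightarrow> complex^'m::finite) \<Rightarrow> complex^'p \<Rightarrow> complex^2 \<Rightarrow> complex^2 \<Rightarrow> complex^2 \<Rightarrow> complex^'m" where
  "cube L e f g k = L (tensor e (sym3 f g k))"

lemma vector_4 [simp]:
  "(vector [a, b, c, d] :: 'a::zero^4) $ 1 = a" "(vector [a, b, c, d] :: 'a^4) $ 2 = b"
  "(vector [a, b, c, d] :: 'a^4) $ 3 = c" "(vector [a, b, c, d] :: 'a^4) $ 4 = d"
  unfolding vector_def by simp_all

lemma sym3_nth [simp]:
  "sym3 f g k $ 1 = f $ 1 * g $ 1 * k $ 1"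
  "sym3 f g k $ 2 = f $ 1 * g $ 1 * k $ 2 + f $ 1 * g $ 2 * k $ 1 + f $ 2 * g $ 1 * k $ 1"
  "sym3 f g k $ 3 = f $ 1 * g $ 2 * k $ 2 + f $ 2 * g $ 1 * k $ 2 + f $ 2 * g $ 2 * k $ 1"
  "sym3 f g k $ 4 = f $ 2 * g $ 2 * k $ 2"
  unfolding sym3_def by simp_all

lemma sym3_commute: "sym3 f g k = sym3 g f k" "sym3 f g k = sym3 f k g"
  by (simp_all add: vec_eq_iff forall_4 algebra_simps)

lemma tensor_nth [simp]: "tensor e t $ i = e $ i *\<^sub>C t"
  by (simp add: tensor_def scaleC_eq_vector_smult)

lemma sym3_linear:
  "sym3 (f + f') g k = sym3 f g k + sym3 f' g k" "sym3 (c *\<^sub>C f) g k = c *\<^sub>C sym3 f g k"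
  "sym3 f (g + g') k = sym3 f g k + sym3 f g' k" "sym3 f (c *\<^sub>C g) k = c *\<^sub>C sym3 f g k"
  "sym3 f g (k + k') = sym3 f g k + sym3 f g k'" "sym3 f g (c *\<^sub>C k) = c *\<^sub>C sym3 f g k"
  by (simp_all add: vec_eq_iff forall_4 scaleC_complex_def algebra_simps)

lemma tensor_linear:
  "tensor (e + e') t = tensor e t + tensor e' t" "tensor (c *\<^sub>C e) t = c *\<^sub>C tensor e t"
  "tensor e (t + t') = tensor e t + tensor e t'" "tensor e (c *\<^sub>C t) = c *\<^sub>C tensor e t"
  by (simp_all add: vec_eq_iff scaleC_complex_def algebra_simps)

text \<open>The order is that of X_+++, X_+, X_-, X_---, with \<open>f\<close> for h_+ and
  \<open>g\<close> for h_-.\<close>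

definition cubic_basis :: "complex^2 \<Rightarrow> complex^2 \<Rightarrow> 4 \<Rightarrow> complex^4" where
  "cubic_basis f g k = (if k = 1 then sym3 f f f else if k = 2 then sym3 f f g else if k = 3 then sym3 g g f else sym3 g g g)"

lemma cubic_basis_simps [simp]:
  "cubic_basis f g 1 = sym3 f f f" "cubic_basis f g 2 = sym3 f f g"
  "cubic_basis f g 3 = sym3 g g f" "cubic_basis f g 4 = sym3 g g g"
  by (simp_all add: cubic_basis_def)

lemma cubic_basis_span:
  assumes "eps f g \<noteq> 0"
  shows "\<exists>a :: complex^4. t = (\<Sum>k\<in>UNIV. a $ k *\<^sub>C cubic_basis f g k)"
proof -
  define d where "d = inverse (eps f g)"
  \<comment> \<open>The inverse of the matrix with rows \<open>f\<close> and \<open>g\<close>, by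
    Cramer's rule: it expresses the unit vectors through \<open>f\<close> and \<open>g\<close>, so
    that monomials in the unit vectors become combinations of products of \<open>f\<close> and
    \<open>g\<close>.\<close>
  define p q r s where "p = g $ 2 * d" and "q = - f $ 2 * d" and "r = - g $ 1 * d" and "s = f $ 1 * d"
  have "d * eps f g = 1" using assms by (simp add: d_def)
  then have d: "d * (f $ 1 * g $ 2 - f $ 2 * g $ 1) = 1" by (simp add: eps_def)
  have "p * f $ 1 + q * g $ 1 = 1" "p * f $ 2 + q * g $ 2 = 0" "r * f $ 1 + s * g $ 1 = 0" "r * f $ 2 + s * g $ 2 = 1"
    using d unfolding p_def q_def r_def s_def by algebra+
  then have e1: "axis 1 1 = p *\<^sub>C f + q *\<^sub>C g" and e2: "axis 2 1 = r *\<^sub>C f + s *\<^sub>C g"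
    by (simp_all add: vec_eq_iff forall_2 axis_def scaleC_complex_def)
  have t: "t = t $ 1 *\<^sub>C sym3 (axis 1 1) (axis 1 1) (axis 1 1) + t $ 2 *\<^sub>C sym3 (axis 1 1) (axis 1 1) (axis 2 1)
     + t $ 3 *\<^sub>C sym3 (axis 1 1) (axis 2 1) (axis 2 1) + t $ 4 *\<^sub>C sym3 (axis 2 1) (axis 2 1) (axis 2 1)"
    by (simp add: vec_eq_iff forall_4 axis_def scaleC_complex_def)
  define P where "P t \<longleftrightarrow> (\<exists>a :: complex^4. t = (\<Sum>k\<in>UNIV. a $ k *\<^sub>C cubic_basis f g k))" for t
  have add: "P (v + w)" if P: "P v" "P w" for v w
  proof -
    from P obtain a b :: "complex^4" where "v = (\<Sum>k\<in>UNIV. a $ k *\<^sub>C cubic_basis f g k)" "w = (\<Sum>k\<in>UNIV. b $ k *\<^sub>C cubic_basis f g k)"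
      unfolding P_def by blast
    then show ?thesis unfolding P_def by (intro exI[of _ "a + b"]) (simp add: scaleC_add_left sum.distrib)
  qed
  have scale: "P (c *\<^sub>C v)" if P: "P v" for c v
  proof -
    from P obtain a :: "complex^4" where "v = (\<Sum>k\<in>UNIV. a $ k *\<^sub>C cubic_basis f g k)"
      unfolding P_def by blast
    then show ?thesis unfolding P_def
      by (intro exI[of _ "c *\<^sub>C a"]) (simp add: scaleC.sum_right scaleC_scaleC scaleC_complex_def)
  qed
  have "P (sym3 f f f)" unfolding P_def by (rule exI[of _ "vector [1, 0, 0, 0]"]) (simp add: sum_4 del: sym3_nth)
  moreover have "P (sym3 f f g)" unfolding P_def by (rule exI[of _ "vector [0, 1, 0, 0]"]) (simp add: sum_4 del: sym3_nth)
  moreover have "P (sym3 g g f)" unfolding P_def by (rule exI[of _ "vector [0, 0, 1, 0]"]) (simp add: sum_4 del: sym3_nth)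
  moreover have "P (sym3 g g g)" unfolding P_def by (rule exI[of _ "vector [0, 0, 0, 1]"]) (simp add: sum_4 del: sym3_nth)
  moreover have "sym3 g f f = sym3 f f g" "sym3 f g f = sym3 f f g" "sym3 f g g = sym3 g g f" "sym3 g f g = sym3 g g f"
    by (simp_all add: vec_eq_iff forall_4 algebra_simps)
  ultimately have "P (sym3 f g f)" "P (sym3 g f f)" "P (sym3 f g g)" "P (sym3 g f g)" "P (sym3 f f f)" "P (sym3 g g g)" "P (sym3 f f g)" "P (sym3 g g f)"
    by simp_all
  then have "P t"
    by (subst t) (unfold e1 e2 sym3_linear, intro add scale)
  then show ?thesis unfolding P_def .
qed

text \<open>The isomorphism of four copies of the fibre of \<open>E*\<close> with the tangent space given by the
  cubic basis of \<open>f, g\<close>.\<close>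

definition cubic_iso :: "(complex^4^'p::finite \<Rightarrow> complex^'m::finite) \<Rightarrow> complex^2 \<Rightarrow> complex^2 \<Rightarrow> complex^4^'p \<Rightarrow> complex^'m" where
  "cubic_iso L f g w = L (\<chi> i. \<Sum>k\<in>UNIV. w $ i $ k *\<^sub>C cubic_basis f g k)"

context
  fixes L :: "complex^4^'p::finite \<Rightarrow> complex^'m::finite"
  assumes L: "clinear_map L" "bij L"
begin

lemma cube_linear:
  "cube L (e + e') f g k = cube L e f g k + cube L e' f g k" "cube L (c *\<^sub>C e) f g k = c *\<^sub>C cube L e f g k"
  "cube L e (f + f') g k = cube L e f g k + cube L e f' g k" "cube L e (c *\<^sub>C f) g k = c *\<^sub>C cube L e f g k"
  "cube L e f (g + g') k = cube L e f g k + cube L e f g' k" "cube L e f (c *\<^sub>C g) k = c *\<^sub>C cube L e f g k"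
  "cube L e f g (k + k') = cube L e f g k + cube L e f g k'" "cube L e f g (c *\<^sub>C k) = c *\<^sub>C cube L e f g k"
  by (simp_all add: cube_def sym3_linear tensor_linear clinear_map_simps[OF L(1)])

lemma cube_commute: "cube L e f g k = cube L e g f k" "cube L e f g k = cube L e f k g"
  by (simp_all add: cube_def sym3_commute)

lemma clinear_map_cube: "clinear_map (\<lambda>e. cube L e f g k)"
  by (intro clinear_onI cube_linear)

lemma cubic_iso_eq: "cubic_iso L f g w = cube L (\<chi> i. w $ i $ 1) f f f + cube L (\<chi> i. w $ i $ 2) f f g
    + cube L (\<chi> i. w $ i $ 3) g g f + cube L (\<chi> i. w $ i $ 4) g g g"
  unfolding cubic_iso_def cube_def clinear_map_simps(1)[OF L(1), symmetric]
  by (rule arg_cong[of _ _ L]) (simp add: vec_eq_iff sum_4)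

lemma clinear_cubic_iso: "clinear_map (cubic_iso L f g)"
proof (rule clinear_onI)
  show "cubic_iso L f g (v + w) = cubic_iso L f g v + cubic_iso L f g w" for v w
    unfolding cubic_iso_def clinear_map_simps(1)[OF L(1), symmetric]
    by (rule arg_cong[of _ _ L]) (simp add: vec_eq_iff scaleC_complex_def algebra_simps sum.distrib)
  show "cubic_iso L f g (c *\<^sub>C v) = c *\<^sub>C cubic_iso L f g v" for c v
    unfolding cubic_iso_def clinear_map_simps(2)[OF L(1), symmetric]
    by (rule arg_cong[of _ _ L]) (simp add: vec_eq_iff scaleC_complex_def sum_distrib_left mult_ac)
qed

text \<open>Spanning is enough, since a surjective linear map of a finite-dimensional space to
  itself is injective.\<close>

lemma bij_cubic_iso:
  assumes "eps f g \<noteq> 0"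
  shows "bij (cubic_iso L f g)"
proof -
  define M where "M w = (\<chi> i. \<Sum>k\<in>UNIV. w $ i $ k *\<^sub>C cubic_basis f g k)" for w :: "complex^4^'p"
  have eq: "cubic_iso L f g = L \<circ> M" by (simp add: fun_eq_iff cubic_iso_def M_def)
  have "surj M"
  proof (rule surjI)
    fix t :: "complex^4^'p"
    define a where "a s = (SOME a :: complex^4. s = (\<Sum>k\<in>UNIV. a $ k *\<^sub>C cubic_basis f g k))" for s
    have a: "s = (\<Sum>k\<in>UNIV. a s $ k *\<^sub>C cubic_basis f g k)" for s
      unfolding a_def by (rule someI_ex[OF cubic_basis_span[OF assms]])
    show "M ((\<lambda>t. \<chi> i. a (t $ i)) t) = t"
      unfolding M_def vec_lambda_beta a[symmetric] by (rule vec_lambda_eta)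
  qed
  have lin: "linear M"
    by (rule clinear_map_linear[OF clinear_onI])
       (simp_all add: M_def vec_eq_iff scaleC_complex_def algebra_simps sum.distrib sum_distrib_left)
  have "inj M" using linear_surjective_imp_injective[OF lin] \<open>surj M\<close> by simp
  then have "bij M" using \<open>surj M\<close> unfolding bij_def by simp
  then show ?thesis unfolding eq using L(2) by (rule bij_comp)
qed

lemma cube_span:
  assumes "eps f g \<noteq> 0"
  obtains w1 w2 w3 w4 where "v = cube L w1 f f f + cube L w2 f f g + cube L w3 g g f + cube L w4 g g g"
proof -
  obtain w where "v = cubic_iso L f g w"
    using surjD[OF bij_is_surj[OF bij_cubic_iso[OF assms]], of v] by auto
  then show thesis using that unfolding cubic_iso_eq by simp
qed

end

section \<open>Bilinear forms on pairs of cubics and the third transvectant\<close>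

lemma quartic_zero:
  fixes c0 c1 c2 c3 c4 :: "complex^'r^'q"
  assumes "\<And>s. c0 + s *\<^sub>C c1 + (s * s) *\<^sub>C c2 + (s * s * s) *\<^sub>C c3 + (s * s * s * s) *\<^sub>C c4 = 0"
  shows "c0 = 0 \<and> c1 = 0 \<and> c2 = 0 \<and> c3 = 0 \<and> c4 = 0"
proof -
  have "c0 $ i $ j = 0 \<and> c1 $ i $ j = 0 \<and> c2 $ i $ j = 0 \<and> c3 $ i $ j = 0 \<and> c4 $ i $ j = 0" for i j
  proof -
    have "poly [:c0 $ i $ j, c1 $ i $ j, c2 $ i $ j, c3 $ i $ j, c4 $ i $ j:] s = 0" for s
    proof -
      have "(c0 + s *\<^sub>C c1 + (s * s) *\<^sub>C c2 + (s * s * s) *\<^sub>C c3 + (s * s * s * s) *\<^sub>C c4) $ i $ j = 0"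
        unfolding assms by simp
      then show ?thesis by (simp add: scaleC_complex_def algebra_simps)
    qed
    then have "[:c0 $ i $ j, c1 $ i $ j, c2 $ i $ j, c3 $ i $ j, c4 $ i $ j:] = 0"
      by (simp only: poly_all_0_iff_0[symmetric] simp_thms)
    then show ?thesis by simp
  qed
  then show ?thesis by (simp add: vec_eq_iff)
qed

text \<open>A bilinear form on cubics that vanishes on all pairs of cubics with a common squared factor
  is a multiple of the third transvectant.\<close>

lemma cubic_form_unique:
  fixes F :: "complex^'m \<Rightarrow> complex^'m \<Rightarrow> complex^'r^'q"
  assumes F1: "\<And>v. clinear_map (F v)" and F2: "\<And>w. clinear_map (\<lambda>v. F v w)"
    and van: "\<And>s. F (x1 + (2 * s) *\<^sub>C x2 + (s * s) *\<^sub>C x3) (y1 + (2 * s) *\<^sub>C y2 + (s * s) *\<^sub>C y3) = 0"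
      "\<And>s. F (x1 + (2 * s) *\<^sub>C x2 + (s * s) *\<^sub>C x3) (y2 + (2 * s) *\<^sub>C y3 + (s * s) *\<^sub>C y4) = 0"
      "\<And>s. F (x2 + (2 * s) *\<^sub>C x3 + (s * s) *\<^sub>C x4) (y1 + (2 * s) *\<^sub>C y2 + (s * s) *\<^sub>C y3) = 0"
      "\<And>s. F (x2 + (2 * s) *\<^sub>C x3 + (s * s) *\<^sub>C x4) (y2 + (2 * s) *\<^sub>C y3 + (s * s) *\<^sub>C y4) = 0"
    and phi: "\<phi> = (- 1 / 12) *\<^sub>C F x2 y3"
  shows "F x1 y1 = 0" "F x1 y2 = 0" "F x1 y3 = 0" "F x1 y4 = 36 *\<^sub>C \<phi>"
    "F x2 y1 = 0" "F x2 y2 = 0" "F x2 y3 = (- 12) *\<^sub>C \<phi>" "F x2 y4 = 0"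
    "F x3 y1 = 0" "F x3 y2 = 12 *\<^sub>C \<phi>" "F x3 y3 = 0" "F x3 y4 = 0"
    "F x4 y1 = (- 36) *\<^sub>C \<phi>" "F x4 y2 = 0" "F x4 y3 = 0" "F x4 y4 = 0"
proof -
  note lin = clinear_map_simps(1,2)[OF F1] clinear_map_simps(1,2)[OF F2]
  \<comment> \<open>When x1, ..., x4 are f^3, f^2 g, g^2 f, g^3 and l = f + s g, the arguments in
    \<open>van\<close> are l^2 f and l^2 g. Each hypothesis is a polynomial of degree 4 in
    \<open>s\<close>, all of whose coefficients vanish.\<close>
  have exp: "F (p + (2 * s) *\<^sub>C q + (s * s) *\<^sub>C r) (p' + (2 * s) *\<^sub>C q' + (s * s) *\<^sub>C r')
    = F p p' + s *\<^sub>C (2 *\<^sub>C F p q' + 2 *\<^sub>C F q p') + (s * s) *\<^sub>C (F p r' + F r p' + 4 *\<^sub>C F q q')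
     + (s * s * s) *\<^sub>C (2 *\<^sub>C F q r' + 2 *\<^sub>C F r q') + (s * s * s * s) *\<^sub>C F r r'" for s p q r p' q' r'
    unfolding lin by (simp add: vec_eq_iff scaleC_complex_def algebra_simps)
  note a = quartic_zero[OF van(1)[unfolded exp]]
  note b = quartic_zero[OF van(2)[unfolded exp]]
  note c = quartic_zero[OF van(3)[unfolded exp]]
  note d = quartic_zero[OF van(4)[unfolded exp]]
  have two: "v = 0" if "2 *\<^sub>C v = 0" for v :: "complex^'r^'q"
    using that by (simp add: vec_eq_iff scaleC_complex_def)
  have two2: "v + w = 0" if "2 *\<^sub>C v + 2 *\<^sub>C w = 0" for v w :: "complex^'r^'q"
    by (rule two) (use that in \<open>simp add: scaleC_add_right\<close>)
  show 11: "F x1 y1 = 0" and 33: "F x3 y3 = 0" using a by simp_all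
  show 22: "F x2 y2 = 0" and 44: "F x4 y4 = 0" using d by simp_all
  show 12: "F x1 y2 = 0" and 34: "F x3 y4 = 0" using b by simp_all
  show 21: "F x2 y1 = 0" and 43: "F x4 y3 = 0" using c by simp_all
  show 13: "F x1 y3 = 0" and 24: "F x2 y4 = 0" by (rule two; use b 22 33 in simp)+
  show 31: "F x3 y1 = 0" and 42: "F x4 y2 = 0" by (rule two; use c 22 33 in simp)+
  \<comment> \<open>Only the pairs with indices adding to 5 remain. The s^3 coefficient of the first
    hypothesis and the s^2 coefficients of the second and third fix their ratios as 36 : -12 : 12 :
    -36; the choice of \<open>\<phi>\<close> fixes the scale.\<close>
  have e1: "F x2 y3 + F x3 y2 = 0" by (rule two2) (use a in simp)
  have e2: "F x1 y4 + F x3 y2 + 4 *\<^sub>C F x2 y3 = 0" using b by simp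
  have e3: "F x2 y3 + F x4 y1 + 4 *\<^sub>C F x3 y2 = 0" using c by simp
  show 23: "F x2 y3 = (- 12) *\<^sub>C \<phi>" by (simp add: phi scaleC_scaleC)
  show 32: "F x3 y2 = 12 *\<^sub>C \<phi>" using e1 23 by (simp add: eq_neg_iff_add_eq_0 add.commute scaleC.minus_left)
  have "F x1 y4 = - (12 *\<^sub>C \<phi>) - 4 *\<^sub>C (- 12) *\<^sub>C \<phi>" using e2 unfolding 23 32 by (simp add: algebra_simps eq_neg_iff_add_eq_0)
  also have "\<dots> = 36 *\<^sub>C \<phi>" by (simp add: vec_eq_iff scaleC_complex_def)
  finally show "F x1 y4 = 36 *\<^sub>C \<phi>" .
  have "F x4 y1 = - ((- 12) *\<^sub>C \<phi>) - 4 *\<^sub>C 12 *\<^sub>C \<phi>" using e3 unfolding 23 32 by (simp add: algebra_simps eq_neg_iff_add_eq_0)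
  also have "\<dots> = (- 36) *\<^sub>C \<phi>" by (simp add: vec_eq_iff scaleC_complex_def)
  finally show "F x4 y1 = (- 36) *\<^sub>C \<phi>" .
qed

text \<open>The permanent of a 3 by 3 matrix. On the pairings of two triples of linear forms it is,
  up to a factor, the third transvectant of the two products.\<close>

definition perm3 :: "(3 \<Rightarrow> 3 \<Rightarrow> complex) \<Rightarrow> complex" where
  "perm3 M = M 1 1 * M 2 2 * M 3 3 + M 1 1 * M 2 3 * M 3 2 + M 1 2 * M 2 1 * M 3 3
     + M 1 2 * M 2 3 * M 3 1 + M 1 3 * M 2 1 * M 3 2 + M 1 3 * M 2 2 * M 3 1"

text \<open>A permutation of three points is the triple of its values, which makes the sum an
  explicit one over six triples.\<close>

lemma sum_bij_3:
  fixes f :: "3 \<Rightarrow> 3 \<Rightarrow> 3 \<Rightarrow> 'v::comm_monoid_add"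
  shows "(\<Sum>\<sigma> | bij (\<sigma> :: 3 \<Rightarrow> 3). f (\<sigma> 1) (\<sigma> 2) (\<sigma> 3))
    = f 1 2 3 + f 1 3 2 + f 2 1 3 + f 2 3 1 + f 3 1 2 + f 3 2 1"
proof -
  define T :: "(3 \<times> 3 \<times> 3) set" where "T = {(1,2,3), (1,3,2), (2,1,3), (2,3,1), (3,1,2), (3,2,1)}"
  define I :: "3 \<times> 3 \<times> 3 \<Rightarrow> 3 \<Rightarrow> 3" where "I t k = (if k = 1 then fst t else if k = 2 then fst (snd t) else snd (snd t))" for t k
  define J :: "(3 \<Rightarrow> 3) \<Rightarrow> 3 \<times> 3 \<times> 3" where "J \<sigma> = (\<sigma> 1, \<sigma> 2, \<sigma> 3)" for \<sigma>
  have IJ: "I (J \<sigma>) k = \<sigma> k" for \<sigma> k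
    using exhaust_3[of k] by (auto simp: I_def J_def)
  have JI: "J (I t) = t" for t by (simp add: I_def J_def)
  have J: "J \<sigma> \<in> T" if "bij \<sigma>" for \<sigma>
  proof -
    have "\<sigma> 1 \<noteq> \<sigma> 2" "\<sigma> 1 \<noteq> \<sigma> 3" "\<sigma> 2 \<noteq> \<sigma> 3" using bij_is_inj[OF that] by (simp_all add: inj_eq)
    then show ?thesis
      using exhaust_3[of "\<sigma> 1"] exhaust_3[of "\<sigma> 2"] exhaust_3[of "\<sigma> 3"]
      by (elim disjE) (simp_all add: T_def J_def)
  qed
  have I: "bij (I t)" if "t \<in> T" for t
  proof -
    have "inj (I t)"
      using that unfolding inj_def forall_3 by (auto simp: T_def I_def)
    then show ?thesis by (simp add: bij_def finite_UNIV_inj_surj)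
  qed
  have "(\<Sum>\<sigma> | bij (\<sigma> :: 3 \<Rightarrow> 3). f (\<sigma> 1) (\<sigma> 2) (\<sigma> 3)) = (\<Sum>t\<in>T. f (fst t) (fst (snd t)) (snd (snd t)))"
    by (rule sum.reindex_bij_witness[of _ I J]) (use IJ JI J I in \<open>auto simp: J_def\<close>)
  also have "\<dots> = f 1 2 3 + f 1 3 2 + f 2 1 3 + f 2 3 1 + f 3 1 2 + f 3 2 1"
    by (simp add: T_def add_ac)
  finally show ?thesis .
qed

text \<open>The summand depends only on \<open>\<tau>\<close> composed with the inverse of
  \<open>\<sigma>\<close>, so each of the six terms of the permanent occurs six times. This is where
  the unnormalised sum over permutations in \<open>curvature_components\<close> acquires its
  factor.\<close>

lemma sum_bij_perm3:
  "(\<Sum>\<sigma> | bij (\<sigma> :: 3 \<Rightarrow> 3). \<Sum>\<tau> | bij (\<tau> :: 3 \<Rightarrow> 3). M (\<sigma> 1) (\<tau> 1) * M (\<sigma> 2) (\<tau> 2) * M (\<sigma> 3) (\<tau> 3))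
    = 6 * perm3 M"
proof -
  define N where "N a b c = M a 1 * M b 2 * M c 3 + M a 1 * M b 3 * M c 2 + M a 2 * M b 1 * M c 3
      + M a 2 * M b 3 * M c 1 + M a 3 * M b 1 * M c 2 + M a 3 * M b 2 * M c 1" for a b c
  have "(\<Sum>\<tau> | bij (\<tau> :: 3 \<Rightarrow> 3). M a (\<tau> 1) * M b (\<tau> 2) * M c (\<tau> 3)) = N a b c" for a b c
    using sum_bij_3[of "\<lambda>d e f. M a d * M b e * M c f"] by (simp add: N_def)
  then show ?thesis
    by (simp add: sum_bij_3[of N]) (simp add: N_def perm3_def algebra_simps)
qed

context
  fixes L :: "complex^4^'p::finite \<Rightarrow> complex^'m::finite"
  assumes L: "clinear_map L" "bij L"
begin

lemma cube_expand:
  fixes a b c :: "complex^2"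
  shows "cube L e (a $ 1 *\<^sub>C f + a $ 2 *\<^sub>C g) (b $ 1 *\<^sub>C f + b $ 2 *\<^sub>C g) (c $ 1 *\<^sub>C f + c $ 2 *\<^sub>C g)
    = (a $ 1 * b $ 1 * c $ 1) *\<^sub>C cube L e f f f
    + (a $ 1 * b $ 1 * c $ 2 + a $ 1 * b $ 2 * c $ 1 + a $ 2 * b $ 1 * c $ 1) *\<^sub>C cube L e f f g
    + (a $ 1 * b $ 2 * c $ 2 + a $ 2 * b $ 1 * c $ 2 + a $ 2 * b $ 2 * c $ 1) *\<^sub>C cube L e g g f
    + (a $ 2 * b $ 2 * c $ 2) *\<^sub>C cube L e g g g"
proof -
  have c: "cube L e f g f = cube L e f f g" "cube L e g f f = cube L e f f g"
    "cube L e f g g = cube L e g g f" "cube L e g f g = cube L e g g f"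
    by (metis cube_commute[OF L])+
  show ?thesis
    unfolding cube_linear[OF L] c by (simp add: vec_eq_iff scaleC_complex_def algebra_simps)
qed

context
  fixes F :: "complex^'m \<Rightarrow> complex^'m \<Rightarrow> complex^'r^'q" and f g :: "complex^2"
  assumes F: "\<And>v. clinear_map (F v)" "\<And>w. clinear_map (\<lambda>v. F v w)" and anti: "\<And>v w. F w v = - F v w"
    and van: "\<And>a b e e' l m. eps a b = 1 \<Longrightarrow> l = a $ 1 *\<^sub>C f + a $ 2 *\<^sub>C g \<Longrightarrow> m = b $ 1 *\<^sub>C f + b $ 2 *\<^sub>C g \<Longrightarrow>
        F (cube L e l l l) (cube L e' l l l) = 0 \<and> F (cube L e l l l) (cube L e' l l m) = 0 \<and>
        F (cube L e l l m) (cube L e' l l m) = 0"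
begin

text \<open>The coefficient of the transvectant, scaled so that the value on the pair X_+, X_-
  carries the prescribed constant -12.\<close>

definition cube_form :: "complex^'p \<Rightarrow> complex^'p \<Rightarrow> complex^'r^'q" where
  "cube_form e e' = (- 1 / 12) *\<^sub>C F (cube L e f f g) (cube L e' g g f)"

text \<open>For l = f + s g and m = g the hypothesis speaks of l^3 and l^2 g, whereas
  \<open>cubic_form_unique\<close> asks for l^2 f and l^2 g. Since l^3 = l^2 f + s l^2 g,
  bilinearity trades one for the other, and antisymmetry of \<open>F\<close> supplies the case with
  the two factors in reverse order.\<close>

lemma cube_form_basis:
  fixes e e' :: "complex^'p"
  defines "x1 \<equiv> cube L e f f f" and "x2 \<equiv> cube L e f f g" and "x3 \<equiv> cube L e g g f" and "x4 \<equiv> cube L e g g g"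
    and "y1 \<equiv> cube L e' f f f" and "y2 \<equiv> cube L e' f f g" and "y3 \<equiv> cube L e' g g f" and "y4 \<equiv> cube L e' g g g"
  shows "F x1 y1 = 0" "F x1 y2 = 0" "F x1 y3 = 0" "F x1 y4 = 36 *\<^sub>C cube_form e e'"
    "F x2 y1 = 0" "F x2 y2 = 0" "F x2 y3 = (- 12) *\<^sub>C cube_form e e'" "F x2 y4 = 0"
    "F x3 y1 = 0" "F x3 y2 = 12 *\<^sub>C cube_form e e'" "F x3 y3 = 0" "F x3 y4 = 0"
    "F x4 y1 = (- 36) *\<^sub>C cube_form e e'" "F x4 y2 = 0" "F x4 y3 = 0" "F x4 y4 = 0"
proof -
  define P where "P s e = cube L e (f + s *\<^sub>C g) (f + s *\<^sub>C g) f" for s e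
  define Q where "Q s e = cube L e (f + s *\<^sub>C g) (f + s *\<^sub>C g) g" for s e
  define l :: "complex \<Rightarrow> complex^2" where "l s = vector [1, s]" for s
  have l: "f + s *\<^sub>C g = l s $ 1 *\<^sub>C f + l s $ 2 *\<^sub>C g" for s by (simp add: l_def)
  have ff: "f = (vector [1, 0] :: complex^2) $ 1 *\<^sub>C f + (vector [1, 0] :: complex^2) $ 2 *\<^sub>C g"
    and gg: "g = (vector [0, 1] :: complex^2) $ 1 *\<^sub>C f + (vector [0, 1] :: complex^2) $ 2 *\<^sub>C g" by simp_all
  have P: "P s e = cube L e f f f + (2 * s) *\<^sub>C cube L e f f g + (s * s) *\<^sub>C cube L e g g f" for s e
  proof -
    have "P s e = cube L e (l s $ 1 *\<^sub>C f + l s $ 2 *\<^sub>C g) (l s $ 1 *\<^sub>C f + l s $ 2 *\<^sub>C g)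
      ((vector [1, 0] :: complex^2) $ 1 *\<^sub>C f + (vector [1, 0] :: complex^2) $ 2 *\<^sub>C g)"
      unfolding P_def l by simp
    then show ?thesis unfolding cube_expand by (simp add: l_def)
  qed
  have Q: "Q s e = cube L e f f g + (2 * s) *\<^sub>C cube L e g g f + (s * s) *\<^sub>C cube L e g g g" for s e
  proof -
    have "Q s e = cube L e (l s $ 1 *\<^sub>C f + l s $ 2 *\<^sub>C g) (l s $ 1 *\<^sub>C f + l s $ 2 *\<^sub>C g)
      ((vector [0, 1] :: complex^2) $ 1 *\<^sub>C f + (vector [0, 1] :: complex^2) $ 2 *\<^sub>C g)"
      unfolding Q_def l by simp
    then show ?thesis unfolding cube_expand by (simp add: l_def)
  qed
  note lin = clinear_map_simps(1,2)[OF F(1)] clinear_map_simps(1,2)[OF F(2)]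
  have PQ: "cube L e (f + s *\<^sub>C g) (f + s *\<^sub>C g) (f + s *\<^sub>C g) = P s e + s *\<^sub>C Q s e" for s e
    unfolding P_def Q_def by (simp only: cube_linear(7,8)[OF L])
  have "F (P s e + s *\<^sub>C Q s e) (P s e' + s *\<^sub>C Q s e') = 0 \<and> F (P s e + s *\<^sub>C Q s e) (Q s e') = 0 \<and> F (Q s e) (Q s e') = 0" for s e e'
    unfolding PQ[symmetric] unfolding Q_def
    by (rule van[of "l s" "vector [0, 1]" _ g]) (simp_all add: l_def eps_def)
  then have QQ: "F (Q s e) (Q s e') = 0" and PQ': "F (P s e + s *\<^sub>C Q s e) (Q s e') = 0"
    and PP': "F (P s e + s *\<^sub>C Q s e) (P s e' + s *\<^sub>C Q s e') = 0" for s e e' by blast+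
  have PQ0: "F (P s e) (Q s e') = 0" for s e e' using PQ'[of s e e'] unfolding lin QQ by simp
  have QP0: "F (Q s e) (P s e') = 0" for s e e' using anti[of "Q s e" "P s e'"] PQ0[of s e' e] by simp
  have PP0: "F (P s e) (P s e') = 0" for s e e' using PP'[of s e e'] unfolding lin QQ PQ0 QP0 by simp
  note * = cubic_form_unique[OF F PP0[unfolded P] PQ0[unfolded P Q] QP0[unfolded P Q] QQ[unfolded Q] cube_form_def[of e e']]
  show "F x1 y1 = 0" "F x1 y2 = 0" "F x1 y3 = 0" "F x1 y4 = 36 *\<^sub>C cube_form e e'"
    "F x2 y1 = 0" "F x2 y2 = 0" "F x2 y3 = (- 12) *\<^sub>C cube_form e e'" "F x2 y4 = 0"
    "F x3 y1 = 0" "F x3 y2 = 12 *\<^sub>C cube_form e e'" "F x3 y3 = 0" "F x3 y4 = 0"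
    "F x4 y1 = (- 36) *\<^sub>C cube_form e e'" "F x4 y2 = 0" "F x4 y3 = 0" "F x4 y4 = 0"
    unfolding x1_def x2_def x3_def x4_def y1_def y2_def y3_def y4_def by (rule *)+
qed

text \<open>The basis values at (x2, y3) and (x3, y2) have opposite constants -12 and 12, so the
  antisymmetry of \<open>F\<close> becomes symmetry in \<open>e\<close>, \<open>e'\<close>.\<close>

lemma cube_form_commute: "cube_form e' e = cube_form e e'"
proof -
  have "12 *\<^sub>C cube_form e e' = 12 *\<^sub>C cube_form e' e"
    using cube_form_basis(10)[of e e'] cube_form_basis(7)[of e' e] anti[of "cube L e g g f" "cube L e' f f g"]
    by (simp add: scaleC.minus_left)
  then show ?thesis by (simp add: vec_eq_iff scaleC_complex_def)
qed

lemma complex_bilinear_cube_form: "complex_bilinear cube_form"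
  unfolding complex_bilinear_def cube_form_def
  by (intro conjI allI clinear_map_compose[OF clinear_map_scaleC(1)] clinear_map_compose[OF F(1)] clinear_map_compose[OF F(2)] clinear_map_cube[OF L])

text \<open>In coordinates the form is 36 a1 b4 - 12 a2 b3 + 12 a3 b2 - 36 a4 b1, which is six times
  the permanent when the cubics are products of linear forms. In this shape the result fits both the
  sum over permutations on \<open>M\<close> and the constants on \<open>S_H\<close>.\<close>

lemma cube_pairing:
  fixes p q :: "3 \<Rightarrow> complex^2"
  assumes P: "\<And>i. P i = p i $ 1 *\<^sub>C f + p i $ 2 *\<^sub>C g" and Q: "\<And>i. Q i = q i $ 1 *\<^sub>C f + q i $ 2 *\<^sub>C g"
  shows "F (cube L e (P 1) (P 2) (P 3)) (cube L e' (Q 1) (Q 2) (Q 3)) = (6 * perm3 (\<lambda>i j. eps (p i) (q j))) *\<^sub>C cube_form e e'"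
proof -
  note lin = clinear_map_simps(1,2)[OF F(1)] clinear_map_simps(1,2)[OF F(2)]
  have *: "F (a1 *\<^sub>C cube L e f f f + a2 *\<^sub>C cube L e f f g + a3 *\<^sub>C cube L e g g f + a4 *\<^sub>C cube L e g g g)
      (b1 *\<^sub>C cube L e' f f f + b2 *\<^sub>C cube L e' f f g + b3 *\<^sub>C cube L e' g g f + b4 *\<^sub>C cube L e' g g g)
    = (36 * a1 * b4 - 12 * a2 * b3 + 12 * a3 * b2 - 36 * a4 * b1) *\<^sub>C cube_form e e'" for a1 a2 a3 a4 b1 b2 b3 b4
    unfolding lin cube_form_basis by (simp add: vec_eq_iff scaleC_complex_def algebra_simps)
  show ?thesis
    unfolding P Q cube_expand *
    by (rule arg_cong[of _ _ "\<lambda>c. c *\<^sub>C cube_form e e'"]) (simp add: perm3_def eps_def algebra_simps)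
qed

end
end

section \<open>Gauge transformations\<close>

lemma matrix_inv_mult:
  assumes "invertible A"
  shows "A ** matrix_inv A = mat 1" "matrix_inv A ** A = mat 1"
  using someI_ex[OF assms[unfolded invertible_def]] unfolding matrix_inv_def by simp_all

lemma cdiff_matrix_system:
  fixes N :: "'a \<Rightarrow> complex^'n^'n" and W Y :: "'a \<Rightarrow> complex^'k^'n"
  assumes c: "centred \<kappa> p" and N: "cdiff_at \<kappa> p N" and W: "cdiff_at \<kappa> p W"
    and V: "nbhd \<kappa> p V" "\<And>q. q \<in> V \<Longrightarrow> invertible (N q) \<and> N q ** Y q = W q" "p \<in> V"
  shows "cdiff_at \<kappa> p Y"
proof -
  have col: "cdiff_at \<kappa> p (\<lambda>q. \<chi> i. Y q $ i $ j)" for j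
  proof (rule cdiff_linear_system[OF c N _ V(1) _ V(3)])
    show "cdiff_at \<kappa> p (\<lambda>q. \<chi> i. W q $ i $ j)"
      by (intro cdiff_vec_lambda cdiff_vec_nth W)
    show "invertible (N q) \<and> N q *v (\<chi> i. Y q $ i $ j) = (\<chi> i. W q $ i $ j)" if "q \<in> V" for q
      using V(2)[OF that] by (auto simp: vec_eq_iff matrix_matrix_mult_def matrix_vector_mult_def)
  qed
  have "cdiff_at \<kappa> p (\<lambda>q. \<chi> i j. (\<chi> i. Y q $ i $ j) $ i)"
    by (intro cdiff_vec_lambda) (rule cdiff_vec_nth[OF col])
  then show ?thesis by simp
qed

context cmanifold
begin

definition gauge :: "('a \<Rightarrow> complex^'m \<Rightarrow> complex^'r::finite^'r) \<Rightarrow> ('a \<Rightarrow> complex^'r^'r) \<Rightarrow> 'a \<Rightarrow> complex^'m \<Rightarrow> complex^'r^'r" where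
  "gauge A \<psi> y v = matrix_inv (\<psi> y) ** (dir \<kappa> \<psi> y v + A y v ** \<psi> y)"

context
  fixes A :: "'a \<Rightarrow> complex^'m \<Rightarrow> complex^'r::finite^'r" and \<psi> :: "'a \<Rightarrow> complex^'r^'r"
  assumes A: "connection_form \<kappa> full_tangent UNIV A"
    and psi: "holo_fun \<kappa> UNIV \<psi>" "\<And>y. invertible (\<psi> y)"
begin

lemma gauge_mult: "\<psi> y ** gauge A \<psi> y v = dir \<kappa> \<psi> y v + A y v ** \<psi> y"
  unfolding gauge_def matrix_mul_assoc matrix_inv_mult(1)[OF psi(2)] by simp

lemma gauge_linear: "clinear_map (gauge A \<psi> y)"
proof -
  have d: "clinear_map (dir \<kappa> \<psi> y)" using psi(1) by (intro clinear_dir) (simp add: holo_fun_def)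
  show ?thesis
    by (rule clinear_onI)
       (simp_all add: gauge_def clinear_map_simps[OF d] clinear_map_simps[OF conn_linear[OF A]] matrix_mult_simps scaleC_add_right)
qed

text \<open>The new potential solves a linear system with matrix \<open>\<psi>\<close>, so
  \<open>cdiff_matrix_system\<close> gives its regularity without differentiating the inverse of
  \<open>\<psi>\<close>. The right side contains a derivative of \<open>\<psi>\<close>, which is
  holomorphic by \<open>holo_fun_dir\<close>.\<close>

lemma connection_form_gauge: "connection_form \<kappa> full_tangent UNIV (gauge A \<psi>)"
  unfolding connection_form_def
proof (intro conjI ballI allI impI)
  show "clinear_map (gauge A \<psi> p)" for p by (rule gauge_linear)
  fix V X assume VX: "openin (top_of_set UNIV) V \<and> holo_vf V X"
  then have V: "open V" and X: "holo_vf V X" by simp_all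
  have psiV: "holo_fun \<kappa> V \<psi>" using psi(1) by (simp add: holo_fun_def)
  show "holo_fun \<kappa> V (\<lambda>y. gauge A \<psi> y (X y))"
    unfolding holo_fun_def
  proof
    fix p assume p: "p \<in> V"
    show "cdiff_at \<kappa> p (\<lambda>y. gauge A \<psi> y (X y))"
    proof (rule cdiff_matrix_system[OF centred _ _ nbhdI[OF V p] _ p])
      show "cdiff_at \<kappa> p \<psi>" using psi(1) by (simp add: holo_fun_def)
      then show "cdiff_at \<kappa> p (\<lambda>y. dir \<kappa> \<psi> y (X y) + A y (X y) ** \<psi> y)"
        using holo_fun_dir[OF V psiV X] conn_holo[OF A V X] p
        by (intro cdiff_add cdiff_matrix_mult[OF centred]) (simp_all add: holo_fun_def)
    qed (simp add: psi gauge_mult)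
  qed
qed

lemma gauge_flat:
  assumes V: "open V" "p \<in> V" and X: "holo_vf V X" and Y: "holo_vf V Y"
    and flat: "curvature \<kappa> A X Y p = 0"
  shows "curvature \<kappa> (gauge A \<psi>) X Y p = 0"
proof -
  have psiV: "holo_fun \<kappa> V \<psi>" using psi(1) by (simp add: holo_fun_def)
  have c: "cdiff_at \<kappa> p (\<lambda>y. gauge A \<psi> y (Z y))" if "holo_vf V Z" for Z
    using conn_holo[OF connection_form_gauge V(1) that] V(2) by (simp add: holo_fun_def)
  have "\<psi> p ** curvature \<kappa> (gauge A \<psi>) X Y p = curvature \<kappa> A X Y p ** \<psi> p"
    unfolding curvature_def[of \<kappa> "gauge A \<psi>"]
    by (rule curvature_gauge[where cX = "\<lambda>y. gauge A \<psi> y (X y)" and cY = "\<lambda>y. gauge A \<psi> y (Y y)"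
          and cZ = "gauge A \<psi> p (bracket \<kappa> X Y p)", OF A V psiV X Y c[OF X] gauge_mult c[OF Y] gauge_mult gauge_mult])
  then have "matrix_inv (\<psi> p) ** (\<psi> p ** curvature \<kappa> (gauge A \<psi>) X Y p) = 0"
    by (simp add: flat matrix_mult_simps)
  then show ?thesis unfolding matrix_mul_assoc matrix_inv_mult(2)[OF psi(2)] by simp
qed

end

text \<open>The curvature on \<open>X\<close>, \<open>Y\<close> sees a potential only through its
  values on \<open>X\<close> and \<open>Y\<close> near \<open>p\<close> and on the bracket at
  \<open>p\<close>. Connections that agree on an involutive distribution therefore have the same
  curvature along it.\<close>

lemma curvature_eq_of_agree:
  fixes A B :: "'a \<Rightarrow> complex^'m \<Rightarrow> complex^'r::finite^'r"
  assumes B: "connection_form \<kappa> full_tangent UNIV B"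
    and V: "open V" "p \<in> V" and X: "holo_vf V X" and Y: "holo_vf V Y"
    and eq: "\<And>y. y \<in> V \<Longrightarrow> A y (X y) = B y (X y)" "\<And>y. y \<in> V \<Longrightarrow> A y (Y y) = B y (Y y)"
      "A p (bracket \<kappa> X Y p) = B p (bracket \<kappa> X Y p)"
  shows "curvature \<kappa> A X Y p = curvature \<kappa> B X Y p"
proof -
  have c: "cdiff_at \<kappa> p (\<lambda>y. B y (Z y))" if "holo_vf V Z" for Z
    using conn_holo[OF B V(1) that] V(2) by (simp add: holo_fun_def)
  have "dir \<kappa> (\<lambda>q. A q (X q)) p = dir \<kappa> (\<lambda>q. B q (X q)) p" "dir \<kappa> (\<lambda>q. A q (Y q)) p = dir \<kappa> (\<lambda>q. B q (Y q)) p"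
    by (rule dir_local[OF c V], rule X Y, simp add: eq)+
  then show ?thesis unfolding curvature_def by (simp add: eq V(2))
qed

end

lemma covariant_derivativeD:
  assumes N: "covariant_derivative \<kappa> Sec N" and s: "open U" "Sec U s" and x: "x \<in> U"
  shows covariant_derivative_add: "Sec U s' \<Longrightarrow> N (\<lambda>y. s y + s' y) x v = N s x v + N s' x v"
    and covariant_derivative_scale: "holo_fun \<kappa> U f \<Longrightarrow> N (\<lambda>y. f y *\<^sub>C s y) x v = dir \<kappa> f x v *\<^sub>C s x + f x *\<^sub>C N s x v"
proof -
  note * = N[unfolded covariant_derivative_def, THEN spec, THEN spec, THEN mp, OF conjI[OF s]]
  show "Sec U s' \<Longrightarrow> N (\<lambda>y. s y + s' y) x v = N s x v + N s' x v"
    by (rule *[THEN conjunct2, THEN conjunct1, rule_format, OF _ x])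
  show "holo_fun \<kappa> U f \<Longrightarrow> N (\<lambda>y. f y *\<^sub>C s y) x v = dir \<kappa> f x v *\<^sub>C s x + f x *\<^sub>C N s x v"
    by (rule *[THEN conjunct2, THEN conjunct2, THEN conjunct2, THEN conjunct1, rule_format, OF _ x])
qed

section \<open>Parallel spinors on a Grassmann manifold\<close>

locale grassmann_frame =
  fixes G :: "('x::{t2_space, second_countable_topology}, 'm::finite, 'p::finite) grassmann"
    and h :: "2 \<Rightarrow> 'x \<Rightarrow> complex ^ 2"
  assumes half_flat: "half_flat_grassmann G"
    and frame: "parallel_symplectic_frame G h"
begin

sublocale cmanifold "atl G"
  by unfold_locales (use half_flat in \<open>simp add: half_flat_grassmann_def\<close>)

abbreviation "sol \<equiv> soldering G"

lemma soldering: "clinear_map (sol x)" "bij (sol x)"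
  using half_flat unfolding half_flat_grassmann_def soldering_iso_def by blast+

definition spinor :: "complex^2 \<Rightarrow> 'x \<Rightarrow> complex^2" where
  "spinor a y = a $ 1 *\<^sub>C h 1 y + a $ 2 *\<^sub>C h 2 y"

text \<open>By \<open>XSH_eq\<close> the fields X_+++, X_+, X_-, X_--- restrict to such fields on a
  slice of constant \<open>u\<close>; the spinors then have constant coefficients in the frame
  \<open>h\<close> and are parallel.\<close>

definition cube_field :: "('x \<Rightarrow> complex^'p) \<Rightarrow> complex^2 \<Rightarrow> complex^2 \<Rightarrow> complex^2 \<Rightarrow> 'x \<Rightarrow> complex^'m" where
  "cube_field e a b c y = cube (sol y) (e y) (spinor a y) (spinor b y) (spinor c y)"

lemma spinor_axis: "spinor (axis \<alpha> 1) = h \<alpha>"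
  using exhaust_2[of \<alpha>] by (auto simp: spinor_def axis_def fun_eq_iff)

lemma Xfield_eq: "Xfield G h e \<alpha> \<beta> \<gamma> y = cube (sol y) (e y) (h \<alpha> y) (h \<beta> y) (h \<gamma> y)"
  by (simp add: Xfield_def cube_def)

lemma cube_field_sum:
  "cube_field e a b c x = (\<Sum>\<alpha>\<in>UNIV. \<Sum>\<beta>\<in>UNIV. \<Sum>\<gamma>\<in>UNIV. (a $ \<alpha> * b $ \<beta> * c $ \<gamma>) *\<^sub>C Xfield G h e \<alpha> \<beta> \<gamma> x)"
  unfolding cube_field_def spinor_def cube_linear[OF soldering] Xfield_eq sum_2
  by (simp add: vec_eq_iff scaleC_complex_def algebra_simps)

lemma XSH_eq: "XSH G h a b c e (x, u) = (cube_field e (a u) (b u) (c u) x, 0)"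
  unfolding XSH_def hlift_def sum_2 cube_field_sum by (simp add: scaleC_Pair zero_prod_def)

lemma omega_frame: "omegaH G x (h \<alpha> x) (h \<beta> x) = eps (axis \<alpha> 1) (axis \<beta> 1)"
proof -
  have sk: "omegaH G x f g = - omegaH G x g f" for f g
    using half_flat unfolding half_flat_grassmann_def symplectic_form_def by blast
  have 0: "omegaH G x f f = 0" for f using sk[of f f] by simp
  have 12: "omegaH G x (h 1 x) (h 2 x) = 1" using frame unfolding parallel_symplectic_frame_def by blast
  then have 21: "omegaH G x (h 2 x) (h 1 x) = - 1" using sk[of "h 2 x" "h 1 x"] by simp
  show ?thesis using exhaust_2[of \<alpha>] exhaust_2[of \<beta>] by (auto simp: 0 12 21 eps_def axis_def)
qed

text \<open>\<open>eps\<close> refers to the chosen identification of the fibre with pairs of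
  numbers, not to the symplectic form. But any alternating form in two dimensions is a multiple of
  \<open>eps\<close>, so a zero here would contradict the normalisation of the frame.\<close>

lemma eps_frame: "eps (h 1 x) (h 2 x) \<noteq> 0"
proof
  assume 0: "eps (h 1 x) (h 2 x) = 0"
  have sk: "omegaH G x f g = - omegaH G x g f" for f g
    using half_flat unfolding half_flat_grassmann_def symplectic_form_def by blast
  have z: "omegaH G x f f = 0" for f using sk[of f f] by simp
  have lin: "clinear_map (omegaH G x f)" for f
    using half_flat unfolding half_flat_grassmann_def symplectic_form_def by blast
  have lin2: "omegaH G x (f + f') g = omegaH G x f g + omegaH G x f' g" "omegaH G x (c *\<^sub>C f) g = c *\<^sub>C omegaH G x f g" for f f' g c
    using clinear_map_simps(1)[OF lin[of g], of f f'] clinear_map_simps(2)[OF lin[of g], of c f]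
      sk[of f g] sk[of f' g] sk[of "f + f'" g] sk[of "c *\<^sub>C f" g] by (simp_all add: scaleC_complex_def)
  have exp: "f = f $ 1 *\<^sub>C axis 1 1 + f $ 2 *\<^sub>C axis 2 1" for f :: "complex^2"
    by (simp add: vec_eq_iff forall_2 axis_def scaleC_complex_def)
  have det: "omegaH G x f g = eps f g * omegaH G x (axis 1 1) (axis 2 1)" for f g
    by (subst exp[of f], subst exp[of g])
       (simp add: lin2 clinear_map_simps[OF lin] z sk[of "axis 2 1" "axis 1 1"] scaleC_complex_def eps_def algebra_simps)
  have "omegaH G x (h 1 x) (h 2 x) = 0" by (subst det) (simp add: 0)
  then show False using frame unfolding parallel_symplectic_frame_def by simp
qed

lemma eps_spinor: "eps (spinor a x) (spinor b x) = eps a b * eps (h 1 x) (h 2 x)"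
  unfolding spinor_def by (simp add: eps_simps eps_swap[of "h 2 x" "h 1 x"]) (simp add: eps_def algebra_simps)

lemma secH_spinor: "secH G U (spinor a)"
proof -
  have h: "cdiff_at (atl G) x (\<lambda>y. snd (bunH G x) y *v h \<alpha> y)" for \<alpha> x
    using frame unfolding parallel_symplectic_frame_def holo_section_def by blast
  have "cdiff_at (atl G) x (\<lambda>y. a $ 1 *\<^sub>C (snd (bunH G x) y *v h 1 y) + a $ 2 *\<^sub>C (snd (bunH G x) y *v h 2 y))" for x
    by (intro cdiff_add cdiff_clinear[OF clinear_map_scaleC(1)] h)
  then show ?thesis
    unfolding holo_section_def spinor_def by (simp add: clinear_map_simps[OF clinear_map_matrix_mult(3)])
qed

lemma covH: "covariant_derivative (atl G) (secH G) (nablaH G)"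
  using half_flat unfolding half_flat_grassmann_def by blast

lemma nablaH_scale_h: "nablaH G (\<lambda>y. c *\<^sub>C h \<alpha> y) x v = 0"
proof -
  have sec: "secH G UNIV (h \<alpha>)" and par: "nablaH G (h \<alpha>) x v = 0"
    using frame unfolding parallel_symplectic_frame_def by blast+
  have hol: "holo_fun (atl G) UNIV (\<lambda>y. c)" by (simp add: holo_fun_def cdiff_const)
  have "nablaH G (\<lambda>y. c *\<^sub>C h \<alpha> y) x v = dir (atl G) (\<lambda>y. c) x v *\<^sub>C h \<alpha> x + c *\<^sub>C nablaH G (h \<alpha>) x v"
    by (rule covariant_derivative_scale[where s = "h \<alpha>" and f = "\<lambda>y. c", OF covH open_UNIV sec UNIV_I hol])
  then show ?thesis by (simp add: par dir_eq[OF cder_const])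
qed

lemma nablaH_spinor: "nablaH G (spinor a) x v = 0"
proof -
  have sec: "secH G UNIV (\<lambda>y. c *\<^sub>C h \<alpha> y)" for c \<alpha>
  proof -
    have "(\<lambda>y. c *\<^sub>C h \<alpha> y) = spinor (c *\<^sub>C axis \<alpha> 1)"
      using exhaust_2[of \<alpha>] by (auto simp: spinor_def axis_def fun_eq_iff scaleC_complex_def)
    then show ?thesis using secH_spinor by simp
  qed
  have "nablaH G (\<lambda>y. a $ 1 *\<^sub>C h 1 y + a $ 2 *\<^sub>C h 2 y) x v = nablaH G (\<lambda>y. a $ 1 *\<^sub>C h 1 y) x v + nablaH G (\<lambda>y. a $ 2 *\<^sub>C h 2 y) x v"
    by (rule covariant_derivative_add[where s = "\<lambda>y. a $ 1 *\<^sub>C h 1 y" and s' = "\<lambda>y. a $ 2 *\<^sub>C h 2 y",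
          OF covH open_UNIV sec UNIV_I sec])
  then show ?thesis unfolding spinor_def[abs_def] by (simp add: nablaH_scale_h)
qed

lemma secT_cube_field:
  assumes "open U" "secE G U e"
  shows "secT G U (cube_field e a b c)"
proof -
  have "soldering_iso G" using half_flat unfolding half_flat_grassmann_def by blast
  from this[unfolded soldering_iso_def, THEN conjunct2, rule_format, of U e "spinor a" "spinor b" "spinor c"]
  show ?thesis using assms secH_spinor unfolding cube_field_def[abs_def] cube_def by simp
qed

text \<open>The spinors are parallel, so only \<open>e\<close> is differentiated; covariant
  derivatives of such a field therefore stay in every distribution given by the same
  spinors.\<close>

lemma nablaT_cube_field:
  assumes "open U" "secE G U e" "x \<in> U"
  shows "nablaT G (cube_field e a b c) x v = cube_field (\<lambda>_. nablaE G e x v) a b c x"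
proof -
  have 0: "sym3 0 g k = 0" "sym3 g 0 k = 0" "sym3 g k 0 = 0" for g k
    by (simp_all add: vec_eq_iff forall_4)
  have t0: "tensor e' 0 = 0" for e' :: "complex^'p" by (simp add: vec_eq_iff)
  have "nablaT G (cube_field e a b c) x v = sol x (tensor (nablaE G e x v) (sym3 (spinor a x) (spinor b x) (spinor c x)) +
             tensor (e x) (sym3 (nablaH G (spinor a) x v) (spinor b x) (spinor c x) + sym3 (spinor a x) (nablaH G (spinor b) x v) (spinor c x) +
                           sym3 (spinor a x) (spinor b x) (nablaH G (spinor c) x v)))"
  proof -
    have "grassmann_connection G" using half_flat unfolding half_flat_grassmann_def by blast
    from this[unfolded grassmann_connection_def, THEN conjunct2, rule_format, of U e "spinor a" "spinor b" "spinor c" x v]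
    show ?thesis using assms secH_spinor unfolding cube_field_def[abs_def] cube_def by simp
  qed
  then show ?thesis unfolding nablaH_spinor cube_field_def cube_def by (simp add: 0 t0 del: sym3_nth)
qed

text \<open>The fibre of D^1_(+) at \<open>(x, (a, b))\<close>, brought down to the tangent space of
  \<open>M\<close>; with \<open>a\<close>, \<open>b\<close> held fixed it is a distribution on
  \<open>M\<close>.\<close>

definition dist :: "complex^2 \<Rightarrow> complex^2 \<Rightarrow> 'x \<Rightarrow> (complex^'m) set" where
  "dist a b x = {cube_field (\<lambda>_. e) a a a x + cube_field (\<lambda>_. e') a a b x | e e'. True}"

lemma dist1_iff: "hlift v \<in> dist1 G h up um (x, u) \<longleftrightarrow> v \<in> dist (up u) (um u) x"
  unfolding dist1_def dist_def hlift_def XSH_eq by (auto simp: prod_eq_iff)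

lemma cube_field_dist: "cube_field e a a a x \<in> dist a b x" "cube_field e a a b x \<in> dist a b x"
proof -
  have z: "cube_field (\<lambda>_. 0) a b c x = 0" for a b c
    unfolding cube_field_def using clinear_map_simps(3)[OF clinear_map_cube[OF soldering]] .
  have c: "cube_field (\<lambda>_. e x) a b c x = cube_field e a b c x" for a b c by (simp add: cube_field_def)
  show "cube_field e a a a x \<in> dist a b x"
    unfolding dist_def mem_Collect_eq by (rule exI[of _ "e x"], rule exI[of _ 0]) (simp add: z c)
  show "cube_field e a a b x \<in> dist a b x"
    unfolding dist_def mem_Collect_eq by (rule exI[of _ 0], rule exI[of _ "e x"]) (simp add: z c)
qed

lemma dist_diff:
  assumes "v \<in> dist a b x" "w \<in> dist a b x"
  shows "v - w \<in> dist a b x"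
proof -
  obtain e e' where v: "v = cube_field (\<lambda>_. e) a a a x + cube_field (\<lambda>_. e') a a b x"
    using assms(1) unfolding dist_def by auto
  obtain d d' where w: "w = cube_field (\<lambda>_. d) a a a x + cube_field (\<lambda>_. d') a a b x"
    using assms(2) unfolding dist_def by auto
  have "v - w = cube_field (\<lambda>_. e - d) a a a x + cube_field (\<lambda>_. e' - d') a a b x"
    unfolding v w cube_field_def by (simp add: clinear_map_simps(5)[OF clinear_map_cube[OF soldering]])
  then show ?thesis unfolding dist_def by auto
qed

text \<open>The bracket is a difference of two covariant derivatives minus the torsion. The
  derivatives stay in the distribution by \<open>nablaT_cube_field\<close>, the torsion by
  admissibility.\<close>

lemma bracket_dist:
  assumes adm: "one_admissible G h" and ab: "eps a b = 1"
    and U: "open U" "x \<in> U" and e: "secE G U e" "secE G U e'"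
    and X: "X = cube_field e a a a \<or> X = cube_field e a a b"
    and Y: "Y = cube_field e' a a a \<or> Y = cube_field e' a a b"
  shows "bracket (atl G) X Y x \<in> dist a b x"
proof -
  have u: "(a, b) \<in> Sp1C" using ab by (simp add: Sp1C_def)
  have sX: "secT G U X" and sY: "secT G U Y" using X Y secT_cube_field[OF U(1)] e by auto
  have iX: "X x \<in> dist a b x" and iY: "Y x \<in> dist a b x" using X Y cube_field_dist by auto
  have "hlift (torsion G X Y x) \<in> dist1 G h up um (x, (a, b))"
  proof -
    have "\<forall>U X Y. open U \<and> secT G U X \<and> secT G U Y \<longrightarrow>
        (\<forall>x\<in>U. \<forall>u\<in>Sp1C. hlift (X x) \<in> dist1 G h up um (x, u) \<and> hlift (Y x) \<in> dist1 G h up um (x, u) \<longrightarrow>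
           hlift (torsion G X Y x) \<in> dist1 G h up um (x, u))"
      using adm unfolding one_admissible_def signs_def by simp
    from bspec[OF bspec[OF mp[OF this[THEN spec[of _ U], THEN spec[of _ X], THEN spec[of _ Y]] conjI[OF U(1) conjI[OF sX sY]]] U(2)] u]
    show ?thesis using iX iY by (simp add: dist1_iff)
  qed
  then have T: "torsion G X Y x \<in> dist a b x" by (simp add: dist1_iff)
  have N: "nablaT G Z x v \<in> dist a b x" if "secE G U d" "Z = cube_field d a a a \<or> Z = cube_field d a a b" for Z d v
    using that(2) by (elim disjE) (simp_all add: nablaT_cube_field[OF U(1) that(1) U(2)] cube_field_dist)
  have "bracket (atl G) X Y x = nablaT G Y x (X x) - nablaT G X x (Y x) - torsion G X Y x"
    unfolding torsion_def by simp
  then show ?thesis using dist_diff[OF dist_diff[OF N[OF e(2) Y] N[OF e(1) X]] T] by simp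
qed

text \<open>The section with constant components in the trivialisation around \<open>x\<close>. A
  constant function will not do, since the identification of the fibres with a fixed space has no
  regularity in the base point.\<close>

definition E_section :: "'x \<Rightarrow> complex^'p \<Rightarrow> 'x \<Rightarrow> complex^'p" where
  "E_section x w y = matrix_inv (snd (bunE G x) y) *v w"

abbreviation "E_dom x \<equiv> fst (bunE G x)"

lemma vector_bundle_E: "vector_bundle (atl G) (bunE G)"
  using half_flat unfolding half_flat_grassmann_def by blast

lemma E_dom: "open (E_dom x)" "x \<in> E_dom x" "y \<in> E_dom x \<Longrightarrow> invertible (snd (bunE G x) y)"
  using vector_bundle_E unfolding vector_bundle_def by blast+

lemma secE_E_section: "secE G (E_dom x) (E_section x w)"
  unfolding holo_section_def
proof
  fix x' assume x': "x' \<in> E_dom x"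
  have "holo_fun (atl G) (E_dom x \<inter> E_dom x') (\<lambda>y. snd (bunE G x') y ** matrix_inv (snd (bunE G x) y))"
    using vector_bundle_E unfolding vector_bundle_def by blast
  then have "cdiff_at (atl G) x' (\<lambda>y. snd (bunE G x') y ** matrix_inv (snd (bunE G x) y))"
    using x' E_dom(2)[of x'] unfolding holo_fun_def by blast
  from cdiff_matrix_vec[OF centred this cdiff_const[of _ _ w]]
  show "cdiff_at (atl G) x' (\<lambda>y. snd (bunE G x') y *v E_section x w y)"
    unfolding E_section_def matrix_vector_mul_assoc .
qed

lemma E_section_self: "E_section x (snd (bunE G x) x *v w) x = w"
  unfolding E_section_def by (simp add: matrix_vector_mul_assoc matrix_inv_mult(2)[OF E_dom(3)[OF E_dom(2)]])

lemma Xfield_cube_field: "Xfield G h e \<alpha> \<beta> \<gamma> = cube_field e (axis \<alpha> 1) (axis \<beta> 1) (axis \<gamma> 1)"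
  by (simp add: fun_eq_iff cube_field_def Xfield_eq spinor_axis)

section \<open>Restriction of the fields on \<open>S_H\<close> to slices\<close>

lemma holo_field_XSH:
  assumes s: "s \<in> {up, um}" "t \<in> {up, um}" "r \<in> {up, um}" and U: "open U" and e: "secE G U e"
  shows "holo_field \<sigma> SH_tangent (U \<times> Sp1C) (XSH G h s t r e)"
proof (rule holo_field_horizontal[OF _ _ U])
  show "snd (XSH G h s t r e q) = 0" for q by (cases q) (simp add: XSH_eq)
next
  fix x u assume x: "x \<in> U" and u: "u \<in> Sp1C"
  have co: "cdiff_at \<sigma> (x, u) (\<lambda>q. f (snd q) $ \<alpha>)" if "f \<in> {up, um}" for f \<alpha>
    using that cdiff_vec_nth[OF cdiff_prod_sel(1)[OF cdiff_atI[OF cder_snd[OF u]]]]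
      cdiff_vec_nth[OF cdiff_prod_sel(2)[OF cdiff_atI[OF cder_snd[OF u]]]] by auto
  have X: "cdiff_at \<sigma> (x, u) (\<lambda>q. field_comp (atl G) x (Xfield G h e \<alpha> \<beta> \<gamma>) (fst q))" for \<alpha> \<beta> \<gamma>
    unfolding Xfield_cube_field by (rule cdiff_fst[OF u holo_fieldD[OF secT_cube_field[OF U e] x]])
  have "cdiff_at \<sigma> (x, u) (\<lambda>q. \<Sum>\<alpha>\<in>UNIV. \<Sum>\<beta>\<in>UNIV. \<Sum>\<gamma>\<in>UNIV. (s (snd q) $ \<alpha> * t (snd q) $ \<beta> * r (snd q) $ \<gamma>) *\<^sub>C
      field_comp (atl G) x (Xfield G h e \<alpha> \<beta> \<gamma>) (fst q))"
    by (intro cdiff_sum cdiff_scaleC[OF SH_centred[OF u]] cdiff_mult[OF SH_centred[OF u]] co X s)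
  then show "cdiff_at \<sigma> (x, u) (\<lambda>q. dir (atl G) (chart_map (atl G) x) (fst q) (fst (XSH G h s t r e q)))"
  proof (rule cdiff_at_cong[OF SH_centred[OF u] SH_nbhd[OF openin_SH_Times[OF U]], rotated 2])
    show "(x, u) \<in> U \<times> Sp1C" using x u by simp
    fix q assume q: "q \<in> U \<times> Sp1C \<inter> chart_dom (atl G) x \<times> Sp1C"
    have lin: "clinear_map (dir (atl G) (chart_map (atl G) x) (fst q))"
      using q by (intro clinear_dir cdiff_chart_map) auto
    have "fst (XSH G h s t r e q) = cube_field e (s (snd q)) (t (snd q)) (r (snd q)) (fst q)"
      by (cases q) (simp add: XSH_eq)
    then show "(\<Sum>\<alpha>\<in>UNIV. \<Sum>\<beta>\<in>UNIV. \<Sum>\<gamma>\<in>UNIV. (s (snd q) $ \<alpha> * t (snd q) $ \<beta> * r (snd q) $ \<gamma>) *\<^sub>C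
      field_comp (atl G) x (Xfield G h e \<alpha> \<beta> \<gamma>) (fst q)) = dir (atl G) (chart_map (atl G) x) (fst q) (fst (XSH G h s t r e q))"
      by (simp add: cube_field_sum clinear_map_simps[OF lin] field_comp_def)
  qed
qed

lemma curvature_XSH_slice:
  assumes s: "s1 \<in> {up, um}" "s2 \<in> {up, um}" "s3 \<in> {up, um}" "t1 \<in> {up, um}" "t2 \<in> {up, um}" "t3 \<in> {up, um}"
    and U: "open U" "x \<in> U" and e: "secE G U e" "secE G U e'" and u: "u \<in> Sp1C"
    and B: "connection_form \<sigma> SH_tangent SH B"
  shows "curvature \<sigma> B (XSH G h s1 s2 s3 e) (XSH G h t1 t2 t3 e') (x, u)
    = curvature (atl G) (\<lambda>y v. B (y, u) (v, 0)) (cube_field e (s1 u) (s2 u) (s3 u)) (cube_field e' (t1 u) (t2 u) (t3 u)) x"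
proof -
  note X = holo_field_XSH[OF s(1-3) U(1) e(1)] and Y = holo_field_XSH[OF s(4-6) U(1) e(2)]
  have hor: "snd (XSH G h a b c e q) = 0" for a b c e q by (cases q) (simp add: XSH_eq)
  have "cdiff_at \<sigma> (x, u) (\<lambda>q. B q (Z q))" if "holo_field \<sigma> SH_tangent (U \<times> Sp1C) Z" for Z
    using B openin_SH_Times[OF U(1)] that U(2) u unfolding connection_form_def holo_fun_def by blast
  from curvature_slice[where B = B, OF u U X hor Y hor this[OF X] this[OF Y]]
  show ?thesis by (simp add: XSH_eq)
qed

end

section \<open>The potential in the central frame\<close>

locale grassmann_potential = grassmann_frame G h
  for G :: "('x::{t2_space, second_countable_topology}, 'm::finite, 'p::finite) grassmann"
    and h :: "2 \<Rightarrow> 'x \<Rightarrow> complex ^ 2" +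
  fixes A :: "'x \<times> spinor_pair \<Rightarrow> (complex ^ 'm) \<times> spinor_pair \<Rightarrow> complex ^ 'r::finite ^ 'r"
    and \<psi> :: "'x \<times> spinor_pair \<Rightarrow> complex ^ 'r ^ 'r"
    and C :: "'x \<Rightarrow> complex ^ 'p \<Rightarrow> 2 \<Rightarrow> 2 \<Rightarrow> 2 \<Rightarrow> complex ^ 'r ^ 'r"
  assumes admissible: "one_admissible G h"
    and connection: "connection_form \<sigma> SH_tangent SH A"
    and almost_flat: "almost_one_partially_flat G h A"
    and central: "central_frame G A \<psi>"
    and symmetric: "\<And>x e \<alpha> \<beta> \<gamma>. C x e \<alpha> \<beta> \<gamma> = C x e \<beta> \<alpha> \<gamma> \<and> C x e \<alpha> \<beta> \<gamma> = C x e \<alpha> \<gamma> \<beta>"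
    and potential_3: "\<And>p e. p \<in> SH \<Longrightarrow>
      potential G A \<psi> p (XSH G h up up up (\<lambda>_. e) p) = CSH C up up up e p"
    and potential_1: "\<And>p e. p \<in> SH \<Longrightarrow>
      potential G A \<psi> p (XSH G h up up um (\<lambda>_. e) p) = CSH C up up um e p"
begin

definition contract :: "'x \<Rightarrow> complex^'p \<Rightarrow> complex^2 \<Rightarrow> complex^2 \<Rightarrow> complex^2 \<Rightarrow> complex^'r^'r" where
  "contract y e a b c = (\<Sum>\<alpha>\<in>UNIV. \<Sum>\<beta>\<in>UNIV. \<Sum>\<gamma>\<in>UNIV. (a $ \<alpha> * b $ \<beta> * c $ \<gamma>) *\<^sub>C C y e \<alpha> \<beta> \<gamma>)"

lemma CSH_eq: "CSH C a b c e (x, u) = contract x e (a u) (b u) (c u)"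
  by (simp add: CSH_def contract_def)

text \<open>The given connection restricted to the slice at \<open>u\<close>, in the central frame.
  For each \<open>u\<close> it is a connection over \<open>M\<close>, so that linearity, holomorphy
  and gauge invariance of flatness are available for it.\<close>

definition slice_potential :: "spinor_pair \<Rightarrow> 'x \<Rightarrow> complex^'m \<Rightarrow> complex^'r^'r" where
  "slice_potential u = gauge (\<lambda>y v. A (y, u) (v, 0)) (\<lambda>y. \<psi> (y, u))"

context
  fixes u assumes u: "u \<in> Sp1C"
begin

lemma psi_slice: "holo_fun (atl G) UNIV (\<lambda>y. \<psi> (y, u))" "invertible (\<psi> (y, u))"
  using central u cdiff_slice[OF u, of _ \<psi>] unfolding central_frame_def holo_fun_def SH_def by auto

lemma slice_potential: "connection_form (atl G) full_tangent UNIV (slice_potential u)"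
  unfolding slice_potential_def
  by (rule connection_form_gauge[OF connection_form_slice[OF u connection] psi_slice])

lemma potential_slice: "potential G A \<psi> (x, u) (v, 0) = slice_potential u x v"
proof -
  have "cdiff_at \<sigma> (x, u) \<psi>" using central u unfolding central_frame_def holo_fun_def SH_def by auto
  then show ?thesis unfolding potential_def slice_potential_def gauge_def by (simp add: dir_slice[OF u])
qed

lemma slice_potential_cube:
  "slice_potential u y (cube_field e (up u) (up u) (up u) y) = contract y (e y) (up u) (up u) (up u)"
  "slice_potential u y (cube_field e (up u) (up u) (um u) y) = contract y (e y) (up u) (up u) (um u)"
proof -
  have c: "cube_field e a b c y = cube_field (\<lambda>_. e y) a b c y" for a b c by (simp add: cube_field_def)
  have p: "(y, u) \<in> SH" using u by (simp add: SH_def)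
  show "slice_potential u y (cube_field e (up u) (up u) (up u) y) = contract y (e y) (up u) (up u) (up u)"
    using potential_3[OF p, of "e y"] unfolding XSH_eq CSH_eq potential_slice c[symmetric] .
  show "slice_potential u y (cube_field e (up u) (up u) (um u) y) = contract y (e y) (up u) (up u) (um u)"
    using potential_1[OF p, of "e y"] unfolding XSH_eq CSH_eq potential_slice c[symmetric] .
qed

end

text \<open>The contraction is the value of a slice potential on the cube of a fixed spinor, and
  inherits linearity in \<open>e\<close> from it. A companion spinor \<open>b\<close> makes
  \<open>a\<close> the first component of a point of \<open>Sp1C\<close>.\<close>

lemma contract_diagonal_linear:
  assumes "eps a b = 1"
  shows "clinear_map (\<lambda>e. contract y e a a a)"
proof -
  have u: "(a, b) \<in> Sp1C" using assms by (simp add: Sp1C_def)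
  have "contract y e a a a = slice_potential (a, b) y (cube (sol y) e (spinor a y) (spinor a y) (spinor a y))" for e
    using slice_potential_cube(1)[OF u, of y "\<lambda>_. e"] by (simp add: cube_field_def)
  then show ?thesis
    using clinear_map_compose[OF conn_linear[OF slice_potential[OF u]] clinear_map_cube[OF soldering]] by simp
qed

lemma contract_diagonal_holo:
  assumes "eps a b = 1" "open U" "x \<in> U" "secE G U e"
  shows "cdiff_at (atl G) x (\<lambda>y. contract y (e y) a a a)"
proof -
  have u: "(a, b) \<in> Sp1C" using assms by (simp add: Sp1C_def)
  show ?thesis
    using conn_holo[OF slice_potential[OF u] assms(2) secT_cube_field[OF assms(2,4), of a a a]] assms(3)
      slice_potential_cube(1)[OF u, of _ e] by (simp add: holo_fun_def)
qed

text \<open>Four spinors at which the cubic form \<open>C\<close> is sampled. The first two give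
  C_111 and C_222; the difference and the sum of the values at (1, 1) and (1, -1) are 6 C_112 + 2
  C_222 and 6 C_221 + 2 C_111.\<close>

definition s10 :: "complex^2" where "s10 = vector [1, 0]"
definition s01 :: "complex^2" where "s01 = vector [0, 1]"
definition s11 :: "complex^2" where "s11 = vector [1, 1]"
definition s1m :: "complex^2" where "s1m = vector [1, - 1]"

text \<open>Each sample spinor is completed to a point of \<open>Sp1C\<close>, where the potential
  is known.\<close>

lemma eps_s: "eps s10 s01 = 1" "eps s01 (- s10) = 1" "eps s11 s01 = 1" "eps s1m s01 = 1"
  by (simp_all add: eps_def s10_def s01_def s11_def s1m_def)

lemma C_sym: "C x e 1 2 1 = C x e 1 1 2" "C x e 2 1 1 = C x e 1 1 2" "C x e 1 2 2 = C x e 2 2 1" "C x e 2 1 2 = C x e 2 2 1"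
  using symmetric by metis+

text \<open>Polarisation: the coefficients of the cubic form are recovered from its values at four points.\<close>

lemma C_polarise:
  "C y e 1 1 1 = contract y e s10 s10 s10" "C y e 2 2 2 = contract y e s01 s01 s01"
  "C y e 1 1 2 = (1 / 6) *\<^sub>C (contract y e s11 s11 s11 - contract y e s1m s1m s1m - 2 *\<^sub>C contract y e s01 s01 s01)"
  "C y e 2 2 1 = (1 / 6) *\<^sub>C (contract y e s11 s11 s11 + contract y e s1m s1m s1m - 2 *\<^sub>C contract y e s10 s10 s10)"
  unfolding contract_def sum_2 C_sym s10_def s01_def s11_def s1m_def
  by (simp_all add: vec_eq_iff scaleC_complex_def)

lemma clinear_map_add: "clinear_map f \<Longrightarrow> clinear_map g \<Longrightarrow> clinear_map (\<lambda>v. f v + g v)"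
  and clinear_map_diff: "clinear_map f \<Longrightarrow> clinear_map g \<Longrightarrow> clinear_map (\<lambda>v. f v - g v)"
  unfolding clinear_on_def by (simp_all add: scaleC_add_right scaleC.diff_right)

lemma C_linear: "clinear_map (\<lambda>e. C y e \<alpha> \<beta> \<gamma>)"
proof -
  note d = contract_diagonal_linear[OF eps_s(1)] contract_diagonal_linear[OF eps_s(2)]
    contract_diagonal_linear[OF eps_s(3)] contract_diagonal_linear[OF eps_s(4)]
  note c = clinear_map_compose[OF clinear_map_scaleC(1)]
  have "clinear_map (\<lambda>e. C y e 1 1 1)" "clinear_map (\<lambda>e. C y e 2 2 2)" "clinear_map (\<lambda>e. C y e 1 1 2)" "clinear_map (\<lambda>e. C y e 2 2 1)"
    unfolding C_polarise by (intro c clinear_map_add clinear_map_diff d)+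
  then show ?thesis using exhaust_2[of \<alpha>] exhaust_2[of \<beta>] exhaust_2[of \<gamma>] by (elim disjE) (simp_all add: C_sym)
qed

lemma C_holo:
  assumes "open U" "x \<in> U" "secE G U e"
  shows "cdiff_at (atl G) x (\<lambda>y. C y (e y) \<alpha> \<beta> \<gamma>)"
proof -
  note d = contract_diagonal_holo[OF eps_s(1) assms] contract_diagonal_holo[OF eps_s(2) assms]
    contract_diagonal_holo[OF eps_s(3) assms] contract_diagonal_holo[OF eps_s(4) assms]
  note c = cdiff_clinear[OF clinear_map_scaleC(1)]
  have "cdiff_at (atl G) x (\<lambda>y. C y (e y) 1 1 1)" "cdiff_at (atl G) x (\<lambda>y. C y (e y) 2 2 2)"
    "cdiff_at (atl G) x (\<lambda>y. C y (e y) 1 1 2)" "cdiff_at (atl G) x (\<lambda>y. C y (e y) 2 2 1)"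
    unfolding C_polarise by (intro c cdiff_add cdiff_diff d)+
  then show ?thesis using exhaust_2[of \<alpha>] exhaust_2[of \<beta>] exhaust_2[of \<gamma>] by (elim disjE) (simp_all add: C_sym)
qed

end

definition sel3 :: "'a \<Rightarrow> 'a \<Rightarrow> 'a \<Rightarrow> 3 \<Rightarrow> 'a" where
  "sel3 a b c i = (if i = 1 then a else if i = 2 then b else c)"

lemma sel3_simps [simp]: "sel3 a b c 1 = a" "sel3 a b c 2 = b" "sel3 a b c 3 = c"
  by (simp_all add: sel3_def)

section \<open>Existence and holomorphy of the connection over \<open>M\<close>\<close>

context grassmann_potential
begin

definition C_basis :: "'x \<Rightarrow> complex^'p \<Rightarrow> 4 \<Rightarrow> complex^'r^'r" where
  "C_basis y e k = (if k = 1 then C y e 1 1 1 else if k = 2 then C y e 1 1 2 else if k = 3 then C y e 2 2 1 else C y e 2 2 2)"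

abbreviation "tangent_iso y \<equiv> cubic_iso (sol y) (h 1 y) (h 2 y)"

lemma C_basis_linear: "clinear_map (\<lambda>e. C_basis y e k)"
  using exhaust_4[of k] C_linear by (elim disjE) (simp_all add: C_basis_def)

lemma C_basis_holo:
  assumes "open U" "x \<in> U" "secE G U e"
  shows "cdiff_at (atl G) x (\<lambda>y. C_basis y (e y) k)"
  using exhaust_4[of k] C_holo[OF assms] by (elim disjE) (simp_all add: C_basis_def)

text \<open>The four cubics of \<open>h 1\<close>, \<open>h 2\<close> identify the tangent space
  with four copies of the fibre of \<open>E*\<close>; on the copy of index \<open>k\<close> the
  potential is the corresponding coefficient \<open>C_basis\<close>. This is well posed because
  \<open>C\<close> has been shown linear in \<open>e\<close>.\<close>

definition base_form :: "'x \<Rightarrow> complex^'m \<Rightarrow> complex^'r^'r" where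
  "base_form y v = (\<Sum>k\<in>UNIV. C_basis y (\<chi> i. inv (tangent_iso y) v $ i $ k) k)"

lemma base_form_iso: "base_form y (tangent_iso y w) = (\<Sum>k\<in>UNIV. C_basis y (\<chi> i. w $ i $ k) k)"
  unfolding base_form_def inv_f_f[OF bij_is_inj[OF bij_cubic_iso[OF soldering eps_frame]]] ..

lemma base_form_linear: "clinear_map (base_form y)"
proof (rule clinear_onI)
  note lin = clinear_cubic_iso[OF soldering, of y "h 1 y" "h 2 y"]
  have ex: "\<exists>w. v = tangent_iso y w" for v
    using surjD[OF bij_is_surj[OF bij_cubic_iso[OF soldering eps_frame[of y]]]] by metis
  have col: "(\<chi> i. (a + b) $ i $ k) = (\<chi> i. a $ i $ k) + (\<chi> i. b $ i $ k)"
    "(\<chi> i. (c *\<^sub>C a) $ i $ k) = c *\<^sub>C (\<chi> i. a $ i $ k)" for a b :: "complex^4^'p" and c k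
    by (simp_all add: vec_eq_iff)
  fix v v' c
  obtain w w' where w: "v = tangent_iso y w" "v' = tangent_iso y w'" using ex by metis
  show "base_form y (v + v') = base_form y v + base_form y v'"
    unfolding w clinear_map_simps(1)[OF lin, symmetric] base_form_iso col
    by (simp add: clinear_map_simps[OF C_basis_linear] sum.distrib)
  show "base_form y (c *\<^sub>C v) = c *\<^sub>C base_form y v"
    unfolding w clinear_map_simps(2)[OF lin, symmetric] base_form_iso col
    by (simp add: clinear_map_simps[OF C_basis_linear] scaleC.sum_right)
qed

lemma tangent_iso_single:
  "tangent_iso y (\<chi> i. axis k (e $ i)) = L"
  if "L = (if k = 1 then cube (sol y) e (h 1 y) (h 1 y) (h 1 y) else if k = 2 then cube (sol y) e (h 1 y) (h 1 y) (h 2 y)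
     else if k = 3 then cube (sol y) e (h 2 y) (h 2 y) (h 1 y) else cube (sol y) e (h 2 y) (h 2 y) (h 2 y))"
proof -
  have 0: "cube (sol y) 0 a b c = 0" for a b c by (rule clinear_map_simps(3)[OF clinear_map_cube[OF soldering]])
  have z: "(\<chi> i. 0) = (0 :: complex^'p)" by (simp add: vec_eq_iff)
  show ?thesis
    unfolding that cubic_iso_eq[OF soldering] using exhaust_4[of k] by (elim disjE) (simp_all add: axis_def 0 z)
qed

lemma base_form_single: "base_form y (tangent_iso y (\<chi> i. axis k (e $ i))) = C_basis y e k"
proof -
  have "(\<chi> i. (\<chi> i. axis k (e $ i)) $ i $ l) = (if l = k then e else 0)" for l
    by (simp add: vec_eq_iff axis_def)
  moreover have "C_basis y 0 l = 0" for l by (rule clinear_map_simps(3)[OF C_basis_linear])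
  ultimately show ?thesis
    unfolding base_form_iso by (simp add: if_distrib[of "\<lambda>e. C_basis y e _"] cong: if_cong)
qed

lemma base_potential_base_form: "base_potential G h C base_form"
  unfolding base_potential_def
proof (intro allI conjI)
  show "clinear_map (base_form x)" for x by (rule base_form_linear)
  fix x e \<alpha> \<beta> \<gamma>
  have b: "base_form x (cube (sol x) e (h 1 x) (h 1 x) (h 1 x)) = C x e 1 1 1"
    "base_form x (cube (sol x) e (h 1 x) (h 1 x) (h 2 x)) = C x e 1 1 2"
    "base_form x (cube (sol x) e (h 2 x) (h 2 x) (h 1 x)) = C x e 2 2 1"
    "base_form x (cube (sol x) e (h 2 x) (h 2 x) (h 2 x)) = C x e 2 2 2"
    using base_form_single[of x 1 e] base_form_single[of x 2 e] base_form_single[of x 3 e] base_form_single[of x 4 e]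
    unfolding tangent_iso_single[OF refl] by (simp_all add: C_basis_def)
  have c: "cube (sol x) e (h 1 x) (h 2 x) (h 1 x) = cube (sol x) e (h 1 x) (h 1 x) (h 2 x)"
    "cube (sol x) e (h 2 x) (h 1 x) (h 1 x) = cube (sol x) e (h 1 x) (h 1 x) (h 2 x)"
    "cube (sol x) e (h 1 x) (h 2 x) (h 2 x) = cube (sol x) e (h 2 x) (h 2 x) (h 1 x)"
    "cube (sol x) e (h 2 x) (h 1 x) (h 2 x) = cube (sol x) e (h 2 x) (h 2 x) (h 1 x)"
    by (metis cube_commute[OF soldering])+
  show "base_form x (Xfield G h (\<lambda>_. e) \<alpha> \<beta> \<gamma> x) = C x e \<alpha> \<beta> \<gamma>"
    unfolding Xfield_eq using exhaust_2[of \<alpha>] exhaust_2[of \<beta>] exhaust_2[of \<gamma>]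
    by (elim disjE) (simp_all add: b c C_sym)
qed

context
  fixes AM assumes AM: "base_potential G h C AM"
begin

lemma base_linear: "clinear_map (AM x)"
  using AM unfolding base_potential_def by blast

lemma base_Xfield: "AM x (Xfield G h (\<lambda>_. e) \<alpha> \<beta> \<gamma> x) = C x e \<alpha> \<beta> \<gamma>"
  using AM unfolding base_potential_def by blast

lemma base_cube_field: "AM x (cube_field e a b c x) = contract x (e x) a b c"
proof -
  have "cube_field e a b c x = cube_field (\<lambda>_. e x) a b c x" by (simp add: cube_field_def)
  then show ?thesis
    unfolding contract_def cube_field_sum by (simp add: clinear_map_simps[OF base_linear] base_Xfield cube_field_sum)
qed

lemma base_iso: "AM y (tangent_iso y w) = (\<Sum>k\<in>UNIV. C_basis y (\<chi> i. w $ i $ k) k)"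
  using base_Xfield[of y _ 1 1 1] base_Xfield[of y _ 1 1 2] base_Xfield[of y _ 2 2 1] base_Xfield[of y _ 2 2 2]
  unfolding Xfield_eq cubic_iso_eq[OF soldering] sum_4 by (simp add: clinear_map_simps[OF base_linear] C_basis_def)

text \<open>A holomorphic field has holomorphic components in the local frame formed by sections of
  \<open>E*\<close> and cubics of \<open>h\<close>, being the solution of a linear system with
  holomorphic coefficients. The potential is then a sum of these components times the coefficients
  \<open>C\<close> on holomorphic sections.\<close>

lemma base_connection: "connection_form (atl G) full_tangent UNIV AM"
  unfolding connection_form_def
proof (intro conjI ballI allI impI)
  show "clinear_map (AM x)" for x by (rule base_linear)
  fix V X assume VX: "openin (top_of_set UNIV) V \<and> holo_field (atl G) full_tangent V X"
  then have V: "open V" and X: "holo_field (atl G) full_tangent V X" by simp_all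
  show "holo_fun (atl G) V (\<lambda>y. AM y (X y))"
    unfolding holo_fun_def
  proof
    fix x assume x: "x \<in> V"
    define W where "W = V \<inter> E_dom x \<inter> chart_dom (atl G) x"
    have W: "open W" "x \<in> W" unfolding W_def using V E_dom[of x] x open_dom by auto
    \<comment> \<open>\<open>M y\<close> passes from the local trivialisation to the fibre at
      \<open>y\<close>. The components of \<open>X y\<close> in the resulting frame are
      \<open>f y\<close>, and \<open>L y\<close> sends such components to those in the chart around
      \<open>x\<close>.\<close>
    define M where "M y = matrix_inv (snd (bunE G x) y)" for y
    define f where "f y = snd (bunE G x) y ** inv (tangent_iso y) (X y)" for y
    define L where "L y w = dir (atl G) (chart_map (atl G) x) y (tangent_iso y (M y ** w))" for y and w :: "complex^4^'p"
    have iso: "bij (tangent_iso y)" "clinear_map (tangent_iso y)" for y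
      using bij_cubic_iso[OF soldering eps_frame] clinear_cubic_iso[OF soldering] by blast+
    have M: "M y ** snd (bunE G x) y = mat 1" "snd (bunE G x) y ** M y = mat 1" if "y \<in> W" for y
      unfolding M_def using matrix_inv_mult[OF E_dom(3)] that by (auto simp: W_def)
    have Mf: "M y ** f y = inv (tangent_iso y) (X y)" if "y \<in> W" for y
      unfolding f_def matrix_mul_assoc M[OF that] by simp
    have col: "(\<chi> i. (M y ** w) $ i $ k) = E_section x (\<chi> i. w $ i $ k) y" for y and w :: "complex^4^'p" and k
      by (simp add: vec_eq_iff E_section_def M_def matrix_matrix_mult_def matrix_vector_mult_def)
    have f: "cdiff_at (atl G) x f"
    proof (rule cdiff_linear_map_system[OF centred _ _ nbhdI[OF W] W(2), of L])
      show "cdiff_at (atl G) x (field_comp (atl G) x X)" by (rule holo_fieldD[OF X x])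
      show "clinear_map (L y) \<and> bij (L y)" if y: "y \<in> W" for y
      proof
        have y': "y \<in> chart_dom (atl G) x" using y by (simp add: W_def)
        show "clinear_map (L y)"
          unfolding L_def by (rule clinear_map_compose[OF clinear_dir[OF cdiff_chart_map[OF y']]
              clinear_map_compose[OF iso(2) clinear_map_matrix_mult(1)]])
        have "bij (\<lambda>w :: complex^4^'p. M y ** w)"
          by (rule o_bij[of "\<lambda>w. snd (bunE G x) y ** w"]) (simp_all add: fun_eq_iff matrix_mul_assoc M[OF y])
        moreover have "bij (\<lambda>v. dir (atl G) (chart_map (atl G) x) y v)"
          by (rule o_bij[of "\<lambda>w. coord_field x w y"]) (simp_all add: fun_eq_iff y')
        ultimately have "bij ((\<lambda>v. dir (atl G) (chart_map (atl G) x) y v) \<circ> (tangent_iso y \<circ> (\<lambda>w. M y ** w)))"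
          using iso(1) by (intro bij_comp)
        then show "bij (L y)" unfolding L_def o_def .
      qed
      show "L y (f y) = field_comp (atl G) x X y" if "y \<in> W" for y
        unfolding L_def Mf[OF that] surj_f_inv_f[OF bij_is_surj[OF iso(1)]] field_comp_def ..
      show "cdiff_at (atl G) x (\<lambda>y. L y w)" for w
      proof -
        have L: "L y w = field_comp (atl G) x (cube_field (E_section x (\<chi> i. w $ i $ 1)) (axis 1 1) (axis 1 1) (axis 1 1)) y
          + field_comp (atl G) x (cube_field (E_section x (\<chi> i. w $ i $ 2)) (axis 1 1) (axis 1 1) (axis 2 1)) y
          + field_comp (atl G) x (cube_field (E_section x (\<chi> i. w $ i $ 3)) (axis 2 1) (axis 2 1) (axis 1 1)) y
          + field_comp (atl G) x (cube_field (E_section x (\<chi> i. w $ i $ 4)) (axis 2 1) (axis 2 1) (axis 2 1)) y"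
          if "y \<in> W" for y
        proof -
          have lin: "clinear_map (dir (atl G) (chart_map (atl G) x) y)"
            using that by (intro clinear_dir cdiff_chart_map) (simp add: W_def)
          show ?thesis
            unfolding L_def cubic_iso_eq[OF soldering] col field_comp_def cube_field_def spinor_axis clinear_map_simps(1)[OF lin] ..
        qed
        have c: "cdiff_at (atl G) x (field_comp (atl G) x (cube_field (E_section x v) a b c))" for v a b c
          by (rule holo_fieldD[OF secT_cube_field[OF E_dom(1) secE_E_section] E_dom(2)])
        show ?thesis
          by (rule cdiff_at_local[OF _ W]) (rule cdiff_add[OF cdiff_add[OF cdiff_add[OF c c] c] c], simp add: L)
      qed
    qed
    have expand: "C_basis y (E_section x v y) k = (\<Sum>i\<in>UNIV. v $ i *\<^sub>C C_basis y (E_section x (axis i 1) y) k)" for v y k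
    proof (rule clinear_map_basis)
      show "clinear_map (\<lambda>v. C_basis y (E_section x v y) k)"
        unfolding E_section_def by (rule clinear_map_compose[OF C_basis_linear clinear_map_matrix_mult(3)])
    qed
    have "cdiff_at (atl G) x (\<lambda>y. \<Sum>k\<in>UNIV. \<Sum>i\<in>UNIV. f y $ i $ k *\<^sub>C C_basis y (E_section x (axis i 1) y) k)"
      by (intro cdiff_sum cdiff_scaleC[OF centred] cdiff_vec_nth f C_basis_holo[OF E_dom(1,2) secE_E_section])
    then show "cdiff_at (atl G) x (\<lambda>y. AM y (X y))"
    proof (rule cdiff_at_local[OF _ W])
      fix y assume y: "y \<in> W"
      have "AM y (X y) = AM y (tangent_iso y (M y ** f y))"
        unfolding Mf[OF y] surj_f_inv_f[OF bij_is_surj[OF iso(1)]] ..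
      then show "(\<Sum>k\<in>UNIV. \<Sum>i\<in>UNIV. f y $ i $ k *\<^sub>C C_basis y (E_section x (axis i 1) y) k) = AM y (X y)"
        unfolding base_iso col expand[of y "\<chi> i. f y $ i $ k" for k] by simp
    qed
  qed
qed

section \<open>Curvature of the connection over \<open>M\<close>\<close>

lemma base_flat:
  assumes ab: "eps a b = 1" and U: "open U" "x \<in> U" and e: "secE G U e" "secE G U e'"
    and X: "X = cube_field e a a a \<and> (Y = cube_field e' a a a \<or> Y = cube_field e' a a b) \<or> X = cube_field e a a b \<and> Y = cube_field e' a a b"
  shows "curvature (atl G) AM X Y x = 0"
proof -
  define u where "u = (a, b)"
  have u: "u \<in> Sp1C" and ua: "up u = a" "um u = b" using ab by (simp_all add: Sp1C_def u_def)
  have sX: "secT G U X" and sY: "secT G U Y" using X secT_cube_field[OF U(1)] e by auto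
  have "\<forall>U e e'. open U \<and> secE G U e \<and> secE G U e' \<longrightarrow>
          (\<forall>p\<in>U \<times> Sp1C.
             curvature \<sigma> A (XSH G h up up up e) (XSH G h up up up e') p = 0 \<and>
             curvature \<sigma> A (XSH G h up up up e) (XSH G h up up um e') p = 0 \<and>
             curvature \<sigma> A (XSH G h up up um e) (XSH G h up up um e') p = 0)"
    using almost_flat unfolding almost_one_partially_flat_def Let_def by (rule conjunct1)
  from bspec[OF mp[OF this[THEN spec[of _ U], THEN spec[of _ e], THEN spec[of _ e']] conjI[OF U(1) conjI[OF e]]], of "(x, u)"]
  have "curvature (atl G) (\<lambda>y v. A (y, u) (v, 0)) X Y x = 0"
    using X U(2) u by (auto simp: curvature_XSH_slice[OF _ _ _ _ _ _ U e u connection] ua)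
  then have "curvature (atl G) (slice_potential u) X Y x = 0"
    unfolding slice_potential_def
    by (rule gauge_flat[OF connection_form_slice[OF u connection] psi_slice(1)[OF u] psi_slice(2)[OF u] U sX sY])
  moreover have eq: "AM y (cube_field d a a a y) = slice_potential u y (cube_field d a a a y)"
    "AM y (cube_field d a a b y) = slice_potential u y (cube_field d a a b y)" for y d
    unfolding base_cube_field using slice_potential_cube[OF u, of y d] by (simp_all add: ua)
  have "curvature (atl G) AM X Y x = curvature (atl G) (slice_potential u) X Y x"
  proof (rule curvature_eq_of_agree[OF slice_potential[OF u] U sX sY])
    show "AM y (X y) = slice_potential u y (X y)" "AM y (Y y) = slice_potential u y (Y y)" for y
      using X eq by auto
    have "bracket (atl G) X Y x \<in> dist a b x"
      by (rule bracket_dist[OF admissible ab U e]) (use X in auto)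
    then show "AM x (bracket (atl G) X Y x) = slice_potential u x (bracket (atl G) X Y x)"
      unfolding dist_def by (auto simp: clinear_map_simps[OF base_linear] clinear_map_simps[OF conn_linear[OF slice_potential[OF u]]] eq)
  qed
  ultimately show ?thesis by simp
qed

lemmas base_curv_linear = curv_linear(1)[OF base_connection] curv_linear(2)[OF base_connection]

text \<open>Vectors of the fibre are extended to holomorphic sections by \<open>E_section\<close>;
  tensoriality of the curvature then turns \<open>base_flat\<close> into a statement about the
  single point \<open>x\<close>.\<close>

lemma base_curv_vanish:
  assumes "eps a b = 1" and l: "l = a $ 1 *\<^sub>C h 1 x + a $ 2 *\<^sub>C h 2 x" and m: "m = b $ 1 *\<^sub>C h 1 x + b $ 2 *\<^sub>C h 2 x"
  shows "curv AM x (cube (sol x) e l l l) (cube (sol x) e' l l l) = 0 \<and>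
    curv AM x (cube (sol x) e l l l) (cube (sol x) e' l l m) = 0 \<and>
    curv AM x (cube (sol x) e l l m) (cube (sol x) e' l l m) = 0"
proof -
  define d where "d w = E_section x (snd (bunE G x) x *v w)" for w
  have d: "secE G (E_dom x) (d w)" "d w x = w" for w unfolding d_def by (rule secE_E_section, rule E_section_self)
  have lm: "l = spinor a x" "m = spinor b x" using l m by (simp_all add: spinor_def)
  have c: "cdiff_at (atl G) x (field_comp (atl G) x (cube_field (d w) a b c))" for w a b c
    by (rule holo_fieldD[OF secT_cube_field[OF E_dom(1) d(1)] E_dom(2)])
  have "curv AM x (cube_field (d e) a1 a2 a3 x) (cube_field (d e') b1 b2 b3 x)
     = curvature (atl G) AM (cube_field (d e) a1 a2 a3) (cube_field (d e') b1 b2 b3) x" for a1 a2 a3 b1 b2 b3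
    by (rule curvature_eq_curv[OF base_connection c c, symmetric])
  then show ?thesis
    using base_flat[OF assms(1) E_dom(1,2) d(1)[of e] d(1)[of e'], of "cube_field (d e) a a a" "cube_field (d e') a a a"]
      base_flat[OF assms(1) E_dom(1,2) d(1)[of e] d(1)[of e'], of "cube_field (d e) a a a" "cube_field (d e') a a b"]
      base_flat[OF assms(1) E_dom(1,2) d(1)[of e] d(1)[of e'], of "cube_field (d e) a a b" "cube_field (d e') a a b"]
    by (simp add: cube_field_def[of _ _ _ _ x] d(2) lm)
qed

definition F3 :: "'x \<Rightarrow> complex^'p \<Rightarrow> complex^'p \<Rightarrow> complex^'r^'r" where
  "F3 x = cube_form (sol x) (curv AM x) (h 1 x) (h 2 x)"

lemma F3_commute: "F3 x e' e = F3 x e e'"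
  unfolding F3_def
  by (rule cube_form_commute[OF soldering base_curv_linear curv_anti[OF base_connection] base_curv_vanish])

lemma F3_bilinear: "complex_bilinear (F3 x)"
  unfolding F3_def
  by (rule complex_bilinear_cube_form[OF soldering base_curv_linear curv_anti[OF base_connection] base_curv_vanish])

text \<open>All curvature of the base connection is contained in this one formula, from which the
  partial flatness over \<open>M\<close> and over \<open>S_H\<close> are both read off. The spinors
  enter through their coefficients in the frame \<open>h\<close>, on which the symplectic form is
  \<open>eps\<close>.\<close>

lemma base_curvature_cube_field:
  assumes U: "open U" "x \<in> U" and e: "secE G U e" "secE G U e'"
  shows "curvature (atl G) AM (cube_field e (p 1) (p 2) (p 3)) (cube_field e' (q 1) (q 2) (q 3)) x
    = (6 * perm3 (\<lambda>i j. eps (p i) (q j))) *\<^sub>C F3 x (e x) (e' x)"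
proof -
  have c: "cdiff_at (atl G) x (field_comp (atl G) x (cube_field d a b c))" if "secE G U d" for d a b c
    by (rule holo_fieldD[OF secT_cube_field[OF U(1) that] U(2)])
  have "curvature (atl G) AM (cube_field e (p 1) (p 2) (p 3)) (cube_field e' (q 1) (q 2) (q 3)) x
    = curv AM x (cube (sol x) (e x) (spinor (p 1) x) (spinor (p 2) x) (spinor (p 3) x))
        (cube (sol x) (e' x) (spinor (q 1) x) (spinor (q 2) x) (spinor (q 3) x))"
    unfolding curvature_eq_curv[OF base_connection c[OF e(1)] c[OF e(2)]] cube_field_def ..
  also have "\<dots> = (6 * perm3 (\<lambda>i j. eps (p i) (q j))) *\<^sub>C F3 x (e x) (e' x)"
    unfolding F3_def
    by (rule cube_pairing[where P = "\<lambda>i. spinor (p i) x" and Q = "\<lambda>i. spinor (q i) x",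
          OF soldering base_curv_linear curv_anti[OF base_connection] base_curv_vanish])
       (simp_all add: spinor_def)
  finally show ?thesis .
qed

lemma one_partially_flat_base: "one_partially_flat_M G h AM"
  unfolding one_partially_flat_M_def
proof (intro allI exI conjI)
  fix x
  show "curvature_components G h AM x (\<lambda>I e e'. 0) (\<lambda>I e e'. 0) (\<lambda>I e e'. 0) (F3 x)"
    unfolding curvature_components_def
  proof (intro conjI allI impI)
    show "F3 x e' e = F3 x e e'" for e e' by (rule F3_commute)
    show "complex_bilinear (F3 x)" by (rule F3_bilinear)
    fix U e e' and a b :: "3 \<Rightarrow> 2" assume "open U \<and> x \<in> U \<and> secE G U e \<and> secE G U e'"
    then have U: "open U" "x \<in> U" and e: "secE G U e" "secE G U e'" by auto
    have "curvature (atl G) AM (Xfield G h e (a 1) (a 2) (a 3)) (Xfield G h e' (b 1) (b 2) (b 3)) x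
      = (\<Sum>\<sigma> | bij (\<sigma> :: 3 \<Rightarrow> 3). \<Sum>\<tau> | bij (\<tau> :: 3 \<Rightarrow> 3).
          eps (axis (a (\<sigma> 1)) 1) (axis (b (\<tau> 1)) 1) * eps (axis (a (\<sigma> 2)) 1) (axis (b (\<tau> 2)) 1) *
          eps (axis (a (\<sigma> 3)) 1) (axis (b (\<tau> 3)) 1)) *\<^sub>C F3 x (e x) (e' x)"
      unfolding sum_bij_perm3[of "\<lambda>i j. eps (axis (a i) 1) (axis (b j) 1)"] Xfield_cube_field
      by (rule base_curvature_cube_field[OF U e, of "\<lambda>i. axis (a i) 1" "\<lambda>j. axis (b j) 1"])
    then show "curvature (atl G) AM (Xfield G h e (a 1) (a 2) (a 3)) (Xfield G h e' (b 1) (b 2) (b 3)) x =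
           (\<Sum>\<sigma> | bij (\<sigma> :: 3 \<Rightarrow> 3). \<Sum>\<tau> | bij (\<tau> :: 3 \<Rightarrow> 3).
              let \<omega> = (\<lambda>i. omegaH G x (h (a (\<sigma> i)) x) (h (b (\<tau> i)) x)) in
              0 + \<omega> 1 *\<^sub>C 0 + (\<omega> 1 * \<omega> 2) *\<^sub>C 0 + (\<omega> 1 * \<omega> 2 * \<omega> 3) *\<^sub>C F3 x (e x) (e' x))"
      unfolding Let_def omega_frame by (simp add: scaleC.sum_left)
  qed (simp_all add: complex_bilinear_def clinear_on_def)
qed (rule refl)+

section \<open>The connection over \<open>S_H\<close> as a pull-back\<close>

context
  fixes Ahat assumes Ahat: "hat_potential G h C Ahat"
begin

text \<open>Both sides are linear on the tangent space and agree on fields that span it: the four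
  families of horizontal fields by \<open>cube_span\<close>, and the three vertical fields, on which
  both vanish.\<close>

lemma hat_eq_pullback:
  assumes p: "p \<in> SH" and v: "v \<in> SH_tangent p"
  shows "Ahat p v = AM (fst p) (fst v)"
proof -
  obtain x u where xu: "p = (x, u)" by (cases p)
  obtain v1 w where vw: "v = (v1, w)" by (cases v)
  have u: "eps (up u) (um u) = 1" using p xu by (simp add: SH_def Sp1C_def)
  have t: "eps (up w) (um u) + eps (up u) (um w) = 0" using v by (simp add: xu vw SH_tangent_iff)
  have lin: "clinear_on (SH_tangent p) (Ahat p)"
    and X: "\<And>e. Ahat p (XSH G h up up up (\<lambda>_. e) p) = CSH C up up up e p"
      "\<And>e. Ahat p (XSH G h up up um (\<lambda>_. e) p) = CSH C up up um e p"
      "\<And>e. Ahat p (XSH G h um um up (\<lambda>_. e) p) = CSH C um um up e p"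
      "\<And>e. Ahat p (XSH G h um um um (\<lambda>_. e) p) = CSH C um um um e p"
    and V: "Ahat p (d_pp p) = 0" "Ahat p (d_mm p) = 0" "Ahat p (d_0 p) = 0"
    using Ahat p unfolding hat_potential_def by blast+
  note add = clinear_onD(1)[OF lin] and scale = clinear_onD(2)[OF lin]
  have hor: "Ahat p (cube_field (\<lambda>_. e) (a u) (b u) (c u) x, 0) = AM x (cube_field (\<lambda>_. e) (a u) (b u) (c u) x)"
    if "(a, b, c) \<in> {(up, up, up), (up, up, um), (um, um, up), (um, um, um)}" for a b c e
    using that X[of e] unfolding xu XSH_eq CSH_eq base_cube_field by auto
  have "Ahat p (v1, 0) = AM x v1"
  proof -
    have "eps (spinor (up u) x) (spinor (um u) x) \<noteq> 0" by (simp add: eps_spinor u eps_frame)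
    then obtain w1 w2 w3 w4 where v1: "v1 = cube_field (\<lambda>_. w1) (up u) (up u) (up u) x + cube_field (\<lambda>_. w2) (up u) (up u) (um u) x
        + cube_field (\<lambda>_. w3) (um u) (um u) (up u) x + cube_field (\<lambda>_. w4) (um u) (um u) (um u) x"
      unfolding cube_field_def by (rule cube_span[OF soldering])
    have "Ahat p (a + b, 0) = Ahat p (a, 0) + Ahat p (b, 0)" for a b
      using add[of "(a, 0)" "(b, 0)"] by simp
    then show ?thesis
      unfolding v1 clinear_map_simps(1)[OF base_linear]
      using hor[of up up up w1] hor[of up up um w2] hor[of um um up w3] hor[of um um um w4] by simp
  qed
  moreover have "Ahat p (0, w) = 0"
  proof -
    have T: "(0, (um u, 0)) \<in> SH_tangent p" "(0, (0, up u)) \<in> SH_tangent p" "(0, (up u, - um u)) \<in> SH_tangent p"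
      by (simp_all add: xu SH_tangent_iff eps_simps)
    have exp: "a = eps a (um u) *\<^sub>C up u + eps (up u) a *\<^sub>C um u" for a
      using u by (simp add: vec_eq_iff forall_2 scaleC_complex_def eps_def) algebra
    \<comment> \<open>Both spinors of \<open>w\<close> are expanded in the basis u_+, u_-. The
      tangency equation identifies two of the four coefficients up to sign, which leaves the
      coefficients of \<open>d_0\<close>, \<open>d_mm\<close> and \<open>d_pp\<close>.\<close>
    have w: "(0, w) = eps (up w) (um u) *\<^sub>C (0, (up u, - um u)) + (eps (up u) (up w) *\<^sub>C (0, (um u, 0)) + eps (um w) (um u) *\<^sub>C (0, (0, up u)))"
    proof -
      have "um w = eps (um w) (um u) *\<^sub>C up u - eps (up w) (um u) *\<^sub>C um u"
        using exp[of "um w"] t by (metis add.commute eq_neg_iff_add_eq_0 scaleC.minus_left uminus_add_conv_diff)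
      then show ?thesis
        using exp[of "up w"] by (simp add: scaleC_Pair prod_eq_iff scaleC.minus_right)
    qed
    have V': "Ahat p (0, (up u, - um u)) = 0" "Ahat p (0, (um u, 0)) = 0" "Ahat p (0, (0, up u)) = 0"
      using V by (simp_all add: xu d_pp_def d_mm_def d_0_def)
    show ?thesis
      by (subst w) (simp add: add scale T SH_tangent_simps V')
  qed
  moreover have "(0, w) \<in> SH_tangent p" using v by (simp add: xu vw SH_tangent_iff)
  ultimately show ?thesis using add[of "(v1, 0)" "(0, w)"] by (simp add: xu vw)
qed

lemma hat_connection: "connection_form \<sigma> SH_tangent SH Ahat"
  by (rule connection_form_pullback[OF base_connection hat_eq_pullback])

lemma hat_curvature:
  assumes s: "s1 \<in> {up, um}" "s2 \<in> {up, um}" "s3 \<in> {up, um}" "t1 \<in> {up, um}" "t2 \<in> {up, um}" "t3 \<in> {up, um}"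
    and U: "open U" "x \<in> U" and e: "secE G U e" "secE G U e'" and u: "u \<in> Sp1C"
  shows "curvature \<sigma> Ahat (XSH G h s1 s2 s3 e) (XSH G h t1 t2 t3 e') (x, u)
    = (6 * perm3 (\<lambda>i j. eps (sel3 (s1 u) (s2 u) (s3 u) i) (sel3 (t1 u) (t2 u) (t3 u) j))) *\<^sub>C F3 x (e x) (e' x)"
proof -
  have "(\<lambda>y v. Ahat (y, u) (v, 0)) = AM"
    using hat_eq_pullback[of "(y, u)" "(v, 0)" for y v] u by (simp add: fun_eq_iff SH_def)
  then show ?thesis
    using base_curvature_cube_field[OF U e, of "sel3 (s1 u) (s2 u) (s3 u)" "sel3 (t1 u) (t2 u) (t3 u)"]
    unfolding curvature_XSH_slice[OF s U e u hat_connection] by simp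
qed

text \<open>The vanishing conditions are vanishing permanents: pairings of a spinor with itself give
  the matrix a zero column, or, for two cubics s^2 t, a zero block of size 2 by 2. Vertical
  directions are covered by the pull-back property.\<close>

lemma one_partially_flat_hat: "one_partially_flat_SH G h Ahat"
  unfolding one_partially_flat_SH_def Let_def
proof (intro conjI)
  show "\<forall>U e e'. open U \<and> secE G U e \<and> secE G U e' \<longrightarrow>
          (\<forall>p\<in>U \<times> Sp1C. \<forall>(s, t)\<in>signs.
             curvature \<sigma> Ahat (XSH G h s s s e) (XSH G h s s s e') p = 0 \<and>
             curvature \<sigma> Ahat (XSH G h s s s e') (XSH G h s s t e) p = 0 \<and>
             curvature \<sigma> Ahat (XSH G h s s t e) (XSH G h s s t e') p = 0 \<and>
             curvature \<sigma> Ahat (XSH G h s s s e) (XSH G h t t s e') p = 0)"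
  proof safe
    fix U e e' x u s t assume U: "open U" "x \<in> U" and e: "secE G U e" "secE G U e'" and u: "u \<in> Sp1C" and st: "(s, t) \<in> signs"
    have s: "s \<in> {up, um}" and t: "t \<in> {up, um}" using st by (auto simp: signs_def)
    show "curvature \<sigma> Ahat (XSH G h s s s e) (XSH G h s s s e') (x, u) = 0"
      unfolding hat_curvature[OF s s s s s s U e u] by (simp add: perm3_def)
    show "curvature \<sigma> Ahat (XSH G h s s s e') (XSH G h s s t e) (x, u) = 0"
      unfolding hat_curvature[OF s s s s s t U e(2) e(1) u] by (simp add: perm3_def)
    show "curvature \<sigma> Ahat (XSH G h s s t e) (XSH G h s s t e') (x, u) = 0"
      unfolding hat_curvature[OF s s t s s t U e u] by (simp add: perm3_def)
    show "curvature \<sigma> Ahat (XSH G h s s s e) (XSH G h t t s e') (x, u) = 0"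
      unfolding hat_curvature[OF s s s t t s U e u] by (simp add: perm3_def)
  qed
  show "\<exists>F3 :: 'x \<times> spinor_pair \<Rightarrow> complex ^ 'p \<Rightarrow> complex ^ 'p \<Rightarrow> complex ^ 'r ^ 'r.
          (\<forall>p e e'. F3 p e' e = F3 p e e') \<and>
          (\<forall>U e e'. open U \<and> secE G U e \<and> secE G U e' \<longrightarrow>
             (\<forall>p\<in>U \<times> Sp1C.
                curvature \<sigma> Ahat (XSH G h up up up e) (XSH G h um um um e') p = 36 *\<^sub>C F3 p (e (fst p)) (e' (fst p)) \<and>
                curvature \<sigma> Ahat (XSH G h up up um e) (XSH G h um um up e') p = (- 12) *\<^sub>C F3 p (e (fst p)) (e' (fst p))))"
  proof (rule exI[of _ "\<lambda>p. F3 (fst p)"], intro conjI allI impI ballI)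
    show "F3 (fst p) e' e = F3 (fst p) e e'" for p :: "'x \<times> spinor_pair" and e e' by (rule F3_commute)
    fix U e e' and p :: "'x \<times> spinor_pair" assume a: "open U \<and> secE G U e \<and> secE G U e'" "p \<in> U \<times> Sp1C"
    obtain x u where p: "p = (x, u)" by (cases p)
    have U: "open U" "x \<in> U" and e: "secE G U e" "secE G U e'" and u: "u \<in> Sp1C" using a p by auto
    have s: "up \<in> {up, um}" "um \<in> {up, um}" by auto
    have eps: "eps (up u) (um u) = 1" "eps (um u) (up u) = - 1" using u eps_swap[of "um u" "up u"] by (simp_all add: Sp1C_def)
    \<comment> \<open>All nine pairings are 1, so the permanent is 6 and the constant is 6 *
      6.\<close>
    show "curvature \<sigma> Ahat (XSH G h up up up e) (XSH G h um um um e') p = 36 *\<^sub>C F3 (fst p) (e (fst p)) (e' (fst p))"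
      unfolding p hat_curvature[OF s(1) s(1) s(1) s(2) s(2) s(2) U e u] by (simp add: perm3_def eps)
    \<comment> \<open>The pairings form a 2 by 2 block of ones and the entry -1, so the permanent is
      -2 and the constant is 6 * (-2).\<close>
    show "curvature \<sigma> Ahat (XSH G h up up um e) (XSH G h um um up e') p = (- 12) *\<^sub>C F3 (fst p) (e (fst p)) (e' (fst p))"
      unfolding p hat_curvature[OF s(1) s(1) s(2) s(2) s(2) s(1) U e u] by (simp add: perm3_def eps)
  qed
  show "\<forall>V Z Y. openin (top_of_set SH) V \<and> holo_field \<sigma> SH_tangent V Z \<and>
                holo_field \<sigma> SH_tangent V Y \<and> (\<forall>p\<in>V. vertical (Z p)) \<longrightarrow>
          (\<forall>p\<in>V. curvature \<sigma> Ahat Z Y p = 0)"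
  proof safe
    fix V Z Y and x :: 'x and a b :: "complex^2"
    assume V: "openin (top_of_set SH) V" "(x, a, b) \<in> V" and Z: "holo_field \<sigma> SH_tangent V Z"
      and Y: "holo_field \<sigma> SH_tangent V Y" and v: "\<forall>p\<in>V. vertical (Z p)"
    show "curvature \<sigma> Ahat Z Y (x, a, b) = 0"
      by (rule curvature_pullback_vertical[OF base_connection hat_eq_pullback V Z Y]) (use v in auto)
  qed
qed

end

lemma hat_potential_pullback: "hat_potential G h C (pullback_form AM)"
  unfolding hat_potential_def
proof (intro ballI conjI allI)
  fix p :: "'x \<times> spinor_pair" and e
  obtain x u where p: "p = (x, u)" by (cases p)
  show "clinear_on (SH_tangent p) (pullback_form AM p)"
    by (rule clinear_onI) (simp_all add: pullback_form_def clinear_map_simps[OF base_linear])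
  show "pullback_form AM p (XSH G h up up up (\<lambda>_. e) p) = CSH C up up up e p"
    "pullback_form AM p (XSH G h up up um (\<lambda>_. e) p) = CSH C up up um e p"
    "pullback_form AM p (XSH G h um um up (\<lambda>_. e) p) = CSH C um um up e p"
    "pullback_form AM p (XSH G h um um um (\<lambda>_. e) p) = CSH C um um um e p"
    by (simp_all add: p pullback_form_def XSH_eq CSH_eq base_cube_field)
  show "pullback_form AM p (d_pp p) = 0" "pullback_form AM p (d_mm p) = 0" "pullback_form AM p (d_0 p) = 0"
    by (simp_all add: p pullback_form_def d_pp_def d_mm_def d_0_def clinear_map_simps[OF base_linear])
qed

end
end

text \<open>The two connections are prescribed by their values on spanning fields, hence the split
  into existence and a claim about every potential with these values. Over \<open>S_H\<close>
  equality with the pull-back is asserted on tangent vectors, where the potential is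
  determined.\<close>

theorem theorem9:
  fixes G :: "('x::{t2_space, second_countable_topology}, 'm::finite, 'p::finite) grassmann"
    and h :: "2 \<Rightarrow> 'x \<Rightarrow> complex ^ 2"
    and A :: "'x \<times> spinor_pair \<Rightarrow> (complex ^ 'm) \<times> spinor_pair \<Rightarrow> complex ^ 'r::finite ^ 'r"
    and \<psi> :: "'x \<times> spinor_pair \<Rightarrow> complex ^ 'r ^ 'r"
    and C :: "'x \<Rightarrow> complex ^ 'p \<Rightarrow> 2 \<Rightarrow> 2 \<Rightarrow> 2 \<Rightarrow> complex ^ 'r ^ 'r"
  assumes half_flat: "half_flat_grassmann G"
    and frame: "parallel_symplectic_frame G h"
    and admissible: "one_admissible G h"
    and connection: "connection_form (atlSH G) SH_tangent SH A"
    and almost_flat: "almost_one_partially_flat G h A"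
    and central: "central_frame G A \<psi>"
    and symmetric: "\<And>x e \<alpha> \<beta> \<gamma>. C x e \<alpha> \<beta> \<gamma> = C x e \<beta> \<alpha> \<gamma> \<and> C x e \<alpha> \<beta> \<gamma> = C x e \<alpha> \<gamma> \<beta>"
    and potential_3: "\<And>p e. p \<in> SH \<Longrightarrow>
      potential G A \<psi> p (XSH G h up up up (\<lambda>_. e) p) = CSH C up up up e p"
    and potential_1: "\<And>p e. p \<in> SH \<Longrightarrow>
      potential G A \<psi> p (XSH G h up up um (\<lambda>_. e) p) = CSH C up up um e p"
  shows "(\<exists>Ahat. hat_potential G h C Ahat) \<and>
    (\<exists>AM. base_potential G h C AM) \<and>
    (\<forall>Ahat AM. hat_potential G h C Ahat \<and> base_potential G h C AM \<longrightarrow>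
       connection_form (atlSH G) SH_tangent SH Ahat \<and>
       one_partially_flat_SH G h Ahat \<and>
       connection_form (atl G) full_tangent UNIV AM \<and>
       one_partially_flat_M G h AM \<and>
       (\<forall>p\<in>SH. \<forall>v\<in>SH_tangent p. Ahat p v = pullback_form AM p v))"
proof -
  interpret grassmann_potential G h A \<psi> C
  proof unfold_locales
    show "C x e \<alpha> \<beta> \<gamma> = C x e \<beta> \<alpha> \<gamma> \<and> C x e \<alpha> \<beta> \<gamma> = C x e \<alpha> \<gamma> \<beta>" for x e \<alpha> \<beta> \<gamma> by (rule symmetric)
  qed (fact half_flat frame admissible connection almost_flat central potential_3 potential_1)+
  show ?thesis
  proof (intro conjI allI impI ballI)
    show "\<exists>AM. base_potential G h C AM" by (rule exI, rule base_potential_base_form)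
    show "\<exists>Ahat. hat_potential G h C Ahat" by (rule exI, rule hat_potential_pullback[OF base_potential_base_form])
    fix Ahat AM assume "hat_potential G h C Ahat \<and> base_potential G h C AM"
    then have Ahat: "hat_potential G h C Ahat" and AM: "base_potential G h C AM" by simp_all
    show "connection_form (atlSH G) SH_tangent SH Ahat" by (rule hat_connection[OF AM Ahat])
    show "one_partially_flat_SH G h Ahat" by (rule one_partially_flat_hat[OF AM Ahat])
    show "connection_form (atl G) full_tangent UNIV AM" by (rule base_connection[OF AM])
    show "one_partially_flat_M G h AM" by (rule one_partially_flat_base[OF AM])
    show "Ahat p v = pullback_form AM p v" if "p \<in> SH" "v \<in> SH_tangent p" for p v
      using hat_eq_pullback[OF AM Ahat that] by (simp add: pullback_form_def)
  qed
qed

end
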